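(* Let $A$ and $B$ be two lower-semibounded self-adjoint operators on a Hilbert space $\mathcal{H}$, with associated closed symmetric lower-semibounded quadratic forms $q_A$ and $q_B$ and form domains $Q(A)$ and $Q(B)$. Suppose that $Q(B)\subset Q(A)$ and that $q_A(\psi)\le q_B(\psi)$ for all $\psi\in Q(B)$. Let $P_B$ be the orthogonal projection onto a closed $B$-invariant subspace such that, for some $m\in\mathbb{N}$ and for all $a>-\inf\sigma(A)$, the operator $P_B(B+a)^{-m}$ is trace class. Then: (1) For all $n\in\mathbb{N}$ large enough that $m<2^n$, and for all $a>-\inf\sigma(A)$, $$\mathrm{Tr}\big(P_B(B+a)^{-2^n}\big)\le \mathrm{Tr}\big(P_B(A+a)^{-2^n}\big).$$ (2) For any $t>0$, $$\mathrm{Tr}\big(P_B e^{-tB}\big)\le \mathrm{Tr}\big(P_B e^{-tA}\big).$$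
   Context: $\sigma(A)$ denotes the spectrum of $A$. Functions of self-adjoint operators are defined by the spectral functional calculus. "$B$-invariant subspace" means that the subspace reduces $B$, i.e. $P_B$ commutes with the resolvents of $B$ (equivalently, the closed subspace is invariant under $(B+a)^{-1}$). For a bounded nonnegative self-adjoint operator $X$, $\mathrm{Tr}(P_BX)$ is understood as $\mathrm{Tr}(P_BXP_B)\in[0,\infty]$; in particular the right-hand sides may equal $+\infty$. *)

theory Defs
  imports "HOL-Analysis.Analysis"
begin

section \<open>Complex Hilbert spaces\<close>

text \<open>The inner product \<open>cinner\<close> is antilinear in its first argument. The real inner product of
  the superclass is its real part, so norm and topology are the usual ones.\<close>

class chilbert = real_inner + complete_space +
  fixes scaleC :: "complex \<Rightarrow> 'a \<Rightarrow> 'a"  (infixr "*\<^sub>C" 75)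
    and cinner :: "'a \<Rightarrow> 'a \<Rightarrow> complex"
  assumes scaleC_add_right: "c *\<^sub>C (x + y) = c *\<^sub>C x + c *\<^sub>C y"
    and scaleC_add_left: "(c + d) *\<^sub>C x = c *\<^sub>C x + d *\<^sub>C x"
    and scaleC_scaleC: "c *\<^sub>C d *\<^sub>C x = (c * d) *\<^sub>C x"
    and scaleC_of_real: "complex_of_real r *\<^sub>C x = r *\<^sub>R x"
    and cinner_commute: "cinner x y = cnj (cinner y x)"
    and cinner_add_right: "cinner x (y + z) = cinner x y + cinner x z"
    and cinner_scaleC_right: "cinner x (c *\<^sub>C y) = c * cinner x y"
    and Re_cinner: "Re (cinner x y) = inner x y"

instantiation complex :: chilbert
begin

definition scaleC_complex :: "complex \<Rightarrow> complex \<Rightarrow> complex"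
  where "scaleC_complex c x = c * x"

definition cinner_complex :: "complex \<Rightarrow> complex \<Rightarrow> complex"
  where "cinner_complex x y = cnj x * y"

instance
  by standard
    (auto simp: scaleC_complex_def cinner_complex_def algebra_simps scaleR_conv_of_real
        inner_complex_def)

end

definition closed_csubspace :: "'h::chilbert set \<Rightarrow> bool" where
  "closed_csubspace V \<longleftrightarrow> closed V \<and> 0 \<in> V \<and> (\<forall>x\<in>V. \<forall>y\<in>V. x + y \<in> V) \<and> (\<forall>c. \<forall>x\<in>V. c *\<^sub>C x \<in> V)"

definition orth_proj :: "'h::chilbert set \<Rightarrow> 'h \<Rightarrow> 'h" where
  "orth_proj V x = (THE y. y \<in> V \<and> (\<forall>z\<in>V. cinner z (x - y) = 0))"

definition bounded_clinear :: "('h::chilbert \<Rightarrow> 'h) \<Rightarrow> bool" where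
  "bounded_clinear T \<longleftrightarrow> bounded_linear T \<and> (\<forall>c x. T (c *\<^sub>C x) = c *\<^sub>C T x)"

definition positive_op :: "('h::chilbert \<Rightarrow> 'h) \<Rightarrow> bool" where
  "positive_op T \<longleftrightarrow> bounded_clinear T \<and> (\<forall>x. cinner x (T x) \<in> \<real>\<^sub>\<ge>\<^sub>0)"

section \<open>Trace and trace class\<close>

text \<open>An orthonormal basis is a maximal orthonormal set.\<close>

definition orthonormal_basis :: "'h::chilbert set \<Rightarrow> bool" where
  "orthonormal_basis E \<longleftrightarrow>
     (\<forall>e\<in>E. \<forall>f\<in>E. cinner e f = (if e = f then 1 else 0)) \<and>
     (\<forall>x. (\<forall>e\<in>E. cinner e x = 0) \<longrightarrow> x = 0)"

text \<open>Trace in \<open>[0,\<infinity>]\<close>; meaningful for bounded nonnegative operators only, for which it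
  does not depend on the chosen orthonormal basis.\<close>

definition trace :: "('h::chilbert \<Rightarrow> 'h) \<Rightarrow> ennreal" where
  "trace T = (\<Sum>\<^sub>\<infinity>e\<in>(SOME E. orthonormal_basis E). ennreal (Re (cinner e (T e))))"

text \<open>The witness \<open>S\<close> is the absolute value of \<open>T\<close>: the nonnegative square root of
  \<open>T\<^sup>*T\<close>.\<close>

definition trace_class :: "('h::chilbert \<Rightarrow> 'h) \<Rightarrow> bool" where
  "trace_class T \<longleftrightarrow> bounded_clinear T \<and>
     (\<exists>S. positive_op S \<and> (\<forall>x y. cinner x (S (S y)) = cinner (T x) (T y)) \<and> trace S < \<infinity>)"

section \<open>Unbounded operators\<close>

text \<open>A possibly unbounded operator is represented by its graph; \<open>Domain A\<close> is its domain.\<close>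

type_synonym 'h operator = "('h \<times> 'h) set"

definition linear_operator :: "'h::chilbert operator \<Rightarrow> bool" where
  "linear_operator A \<longleftrightarrow> single_valued A \<and> (0, 0) \<in> A \<and>
     (\<forall>(x, y)\<in>A. \<forall>(x', y')\<in>A. (x + x', y + y') \<in> A) \<and>
     (\<forall>c. \<forall>(x, y)\<in>A. (c *\<^sub>C x, c *\<^sub>C y) \<in> A)"

definition app :: "'h operator \<Rightarrow> 'h \<Rightarrow> 'h" where
  "app A x = (THE y. (x, y) \<in> A)"

definition adjoint_op :: "'h::chilbert operator \<Rightarrow> 'h operator" where
  "adjoint_op A = {(u, v). \<forall>(x, y)\<in>A. cinner u y = cinner v x}"

definition self_adjoint :: "'h::chilbert operator \<Rightarrow> bool" where
  "self_adjoint A \<longleftrightarrow> linear_operator A \<and> closure (Domain A) = UNIV \<and> adjoint_op A = A"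

definition lower_semibounded :: "'h::chilbert operator \<Rightarrow> bool" where
  "lower_semibounded A \<longleftrightarrow> (\<exists>c. \<forall>x\<in>Domain A. c * (norm x)\<^sup>2 \<le> Re (cinner x (app A x)))"

text \<open>\<open>resolvent A z\<close> is \<open>(A - z)\<^sup>-\<^sup>1\<close>.\<close>

definition resolvent :: "'h::chilbert operator \<Rightarrow> complex \<Rightarrow> 'h \<Rightarrow> 'h" where
  "resolvent A z u = (THE x. x \<in> Domain A \<and> app A x - z *\<^sub>C x = u)"

definition resolvent_set :: "'h::chilbert operator \<Rightarrow> complex set" where
  "resolvent_set A =
     {z. (\<forall>u. \<exists>!x. x \<in> Domain A \<and> app A x - z *\<^sub>C x = u) \<and> bounded_clinear (resolvent A z)}"

definition spectrum :: "'h::chilbert operator \<Rightarrow> complex set" where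
  "spectrum A = - resolvent_set A"

text \<open>The spectrum of a self-adjoint operator is real. The infimum is an extended real, so that
  it is \<open>\<infinity>\<close> for the empty spectrum of the operator on the zero space.\<close>

definition inf_spectrum :: "'h::chilbert operator \<Rightarrow> ereal" where
  "inf_spectrum A = (INF z\<in>spectrum A. ereal (Re z))"

text \<open>\<open>inv_shift_pow A a k\<close> is \<open>(A + a)\<^sup>-\<^sup>k\<close>.\<close>

definition inv_shift_pow :: "'h::chilbert operator \<Rightarrow> real \<Rightarrow> nat \<Rightarrow> 'h \<Rightarrow> 'h" where
  "inv_shift_pow A a k = resolvent A (- complex_of_real a) ^^ k"

definition reduces :: "'h::chilbert set \<Rightarrow> 'h operator \<Rightarrow> bool" where
  "reduces V B \<longleftrightarrow>
     (\<forall>z\<in>resolvent_set B. orth_proj V \<circ> resolvent B z = resolvent B z \<circ> orth_proj V)"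

section \<open>Quadratic forms\<close>

text \<open>The form associated with a lower-semibounded self-adjoint operator \<open>A\<close> is the closure of
  \<open>\<psi> \<mapsto> \<langle>\<psi>, A \<psi>\<rangle>\<close> on \<open>Domain A\<close>.\<close>

definition op_form :: "'h::chilbert operator \<Rightarrow> 'h \<Rightarrow> real" where
  "op_form A x = Re (cinner x (app A x))"

definition form_approx :: "'h::chilbert operator \<Rightarrow> (nat \<Rightarrow> 'h) \<Rightarrow> 'h \<Rightarrow> bool" where
  "form_approx A X x \<longleftrightarrow> range X \<subseteq> Domain A \<and> X \<longlonglongrightarrow> x \<and>
     (\<forall>e>0. \<exists>N. \<forall>j\<ge>N. \<forall>k\<ge>N. \<bar>op_form A (X j - X k)\<bar> < e)"

definition form_domain :: "'h::chilbert operator \<Rightarrow> 'h set" where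
  "form_domain A = {x. \<exists>X. form_approx A X x}"

definition quad_form :: "'h::chilbert operator \<Rightarrow> 'h \<Rightarrow> real" where
  "quad_form A x = (THE r. \<exists>X. form_approx A X x \<and> (\<lambda>n. op_form A (X n)) \<longlonglongrightarrow> r)"

section \<open>Spectral functional calculus\<close>

definition projection_valued_measure :: "(real set \<Rightarrow> 'h::chilbert \<Rightarrow> 'h) \<Rightarrow> bool" where
  "projection_valued_measure E \<longleftrightarrow>
     (\<forall>S\<in>sets borel. bounded_clinear (E S) \<and> E S \<circ> E S = E S \<and>
        (\<forall>x y. cinner (E S x) y = cinner x (E S y))) \<and>
     E UNIV = id \<and>
     (\<forall>S\<in>sets borel. \<forall>T\<in>sets borel. E (S \<inter> T) = E S \<circ> E T) \<and>
     (\<forall>F. range F \<subseteq> sets borel \<longrightarrow> disjoint_family F \<longrightarrow>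
        (\<forall>x. (\<lambda>n::nat. E (F n) x) sums E (\<Union>n. F n) x))"

definition scalar_measure :: "(real set \<Rightarrow> 'h::chilbert \<Rightarrow> 'h) \<Rightarrow> 'h \<Rightarrow> real measure" where
  "scalar_measure E x = measure_of UNIV (sets borel) (\<lambda>S. ennreal (Re (cinner x (E S x))))"

text \<open>\<open>T = \<integral> f dE\<close>, with its natural domain. By polarization the diagonal matrix elements
  determine the linear operator \<open>T\<close>.\<close>

definition has_spectral_integral ::
    "(real set \<Rightarrow> 'h::chilbert \<Rightarrow> 'h) \<Rightarrow> (real \<Rightarrow> real) \<Rightarrow> 'h operator \<Rightarrow> bool" where
  "has_spectral_integral E f T \<longleftrightarrow> f \<in> borel_measurable borel \<and> linear_operator T \<and>
     Domain T = {x. integrable (scalar_measure E x) (\<lambda>s. (f s)\<^sup>2)} \<and>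
     (\<forall>(x, y)\<in>T. cinner x y = complex_of_real (integral\<^sup>L (scalar_measure E x) f))"

text \<open>The spectral measure of a self-adjoint operator is unique on Borel sets; its values on other
  sets are irrelevant.\<close>

definition spectral_measure :: "'h::chilbert operator \<Rightarrow> real set \<Rightarrow> 'h \<Rightarrow> 'h" where
  "spectral_measure A =
     (SOME E. projection_valued_measure E \<and> has_spectral_integral E (\<lambda>s. s) A)"

definition fun_calc :: "(real \<Rightarrow> real) \<Rightarrow> 'h::chilbert operator \<Rightarrow> 'h operator" where
  "fun_calc f A = (THE T. has_spectral_integral (spectral_measure A) f T)"

definition heat_op :: "real \<Rightarrow> 'h::chilbert operator \<Rightarrow> 'h \<Rightarrow> 'h" where
  "heat_op t A = app (fun_calc (\<lambda>s. exp (- t * s)) A)"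

text \<open>\<open>Tr(P X)\<close>, read as \<open>Tr(P X P)\<close>, for the orthogonal projection \<open>P\<close> onto \<open>V\<close>.\<close>

definition proj_trace :: "'h::chilbert set \<Rightarrow> ('h \<Rightarrow> 'h) \<Rightarrow> ennreal" where
  "proj_trace V X = trace (orth_proj V \<circ> X \<circ> orth_proj V)"

end

theory Submission imports Defs "HOL-Probability.Helly_Selection" begin

text \<open>Suppose that \<open>\<phi>\<close> is a unit vector in \<open>V\<close> with \<open>B \<phi> = \<lambda> \<phi>\<close>. The assumption on the forms says that the
  mean value of \<open>A\<close> in the state \<open>\<phi>\<close> is at most \<open>\<lambda>\<close>. For \<open>f s = (s + a)\<^sup>-\<^sup>k\<close> or \<open>f s = exp (- t s)\<close>, which is
  decreasing and convex, Jensen's inequality then gives \<open>\<langle>\<phi>, f(B) \<phi>\<rangle> = f \<lambda> \<le> \<langle>\<phi>, f(A) \<phi>\<rangle>\<close>, and a sum over an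
  orthonormal basis of \<open>V\<close> that consists of such eigenvectors proves the theorem.

  The proof below replaces eigenvectors by vectors in narrow spectral subspaces of \<open>B\<close>. Cut the half-line
  above the spectrum's lower bound into bins \<open>[l, l + d)\<close>. For a unit vector \<open>\<phi>\<close> in the spectral subspace of
  a bin, \<open>\<langle>\<phi>, f(B) \<phi>\<rangle> \<le> f l\<close>, while the mean value of \<open>A\<close> is at most \<open>l + d\<close>, so that
  \<open>f (l + d) \<le> \<langle>\<phi>, f(A) \<phi>\<rangle>\<close> by Jensen (\<open>inner_power_ge\<close> with \<open>resolvent_form_ge\<close>, and \<open>heat_form_ge\<close>). The ratio
  \<open>f l / f (l + d)\<close> is at most a constant \<open>K d\<close> that tends to \<open>1\<close> with \<open>d\<close>. Hence the trace for \<open>B\<close> is at most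
  \<open>K d\<close> times the trace for \<open>A\<close> (\<open>proj_trace_comparison\<close>), for every \<open>d > 0\<close>.

  The summation needs a basis of \<open>V\<close> adapted to the bins. It exists because the projection onto \<open>V\<close>
  commutes with the spectral projections of \<open>B\<close> (\<open>commuting_projection_halfline\<close>), and it may be used
  because the trace of a positive operator is independent of the basis (\<open>trace_eq\<close>).

  The heat operators are spectral integrals, so the existence of spectral measures is needed as well
  (\<open>spectral_theorem\<close>). For a positive contraction \<open>R\<close> the scalar measures solve Hausdorff's moment problem for
  the numbers \<open>\<langle>x, R\<^sup>j x\<rangle>\<close> (\<open>hausdorff_moment\<close>). Applied to a resolvent, this yields the spectral measure of
  a self-adjoint operator that is bounded below.\<close>

section \<open>Complex Hilbert spaces and bounded operators\<close>

instance chilbert \<subseteq> banach ..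

lemma scaleC_one [simp]: "1 *\<^sub>C (x::'a::chilbert) = x"
  using scaleC_of_real[of 1 x] by simp

lemma scaleC_zero_left [simp]: "0 *\<^sub>C (x::'a::chilbert) = 0"
  using scaleC_of_real[of 0 x] by simp

lemma scaleC_zero_right [simp]: "c *\<^sub>C (0::'a::chilbert) = 0"
  using scaleC_add_right[of c "0::'a" 0] by simp

lemma scaleC_minus_left: "(- c) *\<^sub>C (x::'a::chilbert) = - (c *\<^sub>C x)"
  using scaleC_add_left[of c "-c" x] by (simp add: eq_neg_iff_add_eq_0 add.commute)

lemma scaleC_minus_right: "c *\<^sub>C (- (x::'a::chilbert)) = - (c *\<^sub>C x)"
  using scaleC_add_right[of c x "-x"] by (simp add: eq_neg_iff_add_eq_0 add.commute)

lemma scaleC_diff_right: "c *\<^sub>C ((x::'a::chilbert) - y) = c *\<^sub>C x - c *\<^sub>C y"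
  using scaleC_add_right[of c x "-y"] by (simp add: scaleC_minus_right)

lemma scaleC_diff_left: "(c - d) *\<^sub>C (x::'a::chilbert) = c *\<^sub>C x - d *\<^sub>C x"
  using scaleC_add_left[of c "-d" x] by (simp add: scaleC_minus_left)

lemma scaleC_sum_right: "c *\<^sub>C (\<Sum>i\<in>F. (f i::'a::chilbert)) = (\<Sum>i\<in>F. c *\<^sub>C f i)"
  by (induction F rule: infinite_finite_induct) (auto simp: scaleC_add_right)

lemma scaleC_scaleR_commute: "c *\<^sub>C (r *\<^sub>R (x::'a::chilbert)) = r *\<^sub>R (c *\<^sub>C x)"
  by (simp add: scaleC_of_real[symmetric] scaleC_scaleC mult.commute)

lemma cinner_add_left: "cinner (x + y) (z::'a::chilbert) = cinner x z + cinner y z"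
  by (metis cinner_add_right cinner_commute complex_cnj_add)

lemma cinner_scaleC_left: "cinner (c *\<^sub>C x) (y::'a::chilbert) = cnj c * cinner x y"
  by (metis cinner_commute cinner_scaleC_right complex_cnj_mult)

lemma cinner_zero_right [simp]: "cinner (x::'a::chilbert) 0 = 0"
  using cinner_add_right[of x 0 0] by simp

lemma cinner_zero_left [simp]: "cinner 0 (x::'a::chilbert) = 0"
  using cinner_add_left[of 0 0 x] by simp

lemma cinner_minus_right: "cinner (x::'a::chilbert) (- y) = - cinner x y"
  using cinner_add_right[of x y "-y"] by (simp add: eq_neg_iff_add_eq_0 add.commute)

lemma cinner_minus_left: "cinner (- x) (y::'a::chilbert) = - cinner x y"
  using cinner_add_left[of x "-x" y] by (simp add: eq_neg_iff_add_eq_0 add.commute)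

lemma cinner_diff_right: "cinner (x::'a::chilbert) (y - z) = cinner x y - cinner x z"
  using cinner_add_right[of x y "-z"] by (simp add: cinner_minus_right)

lemma cinner_diff_left: "cinner (x - y) (z::'a::chilbert) = cinner x z - cinner y z"
  using cinner_add_left[of x "-y" z] by (simp add: cinner_minus_left)

lemma cinner_scaleR_right: "cinner (x::'a::chilbert) (r *\<^sub>R y) = of_real r * cinner x y"
  by (simp add: scaleC_of_real[symmetric] cinner_scaleC_right)

lemma cinner_scaleR_left: "cinner (r *\<^sub>R x) (y::'a::chilbert) = of_real r * cinner x y"
  by (simp add: scaleC_of_real[symmetric] cinner_scaleC_left)

lemma cinner_sum_right: "cinner (x::'a::chilbert) (\<Sum>i\<in>F. f i) = (\<Sum>i\<in>F. cinner x (f i))"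
  by (induction F rule: infinite_finite_induct) (auto simp: cinner_add_right)

lemma cinner_sum_left: "cinner (\<Sum>i\<in>F. f i) (x::'a::chilbert) = (\<Sum>i\<in>F. cinner (f i) x)"
  by (induction F rule: infinite_finite_induct) (auto simp: cinner_add_left)

lemmas cinner_simps = cinner_add_left cinner_add_right cinner_diff_left cinner_diff_right
  cinner_minus_left cinner_minus_right cinner_scaleC_left cinner_scaleC_right
  cinner_scaleR_left cinner_scaleR_right

lemma Im_cinner: "Im (cinner x (y::'a::chilbert)) = inner (\<i> *\<^sub>C x) y"
  using Re_cinner[of "\<i> *\<^sub>C x" y] by (simp add: cinner_scaleC_left)

lemma cinner_self: "cinner x (x::'a::chilbert) = complex_of_real ((norm x)\<^sup>2)"
proof (rule complex_eqI)
  show "Re (cinner x x) = Re (complex_of_real ((norm x)\<^sup>2))"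
    by (simp add: Re_cinner power2_norm_eq_inner)
  have "Im (cinner x x) = - Im (cinner x x)"
    by (metis cinner_commute complex_cnj cnj.simps(2))
  then show "Im (cinner x x) = Im (complex_of_real ((norm x)\<^sup>2))" by simp
qed

lemma cinner_self_eq_0 [simp]: "cinner x (x::'a::chilbert) = 0 \<longleftrightarrow> x = 0"
  by (simp add: cinner_self)

lemma cinner_extensionality: "(\<And>y. cinner y x = 0) \<Longrightarrow> (x::'a::chilbert) = 0"
  by (metis cinner_self_eq_0)

lemma norm_scaleC: "norm (c *\<^sub>C (x::'a::chilbert)) = cmod c * norm x"
proof -
  have "complex_of_real ((norm (c *\<^sub>C x))\<^sup>2) = complex_of_real ((cmod c * norm x)\<^sup>2)"
    unfolding cinner_self[symmetric] cinner_scaleC_left cinner_scaleC_right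
    by (simp add: cinner_self power_mult_distrib mult.assoc[symmetric] complex_norm_square[symmetric]
        mult.commute)
  then have "(norm (c *\<^sub>C x))\<^sup>2 = (cmod c * norm x)\<^sup>2" by (rule of_real_eq_iff[THEN iffD1])
  then show ?thesis by (rule power2_eq_imp_eq) auto
qed

lemma norm_cinner_le: "cmod (cinner x (y::'a::chilbert)) \<le> norm x * norm y"
proof (cases "cinner x y = 0")
  case False
  \<comment> \<open>rotate the phase of \<open>y\<close> until the inner product is real\<close>
  define u where "u = cnj (sgn (cinner x y))"
  have "cmod (cinner x y) = Re (u * cinner x y)"
  proof -
    have "u * cinner x y = complex_of_real (cmod (cinner x y))"
      using False unfolding u_def sgn_eq
      by (simp add: complex_norm_square[symmetric] power2_eq_square field_simps
          flip: complex_norm_square of_real_power)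
    then show ?thesis by simp
  qed
  also have "\<dots> = inner x (u *\<^sub>C y)" by (simp add: Re_cinner[symmetric] cinner_scaleC_right)
  also have "\<dots> \<le> norm x * norm (u *\<^sub>C y)" by (rule norm_cauchy_schwarz)
  also have "\<dots> = norm x * norm y" using False by (simp add: norm_scaleC u_def norm_sgn)
  finally show ?thesis .
qed auto

lemma bounded_bilinear_cinner: "bounded_bilinear (cinner :: 'a::chilbert \<Rightarrow> _)"
proof
  show "\<exists>K. \<forall>a b::'a. norm (cinner a b) \<le> norm a * norm b * K"
    using norm_cinner_le by (intro exI[of _ 1]) auto
qed (auto simp: cinner_simps scaleR_conv_of_real)

lemma tendsto_cinner:
  "(f \<longlongrightarrow> (x::'a::chilbert)) F \<Longrightarrow> (g \<longlongrightarrow> y) F \<Longrightarrow> ((\<lambda>n. cinner (f n) (g n)) \<longlongrightarrow> cinner x y) F"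
  by (rule bounded_bilinear.tendsto[OF bounded_bilinear_cinner])

lemma tendsto_scaleC: "(f \<longlongrightarrow> (x::'a::chilbert)) F \<Longrightarrow> ((\<lambda>n. c *\<^sub>C f n) \<longlongrightarrow> c *\<^sub>C x) F"
proof -
  have "bounded_linear (\<lambda>x::'a. c *\<^sub>C x)"
    by (rule bounded_linear_intro[where K="cmod c"])
       (auto simp: scaleC_add_right scaleC_scaleR_commute norm_scaleC mult.commute)
  then show "(f \<longlongrightarrow> x) F \<Longrightarrow> ((\<lambda>n. c *\<^sub>C f n) \<longlongrightarrow> c *\<^sub>C x) F" by (rule bounded_linear.tendsto)
qed

lemma pythagoras_cinner:
  fixes x y :: "'a::chilbert"
  assumes "cinner x y = 0"
  shows "(norm (x + y))\<^sup>2 = (norm x)\<^sup>2 + (norm y)\<^sup>2"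
proof -
  have "inner x y = 0" using assms by (simp add: Re_cinner[symmetric])
  then show ?thesis by (simp add: power2_norm_eq_inner inner_simps inner_commute)
qed

definition symmetric_op :: "('h::chilbert \<Rightarrow> 'h) \<Rightarrow> bool" where
  "symmetric_op T \<longleftrightarrow> (\<forall>x y. cinner (T x) y = cinner x (T y))"

text \<open>Polarization: replacing \<open>y\<close> by \<open>\<i> y\<close> separates \<open>b x y\<close> from \<open>b y x\<close>. Complex scalars are
  essential, as the rotation of the plane by a right angle shows.\<close>

lemma sesquilinear_zero:
  fixes b :: "'a::chilbert \<Rightarrow> 'a \<Rightarrow> complex"
  assumes add: "\<And>x y z. b (x + y) z = b x z + b y z" "\<And>x y z. b z (x + y) = b z x + b z y"
    and scale: "\<And>c x y. b (c *\<^sub>C x) y = cnj c * b x y" "\<And>c x y. b x (c *\<^sub>C y) = c * b x y"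
    and diag: "\<And>x. b x x = 0"
  shows "b x y = 0"
proof -
  have 1: "b x y + b y x = 0" for x y
    using diag[of "x + y"] diag[of x] diag[of y] by (simp add: add add.commute)
  have "\<i> * b x y - \<i> * b y x = 0" using 1[of x "\<i> *\<^sub>C y"] by (simp add: scale)
  then have "b x y = b y x" by simp
  with 1[of x y] show ?thesis by simp
qed

lemma bounded_clinearI:
  fixes T :: "'a::chilbert \<Rightarrow> 'a"
  assumes "\<And>x y. T (x + y) = T x + T y" "\<And>c x. T (c *\<^sub>C x) = c *\<^sub>C T x" "\<And>x. norm (T x) \<le> K * norm x"
  shows "bounded_clinear T"
  unfolding bounded_clinear_def
proof
  show "bounded_linear T"
    by (rule bounded_linear_intro[where K=K])
       (use assms(1,3) assms(2)[of "complex_of_real _"] in \<open>auto simp: scaleC_of_real mult.commute\<close>)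
qed (use assms in auto)

lemma bounded_clinear_bounded_linear: "bounded_clinear T \<Longrightarrow> bounded_linear T"
  by (simp add: bounded_clinear_def)

lemma bounded_clinear_simps:
  assumes "bounded_clinear T"
  shows "T (x + y) = T x + T y" "T (x - y) = T x - T y" "T (- x) = - T x" "T 0 = 0"
    "T (c *\<^sub>C x) = c *\<^sub>C T x" "T (r *\<^sub>R x) = r *\<^sub>R T x" "T (\<Sum>i\<in>F. f i) = (\<Sum>i\<in>F. T (f i))"
proof -
  interpret bounded_linear T using assms by (simp add: bounded_clinear_def)
  show "T (x + y) = T x + T y" "T (x - y) = T x - T y" "T (- x) = - T x" "T 0 = 0"
    "T (r *\<^sub>R x) = r *\<^sub>R T x" "T (\<Sum>i\<in>F. f i) = (\<Sum>i\<in>F. T (f i))"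
    by (auto simp: add diff neg zero scaleR sum)
  show "T (c *\<^sub>C x) = c *\<^sub>C T x" using assms by (simp add: bounded_clinear_def)
qed

lemma bounded_clinear_bound:
  assumes "bounded_clinear T"
  obtains K where "K > 0" "\<And>x. norm (T x) \<le> K * norm x"
  using bounded_linear.pos_bounded[OF bounded_clinear_bounded_linear[OF assms]]
  by (auto simp: mult.commute)

lemma bounded_clinear_tendsto:
  "bounded_clinear T \<Longrightarrow> (f \<longlongrightarrow> x) F \<Longrightarrow> ((\<lambda>n. T (f n)) \<longlongrightarrow> T x) F"
  by (rule bounded_linear.tendsto[OF bounded_clinear_bounded_linear])

lemma bounded_clinear_compose:
  "bounded_clinear S \<Longrightarrow> bounded_clinear T \<Longrightarrow> bounded_clinear (\<lambda>x. S (T x))"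
  by (simp add: bounded_clinear_def bounded_linear_compose)

lemma bounded_clinear_add:
  "bounded_clinear S \<Longrightarrow> bounded_clinear T \<Longrightarrow> bounded_clinear (\<lambda>x. S x + T x)"
  by (simp add: bounded_clinear_def bounded_linear_add scaleC_add_right)

lemma bounded_clinear_diff:
  "bounded_clinear S \<Longrightarrow> bounded_clinear T \<Longrightarrow> bounded_clinear (\<lambda>x. S x - T x)"
  by (simp add: bounded_clinear_def bounded_linear_sub scaleC_diff_right)

lemma bounded_clinear_scaleR:
  "bounded_clinear T \<Longrightarrow> bounded_clinear (\<lambda>x. r *\<^sub>R T x)"
  by (simp add: bounded_clinear_def bounded_linear_const_scaleR scaleC_scaleR_commute)

lemma bounded_clinear_ident: "bounded_clinear (\<lambda>x. x)"
  by (simp add: bounded_clinear_def bounded_linear_ident)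

lemma bounded_clinear_zero: "bounded_clinear (\<lambda>x. 0)"
  by (simp add: bounded_clinear_def bounded_linear_zero)

lemma bounded_clinear_funpow: "bounded_clinear T \<Longrightarrow> bounded_clinear (T ^^ n)"
proof (induction n)
  case 0
  then show ?case using bounded_clinear_ident by (simp add: id_def)
next
  case (Suc n)
  then show ?case using bounded_clinear_compose[of T "T ^^ n"] by (simp add: comp_def)
qed

text \<open>Polarization identifies operators of which only the diagonal elements are known, such as those
  defined by spectral integrals.\<close>

lemma op_eqI:
  fixes S T :: "'a::chilbert \<Rightarrow> 'a"
  assumes "\<And>x y. S (x + y) = S x + S y" "\<And>c x. S (c *\<^sub>C x) = c *\<^sub>C S x"
    and "\<And>x y. T (x + y) = T x + T y" "\<And>c x. T (c *\<^sub>C x) = c *\<^sub>C T x"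
    and "\<And>x. cinner x (S x) = cinner x (T x)"
  shows "S = T"
proof
  fix y
  have "cinner x (S y - T y) = 0" for x
    by (rule sesquilinear_zero[of "\<lambda>x y. cinner x (S y - T y)"])
       (auto simp: assms cinner_simps algebra_simps)
  then show "S y = T y" using cinner_extensionality[of "S y - T y"] by simp
qed

lemma bounded_clinear_eqI:
  assumes "bounded_clinear S" "bounded_clinear T" "\<And>x. cinner x (S x) = cinner x (T x)"
  shows "S = T"
  by (rule op_eqI) (use assms in \<open>auto simp: bounded_clinear_simps\<close>)

lemma symmetric_op_if_real_diag:
  assumes T: "bounded_clinear T" and r: "\<And>x. Im (cinner x (T x)) = 0"
  shows "symmetric_op T"
  unfolding symmetric_op_def
proof (intro allI)
  fix x y
  have "cinner (T x) y - cinner x (T y) = 0"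
  proof (rule sesquilinear_zero[of "\<lambda>x y. cinner (T x) y - cinner x (T y)"])
    fix x
    have "cinner (T x) x = cnj (cinner x (T x))" by (rule cinner_commute)
    also have "\<dots> = cinner x (T x)" using r by (simp add: complex_eq_iff)
    finally show "cinner (T x) x - cinner x (T x) = 0" by simp
  qed (auto simp: bounded_clinear_simps[OF T] cinner_simps algebra_simps)
  then show "cinner (T x) y = cinner x (T y)" by simp
qed

lemma positive_op_symmetric: "positive_op T \<Longrightarrow> symmetric_op T"
  by (auto simp: positive_op_def complex_nonneg_Reals_iff intro: symmetric_op_if_real_diag)

lemma symmetric_op_inner: "symmetric_op T \<Longrightarrow> inner (T x) y = inner x (T y)"
  by (metis Re_cinner symmetric_op_def)

lemma symmetric_op_diag: "symmetric_op T \<Longrightarrow> cinner x (T x) = complex_of_real (inner x (T x))"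
proof -
  assume s: "symmetric_op T"
  have "cinner x (T x) = cnj (cinner x (T x))"
    by (metis cinner_commute s symmetric_op_def)
  then show ?thesis by (auto simp: complex_eq_iff Re_cinner)
qed

lemma positive_opI:
  "bounded_clinear T \<Longrightarrow> symmetric_op T \<Longrightarrow> (\<And>x. 0 \<le> inner x (T x)) \<Longrightarrow> positive_op T"
  by (simp add: positive_op_def symmetric_op_diag)

lemma positive_opD:
  "positive_op T \<Longrightarrow> bounded_clinear T" "positive_op T \<Longrightarrow> 0 \<le> inner x (T x)"
  by (auto simp: positive_op_def complex_nonneg_Reals_iff Re_cinner[symmetric])

lemma symmetric_op_funpow: "symmetric_op T \<Longrightarrow> symmetric_op (T ^^ n)"
proof (induction n)
  case (Suc n)
  then show ?case unfolding symmetric_op_def by (simp add: funpow_swap1)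
qed (simp add: symmetric_op_def)

text \<open>Every Cauchy--Schwarz inequality below comes from this discriminant, applied to the values
  of a nonnegative quadratic form on the line \<open>x + r y\<close>.\<close>

lemma nonneg_quadratic_discriminant:
  fixes a b d :: real
  assumes nonneg: "\<And>r. 0 \<le> a + 2 * r * b + r\<^sup>2 * d" and "0 \<le> d"
  shows "b\<^sup>2 \<le> a * d"
proof (cases "d = 0")
  case True
  have "b = 0"
  proof (rule ccontr)
    assume "b \<noteq> 0"
    then show False using nonneg[of "- (a + 1) / (2 * b)"] True by (simp add: field_simps)
  qed
  with True show ?thesis by simp
next
  case False
  then have d: "d > 0" using \<open>0 \<le> d\<close> by simp
  have "0 \<le> a + 2 * (- b / d) * b + (- b / d)\<^sup>2 * d" by (rule nonneg)
  also have "\<dots> = a - b\<^sup>2 / d" using d by (simp add: field_simps power2_eq_square)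
  finally show ?thesis using d by (simp add: field_simps)
qed

lemma positive_op_cauchy_schwarz:
  assumes T: "positive_op T"
  shows "(inner x (T y))\<^sup>2 \<le> inner x (T x) * inner y (T y)"
proof (rule nonneg_quadratic_discriminant)
  fix r :: real
  note sy = symmetric_op_inner[OF positive_op_symmetric[OF T]]
  have "0 \<le> inner (x + r *\<^sub>R y) (T (x + r *\<^sub>R y))" by (rule positive_opD(2)[OF T])
  also have "\<dots> = inner x (T x) + 2 * r * inner x (T y) + r\<^sup>2 * inner y (T y)"
    using sy[of x y] by (simp add: bounded_clinear_simps[OF positive_opD(1)[OF T]] inner_simps
        power2_eq_square inner_commute algebra_simps)
  finally show "0 \<le> inner x (T x) + 2 * r * inner x (T y) + r\<^sup>2 * inner y (T y)" .
qed (rule positive_opD(2)[OF T])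

text \<open>Cauchy--Schwarz for the form of \<open>T\<close>, at the vectors \<open>T x\<close> and \<open>x\<close>, bounds
  \<open>\<parallel>T x\<parallel>\<^sup>4\<close>.\<close>

lemma positive_contraction_norm_le:
  assumes T: "positive_op T" and c: "\<And>x. inner x (T x) \<le> K * (norm x)\<^sup>2"
  shows "(norm (T x))\<^sup>2 \<le> K * inner x (T x)"
proof (cases "T x = 0")
  case True
  have "0 \<le> K \<or> x = 0"
  proof (rule ccontr)
    assume "\<not> ?thesis"
    then have "K * (norm x)\<^sup>2 < 0" by (simp add: mult_less_0_iff)
    with c[of x] positive_opD(2)[OF T, of x] show False by linarith
  qed
  then show ?thesis using True positive_opD(2)[OF T, of x] by auto
next
  case False
  have "((norm (T x))\<^sup>2)\<^sup>2 = (inner (T x) (T x))\<^sup>2" by (simp add: power2_norm_eq_inner)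
  also have "\<dots> \<le> inner (T x) (T (T x)) * inner x (T x)"
    by (rule positive_op_cauchy_schwarz[OF T])
  also have "\<dots> \<le> (K * (norm (T x))\<^sup>2) * inner x (T x)"
    by (rule mult_right_mono[OF c positive_opD(2)[OF T]])
  finally have "(norm (T x))\<^sup>2 * (norm (T x))\<^sup>2 \<le> (norm (T x))\<^sup>2 * (K * inner x (T x))"
    by (simp only: power2_eq_square[of "(norm (T x))\<^sup>2"] mult.assoc mult.left_commute)
  then show ?thesis using False by (subst (asm) mult_le_cancel_left_pos) auto
qed

section \<open>Orthogonal projections, orthonormal bases and the trace\<close>

text \<open>The parallelogram law makes a minimizing sequence for the distance a Cauchy sequence.\<close>

lemma closed_csubspace_exists_nearest:
  fixes x :: "'a::chilbert"
  assumes V: "closed_csubspace V"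
  obtains y where "y \<in> V" "\<And>v. v \<in> V \<Longrightarrow> (norm (x - y))\<^sup>2 \<le> (norm (x - v))\<^sup>2"
proof -
  have V0: "0 \<in> V" and Vadd: "\<And>a b. a \<in> V \<Longrightarrow> b \<in> V \<Longrightarrow> a + b \<in> V"
    and Vsc: "\<And>r a. a \<in> V \<Longrightarrow> r *\<^sub>R a \<in> V" and Vcl: "closed V"
    using V by (auto simp: closed_csubspace_def scaleC_of_real[symmetric])
  define D where "D = (INF v\<in>V. (norm (x - v))\<^sup>2)"
  have bdd: "bdd_below ((\<lambda>v. (norm (x - v))\<^sup>2) ` V)" by (rule bdd_belowI[of _ 0]) auto
  have D_le: "D \<le> (norm (x - v))\<^sup>2" if "v \<in> V" for v
    unfolding D_def by (rule cINF_lower[OF bdd that])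
  have "\<exists>v\<in>V. (norm (x - v))\<^sup>2 < D + e" if "e > 0" for e
    using cINF_less_iff[OF _ bdd, of "D + e"] V0 that by (auto simp: D_def)
  then have "\<exists>v\<in>V. (norm (x - v))\<^sup>2 < D + 1 / real (Suc n)" for n by simp
  then obtain v where v: "\<And>n. v n \<in> V" "\<And>n. (norm (x - v n))\<^sup>2 < D + 1 / real (Suc n)" by metis
  have near: "(norm (v n - v k))\<^sup>2 \<le> 4 / real (Suc N)" if "n \<ge> N" "k \<ge> N" for n k N
  proof -
    have "D \<le> (norm (x - (1/2) *\<^sub>R (v n + v k)))\<^sup>2" by (intro D_le Vsc Vadd v)
    moreover have "(norm (v n - v k))\<^sup>2 = 2 * (norm (x - v n))\<^sup>2 + 2 * (norm (x - v k))\<^sup>2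
       - 4 * (norm (x - (1/2) *\<^sub>R (v n + v k)))\<^sup>2"
      by (simp add: power2_norm_eq_inner inner_simps inner_commute algebra_simps)
    moreover have "1 / real (Suc n) \<le> 1 / real (Suc N)" "1 / real (Suc k) \<le> 1 / real (Suc N)"
      using that by (auto intro!: divide_left_mono)
    moreover have "4 / real (Suc N) = 4 * (1 / real (Suc N))" by simp
    ultimately show ?thesis using v(2)[of n] v(2)[of k] by linarith
  qed
  have "Cauchy v"
  proof (rule CauchyI)
    fix e :: real assume "e > 0"
    obtain N where "4 / e\<^sup>2 < real N" using reals_Archimedean2 by blast
    then have "4 / real (Suc N) < e\<^sup>2" using \<open>e > 0\<close>
      by (simp add: field_simps) (smt (verit) mult_pos_pos zero_less_power)
    then have "norm (v n - v k) < e" if "n \<ge> N" "k \<ge> N" for n k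
      using near[OF that] \<open>e > 0\<close> by (intro power2_less_imp_less[where y=e]) auto
    then show "\<exists>M. \<forall>m\<ge>M. \<forall>n\<ge>M. norm (v m - v n) < e" by blast
  qed
  then obtain y where y: "v \<longlonglongrightarrow> y" using Cauchy_convergent convergent_def by blast
  have "y \<in> V" using closed_sequentially[OF Vcl, of v y] v(1) y by blast
  have "(\<lambda>n. D + 1 / real (Suc n)) \<longlonglongrightarrow> D + 0"
    by (intro tendsto_intros LIMSEQ_Suc lim_1_over_n)
  moreover have "(\<lambda>n. (norm (x - v n))\<^sup>2) \<longlonglongrightarrow> (norm (x - y))\<^sup>2" by (intro tendsto_intros y)
  ultimately have "(norm (x - y))\<^sup>2 \<le> D"
    using LIMSEQ_le[of "\<lambda>n. (norm (x - v n))\<^sup>2" _ "\<lambda>n. D + 1 / real (Suc n)"] v(2)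
    by (force intro: less_imp_le)
  with D_le \<open>y \<in> V\<close> that show thesis by (meson order_trans)
qed

text \<open>Moving the nearest point in the direction \<open>z\<close> cannot shorten the distance, so the real part
  of \<open>\<langle>z, x - y\<rangle>\<close> is \<open>0\<close>; the direction \<open>\<i> z\<close> does the same for the imaginary part.\<close>

lemma orthogonal_decomposition:
  fixes x :: "'a::chilbert"
  assumes V: "closed_csubspace V"
  obtains y where "y \<in> V" "\<And>z. z \<in> V \<Longrightarrow> cinner z (x - y) = 0"
proof -
  obtain y where y: "y \<in> V" "\<And>v. v \<in> V \<Longrightarrow> (norm (x - y))\<^sup>2 \<le> (norm (x - v))\<^sup>2"
    using closed_csubspace_exists_nearest[OF V] by blast
  have Vadd: "\<And>a b. a \<in> V \<Longrightarrow> b \<in> V \<Longrightarrow> a + b \<in> V" and Vc: "\<And>c a. a \<in> V \<Longrightarrow> c *\<^sub>C a \<in> V"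
    using V by (auto simp: closed_csubspace_def)
  have inner0: "inner z (x - y) = 0" if "z \<in> V" for z
  proof -
    have "0 \<le> 0 + 2 * r * (- inner z (x - y)) + r\<^sup>2 * inner z z" for r
    proof -
      have "(norm (x - y))\<^sup>2 \<le> (norm (x - (y + complex_of_real r *\<^sub>C z)))\<^sup>2"
        by (intro y(2) Vadd Vc y(1) that)
      also have "\<dots> = (norm (x - y))\<^sup>2 - 2 * r * inner z (x - y) + r\<^sup>2 * inner z z"
        by (simp add: scaleC_of_real power2_norm_eq_inner inner_simps inner_commute
            algebra_simps) (simp add: power2_eq_square)
      finally show ?thesis by simp
    qed
    from nonneg_quadratic_discriminant[OF this inner_ge_zero] show ?thesis by simp
  qed
  have "cinner z (x - y) = 0" if "z \<in> V" for z
    using inner0[OF that] inner0[OF Vc[OF that, of \<i>]]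
    by (intro complex_eqI) (auto simp: Re_cinner Im_cinner)
  with y(1) that show thesis by blast
qed

lemma orth_proj_eqI:
  assumes V: "closed_csubspace V" and y: "y \<in> V" "\<And>z. z \<in> V \<Longrightarrow> cinner z (x - y) = 0"
  shows "orth_proj V x = y"
  unfolding orth_proj_def
proof (rule the_equality)
  fix y' assume y': "y' \<in> V \<and> (\<forall>z\<in>V. cinner z (x - y') = 0)"
  have "y + (-1) *\<^sub>C y' \<in> V" using V y y' by (simp add: closed_csubspace_def)
  then have d: "y - y' \<in> V" by (simp add: scaleC_minus_left)
  have "cinner (y - y') (y - y') = cinner (y - y') (x - y') - cinner (y - y') (x - y)"
    by (simp add: cinner_diff_right)
  also have "\<dots> = 0" using d y y' by simp
  finally show "y' = y" by simp
qed (use y in auto)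

lemma
  assumes V: "closed_csubspace V"
  shows orth_proj_in: "orth_proj V x \<in> V"
    and orth_proj_orth: "z \<in> V \<Longrightarrow> cinner z (x - orth_proj V x) = 0"
proof -
  obtain y where y: "y \<in> V" "\<And>z. z \<in> V \<Longrightarrow> cinner z (x - y) = 0"
    using orthogonal_decomposition[OF V, of x] by blast
  then have "orth_proj V x = y" by (rule orth_proj_eqI[OF V])
  with y show "orth_proj V x \<in> V" "z \<in> V \<Longrightarrow> cinner z (x - orth_proj V x) = 0" by simp_all
qed

lemma orth_proj_id: "closed_csubspace V \<Longrightarrow> x \<in> V \<Longrightarrow> orth_proj V x = x"
  by (rule orth_proj_eqI) auto

lemma norm_orth_proj_le:
  assumes V: "closed_csubspace V"
  shows "norm (orth_proj V x) \<le> norm x"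
proof (rule power2_le_imp_le)
  show "(norm (orth_proj V x))\<^sup>2 \<le> (norm x)\<^sup>2"
    using pythagoras_cinner[OF orth_proj_orth[OF V orth_proj_in[OF V, of x]], of x] by simp
qed simp

lemma bounded_clinear_orth_proj:
  assumes V: "closed_csubspace V"
  shows "bounded_clinear (orth_proj V)"
proof (rule bounded_clinearI[where K=1])
  have Vadd: "\<And>a b. a \<in> V \<Longrightarrow> b \<in> V \<Longrightarrow> a + b \<in> V" and Vc: "\<And>c a. a \<in> V \<Longrightarrow> c *\<^sub>C a \<in> V"
    using V by (auto simp: closed_csubspace_def)
  show "orth_proj V (x + y) = orth_proj V x + orth_proj V y" for x y
    by (rule orth_proj_eqI[OF V]) (use orth_proj_in[OF V] orth_proj_orth[OF V] Vadd in
        \<open>auto simp: add_diff_add cinner_add_right\<close>)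
  show "orth_proj V (c *\<^sub>C x) = c *\<^sub>C orth_proj V x" for c x
    by (rule orth_proj_eqI[OF V]) (use orth_proj_in[OF V] orth_proj_orth[OF V] Vc in
        \<open>auto simp: scaleC_diff_right[symmetric] cinner_scaleC_right\<close>)
qed (simp add: norm_orth_proj_le[OF V])

lemma symmetric_orth_proj:
  assumes V: "closed_csubspace V"
  shows "symmetric_op (orth_proj V)"
  unfolding symmetric_op_def
proof (intro allI)
  fix x y
  have "cinner (orth_proj V x) (y - orth_proj V y) = 0"
    "cinner (orth_proj V y) (x - orth_proj V x) = 0"
    using V by (auto intro: orth_proj_orth orth_proj_in)
  then have "cinner (orth_proj V x) y = cinner (orth_proj V x) (orth_proj V y)"
    "cinner (orth_proj V y) x = cinner (orth_proj V y) (orth_proj V x)"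
    by (auto simp: cinner_diff_right)
  then show "cinner (orth_proj V x) y = cinner x (orth_proj V y)"
    by (metis cinner_commute)
qed

definition orthonormal :: "'h::chilbert set \<Rightarrow> bool" where
  "orthonormal E \<longleftrightarrow> (\<forall>e\<in>E. \<forall>f\<in>E. cinner e f = (if e = f then 1 else 0))"

lemma maximal_orthonormal_subset:
  fixes G :: "'h::chilbert set"
  obtains E where "E \<subseteq> G" "orthonormal E"
    "\<And>x. x \<in> G \<Longrightarrow> norm x = 1 \<Longrightarrow> (\<And>e. e \<in> E \<Longrightarrow> cinner e x = 0) \<Longrightarrow> False"
proof -
  let ?A = "{E. E \<subseteq> G \<and> orthonormal E}"
  have "\<exists>M\<in>?A. \<forall>X\<in>?A. M \<subseteq> X \<longrightarrow> X = M"
  proof (rule subset_Zorn')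
    fix C assume C: "subset.chain ?A C"
    have "\<exists>X\<in>C. e \<in> X \<and> f \<in> X" if "e \<in> \<Union>C" "f \<in> \<Union>C" for e f
    proof -
      obtain X Y where XY: "X \<in> C" "Y \<in> C" "e \<in> X" "f \<in> Y" using \<open>e \<in> \<Union>C\<close> \<open>f \<in> \<Union>C\<close> by auto
      with C have "(X \<subset> Y \<or> X = Y) \<or> (Y \<subset> X \<or> Y = X)" unfolding subset.chain_def by blast
      then have "X \<subseteq> Y \<or> Y \<subseteq> X" by blast
      with XY show ?thesis by blast
    qed
    moreover have "C \<subseteq> ?A" using C by (auto simp: subset.chain_def)
    ultimately show "\<Union>C \<in> ?A" unfolding orthonormal_def by blast
  qed
  then obtain M where M: "M \<subseteq> G" "orthonormal M"
    and max: "\<And>X. X \<subseteq> G \<Longrightarrow> orthonormal X \<Longrightarrow> M \<subseteq> X \<Longrightarrow> X = M"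
    by (elim bexE) auto
  have False if x: "x \<in> G" "norm x = 1" "\<And>e. e \<in> M \<Longrightarrow> cinner e x = 0" for x
  proof -
    have xx: "cinner x x = 1" using x(2) by (simp add: cinner_self)
    then have "x \<notin> M" using x(3)[of x] by auto
    have "cinner x e = 0" if "e \<in> M" for e using x(3)[OF that] by (metis cinner_commute complex_cnj_zero)
    then have "orthonormal (insert x M)" using M(2) x(3) xx \<open>x \<notin> M\<close>
      by (auto simp: orthonormal_def)
    with max[of "insert x M"] x(1) M(1) \<open>x \<notin> M\<close> show False by auto
  qed
  with M that show thesis by blast
qed

text \<open>A maximal orthonormal subset of \<open>G\<close> is a basis of the whole space: if \<open>x \<noteq> 0\<close> were orthogonal to
  it, the normalized \<open>y\<close> would enlarge it.\<close>

lemma orthonormal_basis_in: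
  fixes G :: "'h::chilbert set"
  assumes scale: "\<And>r x. x \<in> G \<Longrightarrow> r *\<^sub>R x \<in> G"
    and detect: "\<And>E x. E \<subseteq> G \<Longrightarrow> x \<noteq> 0 \<Longrightarrow> (\<And>e. e \<in> E \<Longrightarrow> cinner e x = 0) \<Longrightarrow>
        \<exists>y\<in>G. y \<noteq> 0 \<and> (\<forall>e\<in>E. cinner e y = 0)"
  obtains E where "E \<subseteq> G" "orthonormal_basis E"
proof -
  obtain E where E: "E \<subseteq> G" "orthonormal E"
    "\<And>x. x \<in> G \<Longrightarrow> norm x = 1 \<Longrightarrow> (\<And>e. e \<in> E \<Longrightarrow> cinner e x = 0) \<Longrightarrow> False"
    using maximal_orthonormal_subset by blast
  have "x = 0" if "\<forall>e\<in>E. cinner e x = 0" for x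
  proof (rule ccontr)
    assume "x \<noteq> 0"
    then obtain y where y: "y \<in> G" "y \<noteq> 0" "\<forall>e\<in>E. cinner e y = 0"
      using detect[OF E(1)] \<open>\<forall>e\<in>E. cinner e x = 0\<close> by blast
    show False
      by (rule E(3)[of "(1 / norm y) *\<^sub>R y"]) (use y scale in \<open>auto simp: cinner_scaleR_right\<close>)
  qed
  with E that show thesis unfolding orthonormal_basis_def orthonormal_def by blast
qed

lemma orthonormal_sum_norm:
  assumes "orthonormal E" "F \<subseteq> E" "finite F"
  shows "(norm (\<Sum>e\<in>F. c e *\<^sub>C e))\<^sup>2 = (\<Sum>e\<in>F. (cmod (c e))\<^sup>2)"
proof -
  have "complex_of_real ((norm (\<Sum>e\<in>F. c e *\<^sub>C e))\<^sup>2) = (\<Sum>e\<in>F. \<Sum>f\<in>F. c e * (cnj (c f) * cinner f e))"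
    unfolding cinner_self[symmetric] cinner_sum_right cinner_sum_left cinner_scaleC_left
      cinner_scaleC_right sum_distrib_left by (rule refl)
  also have "\<dots> = (\<Sum>e\<in>F. \<Sum>f\<in>F. if e = f then c e * cnj (c e) else 0)"
    by (intro sum.cong refl) (use assms in \<open>auto simp: orthonormal_def subset_iff\<close>)
  also have "\<dots> = (\<Sum>e\<in>F. c e * cnj (c e))" using assms by (simp add: sum.delta)
  also have "\<dots> = complex_of_real (\<Sum>e\<in>F. (cmod (c e))\<^sup>2)"
    by (simp only: of_real_sum complex_norm_square)
  finally show ?thesis using of_real_eq_iff by blast
qed

text \<open>This identity contains both halves of Parseval's: Fourier coefficients for \<open>c\<close> give Bessel's
  inequality, and dense finite combinations give the converse.\<close>

lemma best_approximation_identity: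
  assumes E: "orthonormal E" "F \<subseteq> E" "finite F"
  shows "(norm (x - (\<Sum>e\<in>F. c e *\<^sub>C e)))\<^sup>2
    = (norm x)\<^sup>2 - (\<Sum>e\<in>F. (cmod (cinner e x))\<^sup>2) + (\<Sum>e\<in>F. (cmod (cinner e x - c e))\<^sup>2)"
proof -
  define p where "p = (\<Sum>e\<in>F. cinner e x *\<^sub>C e)"
  have 0: "cinner (\<Sum>e\<in>F. d e *\<^sub>C e) (x - p) = 0" for d
  proof -
    have "cinner f (x - p) = 0" if "f \<in> F" for f
    proof -
      have "cinner f p = (\<Sum>e\<in>F. cinner e x * cinner f e)"
        by (simp add: p_def cinner_sum_right cinner_scaleC_right)
      also have "\<dots> = (\<Sum>e\<in>F. if e = f then cinner f x else 0)"
        by (intro sum.cong refl) (use E that in \<open>auto simp: orthonormal_def subset_iff\<close>)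
      also have "\<dots> = cinner f x" using E that by simp
      finally show ?thesis by (simp add: cinner_diff_right)
    qed
    then show ?thesis by (simp add: cinner_sum_left cinner_scaleC_left)
  qed
  have "(norm (p + (x - p)))\<^sup>2 = (norm p)\<^sup>2 + (norm (x - p))\<^sup>2"
    by (rule pythagoras_cinner) (use 0[of "\<lambda>e. cinner e x"] in \<open>simp add: p_def\<close>)
  moreover have "(norm ((\<Sum>e\<in>F. (cinner e x - c e) *\<^sub>C e) + (x - p)))\<^sup>2
      = (norm (\<Sum>e\<in>F. (cinner e x - c e) *\<^sub>C e))\<^sup>2 + (norm (x - p))\<^sup>2"
    by (rule pythagoras_cinner) (rule 0)
  moreover have "(\<Sum>e\<in>F. (cinner e x - c e) *\<^sub>C e) + (x - p) = x - (\<Sum>e\<in>F. c e *\<^sub>C e)"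
    by (simp add: p_def scaleC_diff_left sum_subtractf)
  moreover note orthonormal_sum_norm[OF E, of "\<lambda>e. cinner e x"]
    orthonormal_sum_norm[OF E, of "\<lambda>e. cinner e x - c e"]
  moreover have "p + (x - p) = x" by simp
  ultimately show ?thesis unfolding p_def[symmetric] by simp
qed

text \<open>The closed span of the basis is everything, because a vector orthogonal to it is orthogonal
  to the basis.\<close>

lemma orthonormal_basis_dense:
  assumes E: "orthonormal_basis E" and "\<epsilon> > 0"
  obtains F c where "finite F" "F \<subseteq> E" "norm (x - (\<Sum>e\<in>F. c e *\<^sub>C e)) < \<epsilon>"
proof -
  define V where "V = {x. \<forall>\<epsilon>>0. \<exists>F c. finite F \<and> F \<subseteq> E \<and> norm (x - (\<Sum>e\<in>F. c e *\<^sub>C e)) < \<epsilon>}"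
  have VI: "x \<in> V" if "\<And>\<epsilon>. \<epsilon> > 0 \<Longrightarrow> \<exists>F c. finite F \<and> F \<subseteq> E \<and> norm (x - (\<Sum>e\<in>F. c e *\<^sub>C e)) < \<epsilon>" for x
    using that by (simp add: V_def)
  have VE: "\<exists>F c. finite F \<and> F \<subseteq> E \<and> norm (x - (\<Sum>e\<in>F. c e *\<^sub>C e)) < \<epsilon>" if "x \<in> V" "\<epsilon> > 0" for x \<epsilon>
    using that by (simp add: V_def)
  have cs: "closed_csubspace V"
    unfolding closed_csubspace_def
  proof (intro conjI ballI allI)
    have "x \<in> V" if "x \<in> closure V" for x
    proof (rule VI)
      fix \<epsilon> :: real assume "\<epsilon> > 0"
      then obtain y where y: "y \<in> V" "norm (y - x) < \<epsilon> / 2"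
        using closure_approachable[of x V] \<open>x \<in> closure V\<close> by (metis dist_norm half_gt_zero)
      then obtain F c where F: "finite F" "F \<subseteq> E" "norm (y - (\<Sum>e\<in>F. c e *\<^sub>C e)) < \<epsilon> / 2"
        using VE[of y "\<epsilon> / 2"] \<open>\<epsilon> > 0\<close> by auto
      have "norm (x - (\<Sum>e\<in>F. c e *\<^sub>C e)) \<le> norm (x - y) + norm (y - (\<Sum>e\<in>F. c e *\<^sub>C e))"
        using norm_triangle_ineq[of "x - y" "y - (\<Sum>e\<in>F. c e *\<^sub>C e)"] by simp
      with y F have "norm (x - (\<Sum>e\<in>F. c e *\<^sub>C e)) < \<epsilon>" by (simp add: norm_minus_commute)
      with F show "\<exists>F c. finite F \<and> F \<subseteq> E \<and> norm (x - (\<Sum>e\<in>F. c e *\<^sub>C e)) < \<epsilon>" by blast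
    qed
    then show "closed V" by (metis closure_subset_eq subsetI)
    show "0 \<in> V" by (rule VI, rule exI[of _ "{}"]) simp
    show "x + y \<in> V" if xy: "x \<in> V" "y \<in> V" for x y
    proof (rule VI)
      fix \<epsilon> :: real assume "\<epsilon> > 0"
      then obtain F c where F: "finite F" "F \<subseteq> E" "norm (x - (\<Sum>e\<in>F. c e *\<^sub>C e)) < \<epsilon> / 2"
        using VE[OF xy(1), of "\<epsilon> / 2"] by auto
      obtain G d where G: "finite G" "G \<subseteq> E" "norm (y - (\<Sum>e\<in>G. d e *\<^sub>C e)) < \<epsilon> / 2"
        using VE[OF xy(2), of "\<epsilon> / 2"] \<open>\<epsilon> > 0\<close> by auto
      have ext: "(\<Sum>e\<in>F\<union>G. (if e \<in> H then h e else 0) *\<^sub>C e) = (\<Sum>e\<in>H. h e *\<^sub>C e)"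
        if "H \<subseteq> F \<union> G" for H h
        using that F G by (intro sum.mono_neutral_cong_right) auto
      have "x + y - (\<Sum>e\<in>F\<union>G. ((if e \<in> F then c e else 0) + (if e \<in> G then d e else 0)) *\<^sub>C e)
         = (x - (\<Sum>e\<in>F. c e *\<^sub>C e)) + (y - (\<Sum>e\<in>G. d e *\<^sub>C e))"
        unfolding scaleC_add_left sum.distrib using ext[of F c] ext[of G d] by simp
      moreover have "norm ((x - (\<Sum>e\<in>F. c e *\<^sub>C e)) + (y - (\<Sum>e\<in>G. d e *\<^sub>C e))) < \<epsilon>"
        using norm_triangle_lt F(3) G(3) by (smt (verit) field_sum_of_halves)
      ultimately have "norm (x + y - (\<Sum>e\<in>F\<union>G. ((if e \<in> F then c e else 0) + (if e \<in> G then d e else 0)) *\<^sub>C e)) < \<epsilon>"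
        by (simp only:)
      moreover have "finite (F \<union> G)" "F \<union> G \<subseteq> E" using F G by auto
      ultimately show "\<exists>F c. finite F \<and> F \<subseteq> E \<and> norm (x + y - (\<Sum>e\<in>F. c e *\<^sub>C e)) < \<epsilon>"
        by (intro exI conjI)
    qed
    show "k *\<^sub>C x \<in> V" if xV: "x \<in> V" for k x
    proof (rule VI)
      fix \<epsilon> :: real assume e: "\<epsilon> > 0"
      obtain F c where F: "finite F" "F \<subseteq> E" "norm (x - (\<Sum>e\<in>F. c e *\<^sub>C e)) < \<epsilon> / (cmod k + 1)"
        using VE[OF xV, of "\<epsilon> / (cmod k + 1)"] e by (auto simp: add_nonneg_pos)
      have "k *\<^sub>C x - (\<Sum>e\<in>F. (k * c e) *\<^sub>C e) = k *\<^sub>C (x - (\<Sum>e\<in>F. c e *\<^sub>C e))"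
        by (simp add: scaleC_diff_right scaleC_sum_right scaleC_scaleC)
      then have "norm (k *\<^sub>C x - (\<Sum>e\<in>F. (k * c e) *\<^sub>C e)) \<le> (cmod k + 1) * norm (x - (\<Sum>e\<in>F. c e *\<^sub>C e))"
        by (simp add: norm_scaleC distrib_right)
      also have "\<dots> < \<epsilon>" using F(3) by (simp add: pos_less_divide_eq add_nonneg_pos mult.commute)
      finally show "\<exists>F c. finite F \<and> F \<subseteq> E \<and> norm (k *\<^sub>C x - (\<Sum>e\<in>F. c e *\<^sub>C e)) < \<epsilon>"
        using F by (intro exI[of _ F] exI[of _ "\<lambda>e. k * c e"]) auto
    qed
  qed
  have EV: "E \<subseteq> V"
  proof
    fix e assume "e \<in> E"
    then show "e \<in> V" by (intro VI exI[of _ "{e}"] exI[of _ "\<lambda>_. 1"]) auto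
  qed
  have "cinner e (x - orth_proj V x) = 0" if "e \<in> E" for e
    using orth_proj_orth[OF cs] EV that by blast
  then have "x - orth_proj V x = 0" using E unfolding orthonormal_basis_def by blast
  then have "x = orth_proj V x" by (simp only: right_minus_eq)
  then have "x \<in> V" using orth_proj_in[OF cs, of x] by (rule ssubst)
  from VE[OF this \<open>\<epsilon> > 0\<close>] show thesis by (elim exE conjE) (rule that)
qed

lemma infsum_ennreal_SUP:
  "infsum f A = (SUP F\<in>{F. finite F \<and> F \<subseteq> A}. sum f F)" for f :: "'a \<Rightarrow> ennreal"
  by (rule nonneg_infsum_complete) auto

lemma infsum_ennreal_leI:
  "(\<And>F. finite F \<Longrightarrow> F \<subseteq> A \<Longrightarrow> sum f F \<le> (c::ennreal)) \<Longrightarrow> infsum f A \<le> c"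
  by (auto simp: infsum_ennreal_SUP intro!: SUP_least)

lemma sum_le_infsum_ennreal:
  "finite F \<Longrightarrow> F \<subseteq> A \<Longrightarrow> sum f F \<le> infsum f A" for f :: "'a \<Rightarrow> ennreal"
  by (auto simp: infsum_ennreal_SUP intro!: SUP_upper)

lemma summable_on_ennreal': "f summable_on A" for f :: "'a \<Rightarrow> ennreal"
  by (rule nonneg_summable_on_complete) simp

lemma infsum_ennreal_mono:
  "(\<And>x. x \<in> A \<Longrightarrow> f x \<le> g x) \<Longrightarrow> infsum f A \<le> infsum g A" for f :: "'a \<Rightarrow> ennreal"
  by (rule infsum_mono[OF summable_on_ennreal' summable_on_ennreal'])

lemma infsum_ennreal_sum:
  "finite F \<Longrightarrow> infsum (\<lambda>y. \<Sum>x\<in>F. f x y) B = (\<Sum>x\<in>F. infsum (f x) B)" for f :: "_ \<Rightarrow> _ \<Rightarrow> ennreal"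
  by (induction F rule: finite_induct) (auto simp: infsum_add[OF summable_on_ennreal' summable_on_ennreal'])

lemma infsum_ennreal_swap:
  fixes f :: "'a \<Rightarrow> 'b \<Rightarrow> ennreal"
  shows "infsum (\<lambda>x. infsum (f x) B) A = infsum (\<lambda>y. infsum (\<lambda>x. f x y) A) B"
proof -
  have "infsum (\<lambda>x. infsum (f x) B) A \<le> infsum (\<lambda>y. infsum (\<lambda>x. f x y) A) B"
    (is "?le A B f") for f :: "'c \<Rightarrow> 'd \<Rightarrow> ennreal" and A B
    by (rule infsum_ennreal_leI)
      (auto simp: infsum_ennreal_sum[symmetric] intro!: infsum_ennreal_mono sum_le_infsum_ennreal)
  note le = this
  show ?thesis by (rule antisym[OF le le])
qed

lemma parseval:
  assumes E: "orthonormal_basis E"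
  shows "infsum (\<lambda>e. ennreal ((cmod (cinner e x))\<^sup>2)) E = ennreal ((norm x)\<^sup>2)"
proof -
  have on: "orthonormal E" using E by (simp add: orthonormal_basis_def orthonormal_def)
  show ?thesis
  proof (rule antisym)
    show "infsum (\<lambda>e. ennreal ((cmod (cinner e x))\<^sup>2)) E \<le> ennreal ((norm x)\<^sup>2)"
    proof (rule infsum_ennreal_leI)
      fix F assume F: "finite F" "F \<subseteq> E"
      have "0 \<le> (norm (x - (\<Sum>e\<in>F. cinner e x *\<^sub>C e)))\<^sup>2" by simp
      also have "\<dots> = (norm x)\<^sup>2 - (\<Sum>e\<in>F. (cmod (cinner e x))\<^sup>2)"
        by (subst best_approximation_identity[OF on F(2,1)]) simp
      finally show "(\<Sum>e\<in>F. ennreal ((cmod (cinner e x))\<^sup>2)) \<le> ennreal ((norm x)\<^sup>2)"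
        by (simp add: sum_ennreal ennreal_leI)
    qed
    show "ennreal ((norm x)\<^sup>2) \<le> infsum (\<lambda>e. ennreal ((cmod (cinner e x))\<^sup>2)) E"
    proof (rule ennreal_le_epsilon)
      fix \<epsilon> :: real assume "\<epsilon> > 0"
      then obtain F c where F: "finite F" "F \<subseteq> E" "norm (x - (\<Sum>e\<in>F. c e *\<^sub>C e)) < sqrt \<epsilon>"
        using orthonormal_basis_dense[OF E, of "sqrt \<epsilon>" x] by auto
      have "(norm x)\<^sup>2 - (\<Sum>e\<in>F. (cmod (cinner e x))\<^sup>2) \<le> (norm (x - (\<Sum>e\<in>F. c e *\<^sub>C e)))\<^sup>2"
        by (subst best_approximation_identity[OF on F(2,1)]) (simp add: sum_nonneg)
      also have "\<dots> \<le> \<epsilon>"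
        using power_mono[OF less_imp_le[OF F(3)], of 2] \<open>\<epsilon> > 0\<close> by simp
      finally have "ennreal ((norm x)\<^sup>2) \<le> ennreal ((\<Sum>e\<in>F. (cmod (cinner e x))\<^sup>2) + \<epsilon>)"
        by (intro ennreal_leI) simp
      also have "\<dots> = (\<Sum>e\<in>F. ennreal ((cmod (cinner e x))\<^sup>2)) + ennreal \<epsilon>"
        using \<open>\<epsilon> > 0\<close> by (simp add: sum_nonneg)
      also have "\<dots> \<le> infsum (\<lambda>e. ennreal ((cmod (cinner e x))\<^sup>2)) E + ennreal \<epsilon>"
        by (intro add_right_mono sum_le_infsum_ennreal F)
      finally show "ennreal ((norm x)\<^sup>2) \<le> infsum (\<lambda>e. ennreal ((cmod (cinner e x))\<^sup>2)) E + ennreal \<epsilon>" .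
    qed
  qed
qed

text \<open>Expand the norms in the basis \<open>F\<close>, exchange the sums and use the symmetry of \<open>Y\<close>.\<close>

lemma hilbert_schmidt_symmetric_basis_independent:
  assumes Y: "symmetric_op Y" and E: "orthonormal_basis E" and F: "orthonormal_basis F"
  shows "infsum (\<lambda>e. ennreal ((norm (Y e))\<^sup>2)) E = infsum (\<lambda>f. ennreal ((norm (Y f))\<^sup>2)) F"
proof -
  have "infsum (\<lambda>e. ennreal ((norm (Y e))\<^sup>2)) E
      = infsum (\<lambda>e. infsum (\<lambda>f. ennreal ((cmod (cinner f (Y e)))\<^sup>2)) F) E"
    by (simp add: parseval[OF F])
  also have "\<dots> = infsum (\<lambda>f. infsum (\<lambda>e. ennreal ((cmod (cinner f (Y e)))\<^sup>2)) E) F"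
    by (rule infsum_ennreal_swap)
  also have "\<dots> = infsum (\<lambda>f. infsum (\<lambda>e. ennreal ((cmod (cinner e (Y f)))\<^sup>2)) E) F"
  proof -
    have "cinner f (Y e) = cnj (cinner e (Y f))" for e f
      using Y cinner_commute[of "Y f" e] by (simp add: symmetric_op_def)
    then have "cmod (cinner f (Y e)) = cmod (cinner e (Y f))" for e f
      by (metis complex_mod_cnj)
    then show ?thesis by (intro infsum_cong arg_cong[where f="\<lambda>r. ennreal (r\<^sup>2)"])
  qed
  also have "\<dots> = infsum (\<lambda>f. ennreal ((norm (Y f))\<^sup>2)) F" by (simp add: parseval[OF E])
  finally show ?thesis .
qed

lemma ennreal_infsum_nat:
  fixes f :: "nat \<Rightarrow> real"
  assumes "\<And>n. 0 \<le> f n" "f sums s"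
  shows "infsum (\<lambda>n. ennreal (f n)) UNIV = ennreal s"
proof -
  have "(f has_sum s) UNIV"
    using assms by (intro norm_summable_imp_has_sum) (auto simp: sums_iff)
  then have "f summable_on UNIV" "infsum f UNIV = s"
    by (auto simp: summable_on_def infsumI)
  then have "ennreal s = (SUP F\<in>{F. finite F \<and> F \<subseteq> UNIV}. ennreal (sum f F))"
    using infsum_nonneg_is_SUPREMUM_ennreal[of f UNIV] assms(1) by simp
  also have "\<dots> = infsum (\<lambda>n. ennreal (f n)) UNIV"
    by (simp add: infsum_ennreal_SUP sum_ennreal assms(1))
  finally show ?thesis by simp
qed

text \<open>A diagonal element \<open>\<langle>e, X e\<rangle>\<close> of a positive operator becomes a squared norm through the square
  root of \<open>X\<close>. A sum of squares serves as well: with \<open>X\<^sub>0 = X\<close> and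
  \<open>X\<^sub>n\<^sub>+\<^sub>1 = X\<^sub>n - X\<^sub>n\<^sup>2\<close> the sum of the \<open>X\<^sub>n\<^sup>2\<close> telescopes to \<open>X\<close>.\<close>

fun square_peeling :: "('h::chilbert \<Rightarrow> 'h) \<Rightarrow> nat \<Rightarrow> 'h \<Rightarrow> 'h" where
  "square_peeling X 0 = X"
| "square_peeling X (Suc n) = (\<lambda>x. square_peeling X n x - square_peeling X n (square_peeling X n x))"

lemma square_peeling_contraction:
  assumes X: "positive_op X" "\<And>x. inner x (X x) \<le> (norm x)\<^sup>2"
  shows "positive_op (square_peeling X n) \<and> (\<forall>x. inner x (square_peeling X n x) \<le> (norm x)\<^sup>2)"
proof (induction n)
  case (Suc n)
  let ?Y = "square_peeling X n"
  have Y: "positive_op ?Y" and Yc: "\<And>x. inner x (?Y x) \<le> 1 * (norm x)\<^sup>2" using Suc by auto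
  note sym = positive_op_symmetric[OF Y] and bc = positive_opD(1)[OF Y]
  have diag: "inner x (square_peeling X (Suc n) x) = inner x (?Y x) - (norm (?Y x))\<^sup>2" for x
    using symmetric_op_inner[OF sym, of x "?Y x"] by (simp add: inner_simps power2_norm_eq_inner)
  have "positive_op (square_peeling X (Suc n))"
  proof (rule positive_opI)
    show "bounded_clinear (square_peeling X (Suc n))"
      by (simp add: bounded_clinear_diff[OF bc bounded_clinear_compose[OF bc bc]])
    show "symmetric_op (square_peeling X (Suc n))"
      using sym by (simp add: symmetric_op_def cinner_simps)
    show "0 \<le> inner x (square_peeling X (Suc n) x)" for x
      unfolding diag using positive_contraction_norm_le[OF Y Yc, of x] by simp
  qed
  moreover have "inner x (square_peeling X (Suc n) x) \<le> (norm x)\<^sup>2" for x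
    unfolding diag using Yc[of x] zero_le_power2[of "norm (?Y x)"] by linarith
  ultimately show ?case by blast
qed (use X in auto)

text \<open>The partial sums are bounded by \<open>\<langle>x, X x\<rangle>\<close>, so \<open>X\<^sub>n x\<close> tends to \<open>0\<close>, and with it the
  remainder \<open>\<langle>x, X\<^sub>n x\<rangle>\<close>.\<close>

lemma positive_contraction_sum_of_squares:
  assumes X: "positive_op X" "\<And>x. inner x (X x) \<le> (norm x)\<^sup>2"
  shows "(\<lambda>n. (norm (square_peeling X n x))\<^sup>2) sums inner x (X x)"
proof -
  let ?Y = "square_peeling X"
  have Y: "positive_op (?Y n)" for n using square_peeling_contraction[OF X] by blast
  have part: "(\<Sum>k<n. (norm (?Y k x))\<^sup>2) = inner x (X x) - inner x (?Y n x)" for n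
  proof (induction n)
    case (Suc n)
    have "inner x (?Y (Suc n) x) = inner x (?Y n x) - (norm (?Y n x))\<^sup>2"
      using symmetric_op_inner[OF positive_op_symmetric[OF Y[of n]], of x "?Y n x"]
      by (simp add: inner_simps power2_norm_eq_inner)
    with Suc show ?case by simp
  qed simp
  have "summable (\<lambda>n. (norm (?Y n x))\<^sup>2)"
  proof (rule summableI_nonneg_bounded[where x="inner x (X x)"])
    show "(\<Sum>k<n. (norm (?Y k x))\<^sup>2) \<le> inner x (X x)" for n
      unfolding part using positive_opD(2)[OF Y, of x n] by simp
  qed simp
  then have "(\<lambda>n. (norm (?Y n x))\<^sup>2) \<longlonglongrightarrow> 0" by (rule summable_LIMSEQ_zero)
  then have "(\<lambda>n. sqrt ((norm (?Y n x))\<^sup>2)) \<longlonglongrightarrow> sqrt 0" by (rule tendsto_real_sqrt)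
  then have "(\<lambda>n. ?Y n x) \<longlonglongrightarrow> 0" by (simp add: tendsto_norm_zero_iff)
  then have "(\<lambda>n. inner x (X x) - inner x (?Y n x)) \<longlonglongrightarrow> inner x (X x) - inner x 0"
    by (intro tendsto_intros)
  then show ?thesis by (simp add: sums_def part)
qed

lemma positive_contraction_trace_basis_independent:
  assumes X: "positive_op X" "\<And>x. inner x (X x) \<le> (norm x)\<^sup>2"
    and E: "orthonormal_basis E" and F: "orthonormal_basis F"
  shows "infsum (\<lambda>e. ennreal (inner e (X e))) E = infsum (\<lambda>f. ennreal (inner f (X f))) F"
proof -
  let ?Y = "square_peeling X"
  have sq: "ennreal (inner x (X x)) = infsum (\<lambda>n. ennreal ((norm (?Y n x))\<^sup>2)) UNIV" for x
    by (rule ennreal_infsum_nat[symmetric]) (auto intro: positive_contraction_sum_of_squares[OF X])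
  have "symmetric_op (?Y n)" for n
    using square_peeling_contraction[OF X] positive_op_symmetric by blast
  from hilbert_schmidt_symmetric_basis_independent[OF this E F]
  show ?thesis unfolding sq
    by (subst (1 2) infsum_ennreal_swap) simp
qed

text \<open>The definition of the trace picks some basis; this allows a convenient one.\<close>

lemma trace_eq:
  assumes T: "positive_op T" and E: "orthonormal_basis E"
  shows "trace T = infsum (\<lambda>e. ennreal (inner e (T e))) E"
proof -
  define F :: "'a set" where "F = (SOME E. orthonormal_basis E)"
  have F: "orthonormal_basis F" unfolding F_def using E by (rule someI)
  obtain K where K: "K > 0" "\<And>x. norm (T x) \<le> K * norm x"
    using bounded_clinear_bound[OF positive_opD(1)[OF T]] by blast
  define X where "X = (\<lambda>x. (1 / K) *\<^sub>R T x)"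
  have X: "positive_op X"
    unfolding X_def using K positive_op_symmetric[OF T] positive_opD[OF T]
    by (intro positive_opI bounded_clinear_scaleR) (auto simp: symmetric_op_def cinner_simps)
  have Xc: "inner x (X x) \<le> (norm x)\<^sup>2" for x
  proof -
    have "inner x (T x) \<le> norm x * (K * norm x)"
      by (meson K(2) mult_left_mono norm_cauchy_schwarz norm_ge_zero order_trans)
    then show ?thesis using K by (simp add: X_def field_simps power2_eq_square)
  qed
  have TX: "ennreal (inner x (T x)) = ennreal K * ennreal (inner x (X x))" for x
    using K by (simp add: X_def ennreal_mult'[symmetric])
  have "trace T = infsum (\<lambda>e. ennreal (inner e (T e))) F"
    by (simp add: trace_def F_def Re_cinner)
  also have "\<dots> = ennreal K * infsum (\<lambda>e. ennreal (inner e (X e))) F"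
    unfolding TX by (simp add: infsum_ennreal_SUP sum_distrib_left[symmetric] SUP_mult_left_ennreal)
  also have "\<dots> = ennreal K * infsum (\<lambda>e. ennreal (inner e (X e))) E"
    by (simp only: positive_contraction_trace_basis_independent[OF X Xc F E])
  also have "\<dots> = infsum (\<lambda>e. ennreal (inner e (T e))) E"
    unfolding TX by (simp add: infsum_ennreal_SUP sum_distrib_left[symmetric] SUP_mult_left_ennreal)
  finally show ?thesis .
qed

section \<open>Integration against a projection-valued measure\<close>

definition binary_digit :: "nat \<Rightarrow> real \<Rightarrow> bool" where
  "binary_digit k y \<longleftrightarrow> odd \<lfloor>2 ^ Suc k * y\<rfloor>"

lemma binary_expansion:
  fixes y :: real
  assumes "0 \<le> y" "y < 1"
  shows "(\<lambda>k. (1/2) ^ Suc k * of_bool (binary_digit k y)) sums y"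
proof -
  have part: "(\<Sum>k<n. (1/2) ^ Suc k * of_bool (binary_digit k y)) = real_of_int \<lfloor>2 ^ n * y\<rfloor> / 2 ^ n" for n
  proof (induction n)
    case 0
    have "\<lfloor>y\<rfloor> = 0" using assms by linarith
    then show ?case by simp
  next
    case (Suc n)
    have "\<lfloor>2 ^ Suc n * y\<rfloor> = 2 * \<lfloor>2 ^ n * y\<rfloor> + (if binary_digit n y then 1 else 0)"
    proof -
      have "\<lfloor>2 * (2 ^ n * y)\<rfloor> = 2 * \<lfloor>2 ^ n * y\<rfloor> \<or> \<lfloor>2 * (2 ^ n * y)\<rfloor> = 2 * \<lfloor>2 ^ n * y\<rfloor> + 1"
        by linarith
      then show ?thesis by (auto simp: binary_digit_def mult.assoc)
    qed
    then have "real_of_int \<lfloor>2 ^ Suc n * y\<rfloor> = 2 * real_of_int \<lfloor>2 ^ n * y\<rfloor> + of_bool (binary_digit n y)"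
      by simp
    then show ?case unfolding sum.lessThan_Suc Suc
      by (simp add: field_simps power_divide)
  qed
  have "(\<lambda>n. real_of_int \<lfloor>2 ^ n * y\<rfloor> / 2 ^ n) \<longlonglongrightarrow> y"
  proof (rule real_tendsto_sandwich)
    have "2 ^ n * y - 1 \<le> real_of_int \<lfloor>2 ^ n * y\<rfloor>" "real_of_int \<lfloor>2 ^ n * y\<rfloor> \<le> 2 ^ n * y" for n
      by linarith+
    then have "(2 ^ n * y - 1) / 2 ^ n \<le> real_of_int \<lfloor>2 ^ n * y\<rfloor> / 2 ^ n"
      "real_of_int \<lfloor>2 ^ n * y\<rfloor> / 2 ^ n \<le> 2 ^ n * y / 2 ^ n" for n
      by (intro divide_right_mono; simp)+
    then show "\<forall>\<^sub>F n in sequentially. y - (1/2) ^ n \<le> real_of_int \<lfloor>2 ^ n * y\<rfloor> / 2 ^ n"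
      "\<forall>\<^sub>F n in sequentially. real_of_int \<lfloor>2 ^ n * y\<rfloor> / 2 ^ n \<le> y"
      by (auto simp: diff_divide_distrib power_divide)
    have "(\<lambda>n. y - (1/2) ^ n) \<longlonglongrightarrow> y - 0" by (intro tendsto_intros LIMSEQ_realpow_zero) auto
    then show "(\<lambda>n. y - (1/2) ^ n) \<longlonglongrightarrow> y" by simp
  qed auto
  then show ?thesis unfolding sums_def part .
qed

lemma binary_digit_sums_integral:
  fixes f h :: "real \<Rightarrow> real"
  assumes "finite_measure N" and N: "sets N = sets borel"
    and f: "f \<in> borel_measurable borel" "\<And>s. 0 \<le> f s" "\<And>s. f s < 1"
    and h: "h \<in> borel_measurable borel" "\<And>s. 0 \<le> h s" "\<And>s. h s \<le> M"
  shows "(\<lambda>k. (1/2) ^ Suc k * (\<integral>s. of_bool (binary_digit k (f s)) * h s \<partial>N)) sums (\<integral>s. f s * h s \<partial>N)"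
proof -
  interpret finite_measure N by fact
  note [measurable] = f(1) h(1)
  have [measurable_cong]: "sets N = sets borel" by fact
  let ?g = "\<lambda>k s. (1/2) ^ Suc k * (of_bool (binary_digit k (f s)) * h s)"
  have meas[measurable]: "(\<lambda>s. of_bool (binary_digit k (f s)) * h s) \<in> borel_measurable borel" for k
    unfolding binary_digit_def by measurable
  have int: "integrable N (\<lambda>s. of_bool (binary_digit k (f s)) * h s)" for k
  proof (rule integrable_const_bound[where B=M])
    show "(\<lambda>s. of_bool (binary_digit k (f s)) * h s) \<in> borel_measurable N" by measurable
    show "AE s in N. norm (of_bool (binary_digit k (f s)) * h s) \<le> M"
      using h(2,3) order_trans[OF h(2,3)] by (auto simp: of_bool_def)
  qed
  have sm: "(\<lambda>k. ?g k s) sums (f s * h s)" for s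
    using sums_mult2[OF binary_expansion[OF f(2,3), of s], of "h s"] by (simp add: mult.assoc)
  have "(\<lambda>k. integral\<^sup>L N (?g k)) sums (\<integral>s. (\<Sum>k. ?g k s) \<partial>N)"
  proof (rule sums_integral)
    show "integrable N (?g k)" for k using int[of k] by (rule integrable_mult_right)
    show "AE s in N. summable (\<lambda>k. norm (?g k s))"
      using sm h by (auto simp: sums_iff)
    show "summable (\<lambda>k. \<integral>s. norm (?g k s) \<partial>N)"
    proof (rule summable_comparison_test')
      show "summable (\<lambda>k. (1/2) ^ Suc k * (M * measure N (space N)))"
        by (intro summable_mult2) (simp add: summable_geometric)
      fix k :: nat
      have "(\<integral>s. norm (?g k s) \<partial>N) \<le> (\<integral>s. (1/2) ^ Suc k * M \<partial>N)"
      proof (rule integral_mono)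
        show "integrable N (\<lambda>s. norm (?g k s))" using int[of k] by (intro integrable_norm integrable_mult_right)
        fix s
        have "of_bool (binary_digit k (f s)) * h s \<le> M" using h(2,3)[of s] by (auto simp: of_bool_def)
        then show "norm (?g k s) \<le> (1/2) ^ Suc k * M"
          using h(2)[of s] unfolding real_norm_def
          by (subst abs_of_nonneg) (auto intro!: mult_left_mono)
      qed auto
      then show "norm (\<integral>s. norm (?g k s) \<partial>N) \<le> (1/2) ^ Suc k * (M * measure N (space N))"
        by (simp add: mult.assoc mult.left_commute mult.commute)
    qed
  qed
  then show ?thesis using sm by (simp add: sums_iff)
qed

text \<open>The inner products say that \<open>f k \<mapsto> v k\<close> is isometric from \<open>L\<^sup>2(M)\<close>, so the \<open>v k\<close> form a Cauchy
  sequence with the \<open>f k\<close>.\<close>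

lemma convergent_if_L2_convergent:
  fixes v :: "nat \<Rightarrow> 'h::chilbert" and f :: "nat \<Rightarrow> 'a \<Rightarrow> real"
  assumes inner: "\<And>k l. inner (v k) (v l) = (\<integral>t. f k t * f l t \<partial>M)"
    and int: "\<And>k l. integrable M (\<lambda>t. f k t * f l t)"
    and int2: "\<And>k. integrable M (\<lambda>t. (f k t - h t)\<^sup>2)"
    and lim: "(\<lambda>k. \<integral>t. (f k t - h t)\<^sup>2 \<partial>M) \<longlonglongrightarrow> 0"
  shows "convergent v"
proof -
  have diff: "(norm (v k - v l))\<^sup>2 \<le> 2 * (\<integral>t. (f k t - h t)\<^sup>2 \<partial>M) + 2 * (\<integral>t. (f l t - h t)\<^sup>2 \<partial>M)" for k l
  proof -
    have "(norm (v k - v l))\<^sup>2 = (\<integral>t. f k t * f k t - f k t * f l t - f l t * f k t + f l t * f l t \<partial>M)"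
      by (simp add: power2_norm_eq_inner inner_simps inner int) (simp only: mult.commute)
    also have "\<dots> \<le> (\<integral>t. 2 * (f k t - h t)\<^sup>2 + 2 * (f l t - h t)\<^sup>2 \<partial>M)"
    proof (rule integral_mono)
      fix t
      have "0 \<le> ((f k t - h t) + (f l t - h t))\<^sup>2" by simp
      then show "f k t * f k t - f k t * f l t - f l t * f k t + f l t * f l t
          \<le> 2 * (f k t - h t)\<^sup>2 + 2 * (f l t - h t)\<^sup>2"
        by (simp add: power2_eq_square algebra_simps)
    qed (simp_all add: int int2)
    finally show ?thesis by (simp add: int2)
  qed
  have "Cauchy v"
  proof (rule CauchyI)
    fix e :: real assume e: "e > 0"
    have "\<forall>\<^sub>F k in sequentially. (\<integral>t. (f k t - h t)\<^sup>2 \<partial>M) < e\<^sup>2 / 4"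
      using order_tendstoD(2)[OF lim, of "e\<^sup>2 / 4"] e by simp
    then obtain N where N: "\<And>k. k \<ge> N \<Longrightarrow> (\<integral>t. (f k t - h t)\<^sup>2 \<partial>M) < e\<^sup>2 / 4"
      by (auto simp: eventually_sequentially)
    have "norm (v k - v l) < e" if "k \<ge> N" "l \<ge> N" for k l
      using diff[of k l] N[OF that(1)] N[OF that(2)] e by (intro power2_less_imp_less[where y=e]) auto
    then show "\<exists>M. \<forall>k\<ge>M. \<forall>l\<ge>M. norm (v k - v l) < e" by blast
  qed
  then show ?thesis by (simp add: Cauchy_convergent_iff)
qed

locale pvm =
  fixes E :: "real set \<Rightarrow> 'h::chilbert \<Rightarrow> 'h"
  assumes pvm: "projection_valued_measure E"
begin

lemma bounded_clinear_E: "S \<in> sets borel \<Longrightarrow> bounded_clinear (E S)"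
  and symmetric_E: "S \<in> sets borel \<Longrightarrow> symmetric_op (E S)"
  and E_idem: "S \<in> sets borel \<Longrightarrow> E S (E S x) = E S x"
  and E_UNIV [simp]: "E UNIV x = x"
  and E_Int: "S \<in> sets borel \<Longrightarrow> T \<in> sets borel \<Longrightarrow> E (S \<inter> T) x = E S (E T x)"
  and E_sums: "range F \<subseteq> sets borel \<Longrightarrow> disjoint_family F \<Longrightarrow> (\<lambda>n::nat. E (F n) x) sums E (\<Union>n. F n) x"
proof -
  note 1 = pvm[unfolded projection_valued_measure_def]
  show "S \<in> sets borel \<Longrightarrow> bounded_clinear (E S)" using 1 by blast
  show "S \<in> sets borel \<Longrightarrow> symmetric_op (E S)" unfolding symmetric_op_def using 1 by blast
  show "S \<in> sets borel \<Longrightarrow> E S (E S x) = E S x"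
    using 1 by (elim conjE) (metis comp_apply)
  show "E UNIV x = x" using 1 by (elim conjE) simp
  show "S \<in> sets borel \<Longrightarrow> T \<in> sets borel \<Longrightarrow> E (S \<inter> T) x = E S (E T x)"
    using 1 by (elim conjE) (metis comp_apply)
  show "range F \<subseteq> sets borel \<Longrightarrow> disjoint_family F \<Longrightarrow> (\<lambda>n::nat. E (F n) x) sums E (\<Union>n. F n) x"
    using 1 by blast
qed

lemma E_commute: "S \<in> sets borel \<Longrightarrow> T \<in> sets borel \<Longrightarrow> E S (E T x) = E T (E S x)"
  using E_Int[of S T x] E_Int[of T S x] by (simp add: Int_commute)

lemma E_empty [simp]: "E {} x = 0"
proof -
  have "(\<lambda>n::nat. E {} x) sums E {} x"
    using E_sums[of "\<lambda>_. {}" x] by (simp add: disjoint_family_on_def)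
  then have "(\<lambda>n::nat. E {} x) \<longlonglongrightarrow> 0" using sums_summable summable_LIMSEQ_zero by blast
  then show ?thesis using LIMSEQ_const_iff by blast
qed

lemma inner_E: "S \<in> sets borel \<Longrightarrow> inner x (E S x) = (norm (E S x))\<^sup>2"
  using symmetric_op_inner[OF symmetric_E, of S x "E S x"] by (simp add: E_idem power2_norm_eq_inner)

lemma norm_E_le: "S \<in> sets borel \<Longrightarrow> norm (E S x) \<le> norm x"
proof -
  assume S: "S \<in> sets borel"
  have "(norm (E S x))\<^sup>2 \<le> norm x * norm (E S x)"
    unfolding inner_E[OF S, symmetric] by (rule norm_cauchy_schwarz)
  then show ?thesis by (cases "E S x = 0") (auto simp: power2_eq_square)
qed

abbreviation \<mu> :: "'h \<Rightarrow> real measure" where "\<mu> \<equiv> scalar_measure E"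

lemma sets_\<mu> [simp, measurable_cong]: "sets (\<mu> x) = sets borel"
  using sets.sigma_sets_eq[of "borel::real measure"] by (simp add: scalar_measure_def)

lemma space_\<mu> [simp]: "space (\<mu> x) = UNIV"
  using sets_eq_imp_space_eq[OF sets_\<mu>[of x]] by simp

lemma emeasure_\<mu>: "S \<in> sets borel \<Longrightarrow> emeasure (\<mu> x) S = ennreal (inner x (E S x))"
proof -
  assume S: "S \<in> sets borel"
  have "emeasure (\<mu> x) S = ennreal (Re (cinner x (E S x)))"
    unfolding scalar_measure_def
  proof (rule emeasure_measure_of_sigma)
    show "sigma_algebra UNIV (sets (borel::real measure))"
      using sets.sigma_algebra_axioms[of "borel::real measure"] by simp
    show "positive (sets borel) (\<lambda>S. ennreal (Re (cinner x (E S x))))" by (simp add: positive_def)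
    show "countably_additive (sets borel) (\<lambda>S. ennreal (Re (cinner x (E S x))))"
    proof (rule countably_additiveI)
      fix F :: "nat \<Rightarrow> real set"
      assume F: "range F \<subseteq> sets borel" "disjoint_family F"
      have "(\<lambda>n. inner x (E (F n) x)) sums inner x (E (\<Union>n. F n) x)"
        by (rule bounded_linear.sums[OF bounded_linear_inner_right E_sums[OF F]])
      then show "(\<Sum>n. ennreal (Re (cinner x (E (F n) x)))) = ennreal (Re (cinner x (E (\<Union>n. F n) x)))"
        unfolding Re_cinner using F inner_E by (intro suminf_ennreal_eq) auto
    qed
  qed (rule S)
  then show ?thesis by (simp add: Re_cinner)
qed

lemma measure_\<mu>: "S \<in> sets borel \<Longrightarrow> measure (\<mu> x) S = inner x (E S x)"
  by (simp add: measure_def emeasure_\<mu> inner_E)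

lemma finite_\<mu> [simp]: "finite_measure (\<mu> x)"
  by (rule finite_measureI) (simp add: emeasure_\<mu>)

lemma measure_\<mu>_UNIV: "measure (\<mu> x) UNIV = (norm x)\<^sup>2"
  by (simp add: measure_\<mu> power2_norm_eq_inner)

lemma emeasure_\<mu>_E:
  "S \<in> sets borel \<Longrightarrow> T \<in> sets borel \<Longrightarrow> emeasure (\<mu> (E T x)) S = emeasure (\<mu> x) (S \<inter> T)"
  using symmetric_op_inner[OF symmetric_E, of T x "E S (E T x)"]
  by (simp add: emeasure_\<mu> E_Int E_commute[of T S] E_idem)

lemma \<mu>_E: "T \<in> sets borel \<Longrightarrow> \<mu> (E T x) = density (\<mu> x) (\<lambda>s. ennreal (indicator T s))"
  by (rule measure_eqI) (simp_all add: emeasure_\<mu>_E emeasure_restricted Int_commute ennreal_indicator)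

text \<open>Bounded nonnegative Borel functions: the integrands that binary digits can handle.\<close>

definition bnn :: "(real \<Rightarrow> real) \<Rightarrow> bool" where
  "bnn f \<longleftrightarrow> f \<in> borel_measurable borel \<and> (\<forall>s. 0 \<le> f s) \<and> (\<exists>M. \<forall>s. f s \<le> M)"

lemma bnnI: "f \<in> borel_measurable borel \<Longrightarrow> (\<And>s. 0 \<le> f s) \<Longrightarrow> (\<And>s. f s \<le> M) \<Longrightarrow> bnn f"
  by (auto simp: bnn_def)

lemma bnn_measurable: "bnn f \<Longrightarrow> f \<in> borel_measurable borel" by (simp add: bnn_def)

lemma bnn_mult: "bnn f \<Longrightarrow> bnn g \<Longrightarrow> bnn (\<lambda>s. f s * g s)"
proof -
  assume f: "bnn f" and g: "bnn g"
  obtain M K where MK: "\<And>s. f s \<le> M" "\<And>s. g s \<le> K" using f g by (auto simp: bnn_def)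
  have "f s * g s \<le> M * K" for s
    using f g MK[of s] by (intro mult_mono) (auto simp: bnn_def intro: order_trans)
  then show ?thesis using f g by (intro bnnI) (auto simp: bnn_def)
qed

lemma bnn_indicator: "S \<in> sets borel \<Longrightarrow> bnn (indicator S)"
  by (rule bnnI[where M=1]) (auto simp: indicator_def)

lemma bnn_integrable: "bnn f \<Longrightarrow> integrable (\<mu> x) f"
proof -
  assume f: "bnn f"
  interpret finite_measure "\<mu> x" by simp
  obtain M where "\<And>s. f s \<le> M" using f by (auto simp: bnn_def)
  with f show ?thesis by (intro integrable_const_bound[where B=M]) (auto simp: bnn_def)
qed

text \<open>The integral in the weak sense; by polarization at most one operator has these diagonal
  elements.\<close>

definition is_integral :: "(real \<Rightarrow> real) \<Rightarrow> ('h \<Rightarrow> 'h) \<Rightarrow> bool" where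
  "is_integral f T \<longleftrightarrow> bounded_clinear T \<and> (\<forall>x. cinner x (T x) = complex_of_real (integral\<^sup>L (\<mu> x) f))"

lemma is_integral_unique: "is_integral f S \<Longrightarrow> is_integral f T \<Longrightarrow> S = T"
  unfolding is_integral_def by (rule bounded_clinear_eqI) auto

lemma is_integral_indicator: "S \<in> sets borel \<Longrightarrow> is_integral (indicator S) (E S)"
  by (simp add: is_integral_def bounded_clinear_E measure_\<mu> symmetric_op_diag symmetric_E)

text \<open>For \<open>0 \<le> f < 1\<close> the integral is a norm convergent series of projections, one for each binary
  digit of \<open>f\<close>, namely the one onto the set where this digit is 1.\<close>

definition digit_op :: "(real \<Rightarrow> real) \<Rightarrow> 'h \<Rightarrow> 'h" where
  "digit_op f x = (\<Sum>k. (1/2) ^ Suc k *\<^sub>R E {s. binary_digit k (f s)} x)"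

context
  fixes f :: "real \<Rightarrow> real"
  assumes f: "f \<in> borel_measurable borel" "\<And>s. 0 \<le> f s" "\<And>s. f s < 1"
begin

lemma digit_set: "{s. binary_digit k (f s)} \<in> sets borel"
  using f(1) unfolding binary_digit_def by measurable

lemma digit_op_summable: "summable (\<lambda>k. norm ((1/2) ^ Suc k *\<^sub>R E {s. binary_digit k (f s)} x))"
proof (rule summable_comparison_test')
  show "summable (\<lambda>k. (1/2) ^ Suc k * norm x)"
    by (intro summable_mult2) (simp add: summable_geometric)
  show "norm (norm ((1/2) ^ Suc k *\<^sub>R E {s. binary_digit k (f s)} x)) \<le> (1/2) ^ Suc k * norm x" for k
    using norm_E_le[OF digit_set, of k x] by (simp add: mult_left_mono)
qed

lemma digit_op_sums: "(\<lambda>k. (1/2) ^ Suc k *\<^sub>R E {s. binary_digit k (f s)} x) sums digit_op f x"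
  unfolding digit_op_def by (rule summable_sums[OF summable_norm_cancel[OF digit_op_summable]])

lemma bounded_clinear_digit_op: "bounded_clinear (digit_op f)"
proof (rule bounded_clinearI[where K=1])
  note bc = bounded_clinear_simps[OF bounded_clinear_E[OF digit_set]]
  show "digit_op f (x + y) = digit_op f x + digit_op f y" for x y
    by (rule sums_unique2[OF digit_op_sums])
      (use sums_add[OF digit_op_sums digit_op_sums, of x y] in \<open>simp add: bc scaleR_add_right\<close>)
  show "digit_op f (c *\<^sub>C x) = c *\<^sub>C digit_op f x" for c x
  proof (rule sums_unique2[OF digit_op_sums])
    have "(\<lambda>n. c *\<^sub>C (\<Sum>k<n. (1/2) ^ Suc k *\<^sub>R E {s. binary_digit k (f s)} x)) \<longlonglongrightarrow> c *\<^sub>C digit_op f x"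
      by (rule tendsto_scaleC) (use digit_op_sums in \<open>simp add: sums_def\<close>)
    then show "(\<lambda>k. (1/2) ^ Suc k *\<^sub>R E {s. binary_digit k (f s)} (c *\<^sub>C x)) sums (c *\<^sub>C digit_op f x)"
      by (simp add: sums_def bc scaleC_sum_right scaleC_scaleR_commute)
  qed
  show "norm (digit_op f x) \<le> 1 * norm x" for x
  proof -
    have "norm (digit_op f x) \<le> (\<Sum>k. norm ((1/2) ^ Suc k *\<^sub>R E {s. binary_digit k (f s)} x))"
      unfolding digit_op_def by (rule summable_norm[OF digit_op_summable])
    also have "\<dots> \<le> (\<Sum>k. (1/2) ^ Suc k * norm x)"
    proof (rule suminf_le[OF _ digit_op_summable])
      show "summable (\<lambda>k. (1/2) ^ Suc k * norm x)"
        by (intro summable_mult2) (simp add: summable_geometric)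
      show "norm ((1/2) ^ Suc k *\<^sub>R E {s. binary_digit k (f s)} x) \<le> (1/2) ^ Suc k * norm x" for k
        using norm_E_le[OF digit_set, of k x] by (simp add: mult_left_mono)
    qed
    also have "\<dots> = norm x"
      using sums_mult2[OF power_half_series, of "norm x"] by (simp add: sums_iff)
    finally show ?thesis by simp
  qed
qed

lemma cinner_digit_op_sums:
  "(\<lambda>k. complex_of_real ((1/2) ^ Suc k) * cinner y (E {s. binary_digit k (f s)} x)) sums cinner y (digit_op f x)"
  using bounded_linear.sums[OF bounded_bilinear.bounded_linear_right[OF bounded_bilinear_cinner, of y]
      digit_op_sums[of x]]
  unfolding cinner_scaleR_right .

lemma is_integral_digit_op_restrict:
  assumes S: "S \<in> sets borel"
  shows "is_integral (\<lambda>s. f s * indicator S s) (\<lambda>x. E S (digit_op f x))"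
  unfolding is_integral_def
proof (intro conjI allI)
  show "bounded_clinear (\<lambda>x. E S (digit_op f x))"
    by (rule bounded_clinear_compose[OF bounded_clinear_E[OF S] bounded_clinear_digit_op])
  fix x
  have 1: "(\<lambda>k. (1/2) ^ Suc k * (\<integral>s. of_bool (binary_digit k (f s)) * indicator S s \<partial>\<mu> x))
     sums (\<integral>s. f s * indicator S s \<partial>\<mu> x)"
    by (rule binary_digit_sums_integral[where M=1]) (use f S in \<open>auto simp: indicator_def\<close>)
  have 2: "(\<integral>s. of_bool (binary_digit k (f s)) * indicator S s \<partial>\<mu> x)
      = inner x (E (S \<inter> {s. binary_digit k (f s)}) x)" for k
  proof -
    have "(\<lambda>s. of_bool (binary_digit k (f s)) * indicator S s :: real) = indicator (S \<inter> {s. binary_digit k (f s)})"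
      by (auto simp: fun_eq_iff indicator_def)
    then show ?thesis using S digit_set[of k] by (simp add: measure_\<mu>)
  qed
  have 3: "cinner (E S x) (E {s. binary_digit k (f s)} x)
      = complex_of_real (inner x (E (S \<inter> {s. binary_digit k (f s)}) x))" for k
  proof -
    have "cinner (E S x) (E {s. binary_digit k (f s)} x) = cinner x (E (S \<inter> {s. binary_digit k (f s)}) x)"
      using symmetric_E[OF S] S digit_set[of k] by (simp add: symmetric_op_def E_Int)
    then show ?thesis using S digit_set[of k] by (simp add: symmetric_op_diag symmetric_E)
  qed
  have "(\<lambda>k. complex_of_real ((1/2) ^ Suc k * inner x (E (S \<inter> {s. binary_digit k (f s)}) x)))
      sums complex_of_real (\<integral>s. f s * indicator S s \<partial>\<mu> x)"
    using 1 unfolding 2 by (rule sums_of_real)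
  moreover have "(\<lambda>k. complex_of_real ((1/2) ^ Suc k * inner x (E (S \<inter> {s. binary_digit k (f s)}) x)))
      sums cinner (E S x) (digit_op f x)"
    using cinner_digit_op_sums[of "E S x" x] unfolding 3 by simp
  ultimately have "complex_of_real (\<integral>s. f s * indicator S s \<partial>\<mu> x) = cinner (E S x) (digit_op f x)"
    by (rule sums_unique2)
  also have "\<dots> = cinner x (E S (digit_op f x))"
    using symmetric_E[OF S] by (simp add: symmetric_op_def)
  finally show "cinner x (E S (digit_op f x)) = complex_of_real (\<integral>s. f s * indicator S s \<partial>\<mu> x)" ..
qed

end

text \<open>Multiplicativity of the integral: sum the digits of \<open>f\<close> against \<open>g\<close>, each term being the
  integral of \<open>g\<close> over the set of a digit.\<close>

lemma is_integral_digit_op_mult: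
  assumes f: "f \<in> borel_measurable borel" "\<And>s. 0 \<le> f s" "\<And>s. f s < 1"
    and g: "g \<in> borel_measurable borel" "\<And>s. 0 \<le> g s" "\<And>s. g s < 1"
  shows "is_integral (\<lambda>s. f s * g s) (\<lambda>x. digit_op f (digit_op g x))"
  unfolding is_integral_def
proof (intro conjI allI)
  show "bounded_clinear (\<lambda>x. digit_op f (digit_op g x))"
    by (rule bounded_clinear_compose[OF bounded_clinear_digit_op[OF f] bounded_clinear_digit_op[OF g]])
  fix x
  have 1: "(\<lambda>k. (1/2) ^ Suc k * (\<integral>s. of_bool (binary_digit k (f s)) * g s \<partial>\<mu> x))
     sums (\<integral>s. f s * g s \<partial>\<mu> x)"
    by (rule binary_digit_sums_integral[where M=1]) (use f g in \<open>auto intro: less_imp_le\<close>)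
  have 2: "cinner x (E {s. binary_digit k (f s)} (digit_op g x))
      = complex_of_real (\<integral>s. of_bool (binary_digit k (f s)) * g s \<partial>\<mu> x)" for k
  proof -
    have "(\<lambda>s. of_bool (binary_digit k (f s)) * g s) = (\<lambda>s. g s * indicator {s. binary_digit k (f s)} s)"
      by (auto simp: fun_eq_iff indicator_def)
    then show ?thesis
      using is_integral_digit_op_restrict[OF g digit_set[OF f, of k]] by (simp add: is_integral_def)
  qed
  have "(\<lambda>k. complex_of_real ((1/2) ^ Suc k * (\<integral>s. of_bool (binary_digit k (f s)) * g s \<partial>\<mu> x)))
      sums cinner x (digit_op f (digit_op g x))"
    using cinner_digit_op_sums[OF f, of x "digit_op g x"] unfolding 2 by simp
  then show "cinner x (digit_op f (digit_op g x)) = complex_of_real (\<integral>s. f s * g s \<partial>\<mu> x)"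
    using sums_of_real[OF 1] by (rule sums_unique2)
qed

definition bint :: "(real \<Rightarrow> real) \<Rightarrow> 'h \<Rightarrow> 'h" where
  "bint f = (THE T. is_integral f T)"

lemma bint_eqI: "is_integral f T \<Longrightarrow> bint f = T"
  unfolding bint_def using is_integral_unique by blast

lemma bnn_scaled:
  assumes "bnn f"
  obtains M where "M > 0" "\<And>s. 0 \<le> f s / M" "\<And>s. f s / M < 1"
proof -
  obtain M where M: "\<And>s. f s \<le> M" and "\<And>s. 0 \<le> f s" using assms by (auto simp: bnn_def)
  moreover have "f s < \<bar>M\<bar> + 1" for s using M[of s] by linarith
  ultimately show thesis by (intro that[of "\<bar>M\<bar> + 1"]) (auto simp: divide_less_eq)
qed

lemma bint_scaled:
  assumes f: "f \<in> borel_measurable borel" and M: "M > 0" "\<And>s. 0 \<le> f s / M" "\<And>s. f s / M < 1"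
  shows "is_integral f (\<lambda>x. M *\<^sub>R digit_op (\<lambda>s. f s / M) x)"
proof -
  have fM: "(\<lambda>s. f s / M) \<in> borel_measurable borel" using f by measurable
  have "is_integral (\<lambda>s. f s / M * indicator UNIV s) (\<lambda>x. E UNIV (digit_op (\<lambda>s. f s / M) x))"
    by (rule is_integral_digit_op_restrict[OF fM M(2,3)]) simp
  then have "bounded_clinear (digit_op (\<lambda>s. f s / M))"
    "\<And>x. cinner x (digit_op (\<lambda>s. f s / M) x) = complex_of_real (integral\<^sup>L (\<mu> x) f / M)"
    by (simp_all add: is_integral_def)
  then show ?thesis using M(1) by (simp add: is_integral_def bounded_clinear_scaleR cinner_scaleR_right)
qed

lemma is_integral_bint: "bnn f \<Longrightarrow> is_integral f (bint f)"
  by (metis bnn_scaled bint_scaled bint_eqI bnn_measurable)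

lemma bint_bint:
  assumes f: "bnn f" and g: "bnn g"
  shows "bint f (bint g x) = bint (\<lambda>s. f s * g s) x"
proof -
  obtain M where M: "M > 0" "\<And>s. 0 \<le> f s / M" "\<And>s. f s / M < 1" using bnn_scaled[OF f] by blast
  obtain K where K: "K > 0" "\<And>s. 0 \<le> g s / K" "\<And>s. g s / K < 1" using bnn_scaled[OF g] by blast
  let ?f = "\<lambda>s. f s / M" and ?g = "\<lambda>s. g s / K"
  have meas: "?f \<in> borel_measurable borel" "?g \<in> borel_measurable borel"
    using bnn_measurable[OF f] bnn_measurable[OF g] by measurable
  have T: "is_integral (\<lambda>s. ?f s * ?g s) (\<lambda>x. digit_op ?f (digit_op ?g x))"
    by (rule is_integral_digit_op_mult[OF meas(1) M(2,3) meas(2) K(2,3)])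
  have "is_integral (\<lambda>s. f s * g s) (\<lambda>x. M *\<^sub>R digit_op ?f (K *\<^sub>R digit_op ?g x))"
    unfolding is_integral_def
  proof (intro conjI allI)
    note bc = bounded_clinear_digit_op[OF meas(1) M(2,3)] bounded_clinear_digit_op[OF meas(2) K(2,3)]
    show "bounded_clinear (\<lambda>x. M *\<^sub>R digit_op ?f (K *\<^sub>R digit_op ?g x))"
      by (rule bounded_clinear_scaleR[OF bounded_clinear_compose[OF bc(1) bounded_clinear_scaleR[OF bc(2)]]])
    show "cinner x (M *\<^sub>R digit_op ?f (K *\<^sub>R digit_op ?g x)) = complex_of_real (\<integral>s. f s * g s \<partial>\<mu> x)" for x
      using T M(1) K(1)
      by (simp add: is_integral_def bounded_clinear_simps[OF bc(1)] cinner_scaleR_right field_simps)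
  qed
  from bint_eqI[OF this] bint_eqI[OF bint_scaled[OF bnn_measurable[OF f] M]]
    bint_eqI[OF bint_scaled[OF bnn_measurable[OF g] K]]
  show ?thesis by simp
qed

lemma bounded_clinear_bint: "bnn f \<Longrightarrow> bounded_clinear (bint f)"
  using is_integral_bint by (simp add: is_integral_def)

lemma inner_bint_diag: "bnn f \<Longrightarrow> inner x (bint f x) = integral\<^sup>L (\<mu> x) f"
  using is_integral_bint[of f] by (simp add: is_integral_def Re_cinner[symmetric])

lemma positive_bint: "bnn f \<Longrightarrow> positive_op (bint f)"
  using is_integral_bint[of f]
  by (auto simp: positive_op_def is_integral_def bnn_def intro!: integral_nonneg)

lemma bint_indicator: "S \<in> sets borel \<Longrightarrow> bint (indicator S) = E S"
  by (rule bint_eqI) (rule is_integral_indicator)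

lemma inner_bint_bint:
  assumes f: "bnn f" and g: "bnn g"
  shows "inner (bint f x) (bint g x) = (\<integral>s. f s * g s \<partial>\<mu> x)"
  using symmetric_op_inner[OF positive_op_symmetric[OF positive_bint[OF f]], of x "bint g x"]
  by (simp add: bint_bint f g inner_bint_diag bnn_mult)

lemma \<mu>_bint:
  assumes f: "bnn f"
  shows "\<mu> (bint f x) = density (\<mu> x) (\<lambda>s. ennreal ((f s)\<^sup>2))"
proof (rule measure_eqI)
  fix S assume "S \<in> sets (\<mu> (bint f x))"
  then have S: "S \<in> sets borel" by simp
  note fm[measurable] = bnn_measurable[OF f]
  have "inner (bint f x) (E S (bint f x)) = inner (bint f x) (bint (\<lambda>s. indicator S s * f s) x)"
    by (simp add: bint_indicator[OF S, symmetric] bint_bint bnn_indicator S f)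
  also have "\<dots> = (\<integral>s. f s * (indicator S s * f s) \<partial>\<mu> x)"
    by (intro inner_bint_bint f bnn_mult bnn_indicator S)
  finally have "emeasure (\<mu> (bint f x)) S = ennreal (\<integral>s. f s * (indicator S s * f s) \<partial>\<mu> x)"
    by (simp add: emeasure_\<mu> S)
  also have "\<dots> = (\<integral>\<^sup>+s. ennreal (f s * (indicator S s * f s)) \<partial>\<mu> x)"
  proof (rule nn_integral_eq_integral[symmetric])
    show "integrable (\<mu> x) (\<lambda>s. f s * (indicator S s * f s))"
      by (intro bnn_integrable bnn_mult bnn_indicator S f)
  qed (use f in \<open>auto simp: bnn_def\<close>)
  also have "\<dots> = (\<integral>\<^sup>+s. ennreal ((f s)\<^sup>2) * indicator S s \<partial>\<mu> x)"
    by (intro nn_integral_cong) (auto simp: indicator_def power2_eq_square)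
  also have "\<dots> = emeasure (density (\<mu> x) (\<lambda>s. ennreal ((f s)\<^sup>2))) S"
    using S by (subst emeasure_density) auto
  finally show "emeasure (\<mu> (bint f x)) S = emeasure (density (\<mu> x) (\<lambda>s. ennreal ((f s)\<^sup>2))) S" .
qed simp

end

section \<open>The Hausdorff moment problem\<close>

text \<open>The recurrence, applied \<open>p\<close> times, distributes \<open>a j q\<close> along a row of Pascal's triangle.\<close>

lemma pascal_double_sequence:
  fixes a :: "nat \<Rightarrow> nat \<Rightarrow> real"
  assumes rec: "\<And>i q. a i q = a (Suc i) q + a i (Suc q)"
  shows "(\<Sum>i\<le>p. real (p choose i) * a (j + i) (q + (p - i))) = a j q"
proof (induction p arbitrary: j q)
  case (Suc p)
  have "(\<Sum>i\<le>Suc p. real (Suc p choose i) * a (j + i) (q + (Suc p - i)))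
      = (\<Sum>i\<le>p. real (p choose i) * a (j + i) (Suc q + (p - i)))
      + (\<Sum>i\<le>p. real (p choose i) * a (Suc j + i) (q + (p - i)))"
  proof -
    have "(\<Sum>i\<le>Suc p. real (Suc p choose i) * a (j + i) (q + (Suc p - i)))
       = a j (q + Suc p) + (\<Sum>i\<le>p. real (Suc p choose Suc i) * a (Suc j + i) (q + (p - i)))"
      by (subst sum.atMost_Suc_shift) simp
    also have "(\<Sum>i\<le>p. real (Suc p choose Suc i) * a (Suc j + i) (q + (p - i)))
       = (\<Sum>i\<le>p. real (p choose i) * a (Suc j + i) (q + (p - i)))
       + (\<Sum>i\<le>p. real (p choose Suc i) * a (Suc j + i) (q + (p - i)))"
      by (simp add: sum.distrib[symmetric] distrib_right)
    also have "(\<Sum>i\<le>p. real (p choose Suc i) * a (Suc j + i) (q + (p - i)))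
       = (\<Sum>i<p. real (p choose Suc i) * a (Suc j + i) (q + (p - i)))"
      by (simp add: lessThan_Suc_atMost[symmetric] binomial_eq_0)
    also have "a j (q + Suc p) + ((\<Sum>i\<le>p. real (p choose i) * a (Suc j + i) (q + (p - i))) + \<dots>)
       = (\<Sum>i\<le>p. real (p choose i) * a (Suc j + i) (q + (p - i)))
       + (\<Sum>i\<le>p. real (p choose i) * a (j + i) (Suc q + (p - i)))"
    proof -
      have "(\<Sum>i\<le>p. real (p choose i) * a (j + i) (Suc q + (p - i)))
         = a j (q + Suc p) + (\<Sum>i<p. real (p choose Suc i) * a (Suc j + i) (q + (p - i)))"
        by (subst sum.atMost_shift) (auto intro!: sum.cong arg_cong2[where f=a])
      then show ?thesis by simp
    qed
    finally show ?thesis by simp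
  qed
  also have "\<dots> = a j (Suc q) + a (Suc j) q" using Suc[of j "Suc q"] Suc[of "Suc j" q] by simp
  finally show ?case using rec[of j q] by simp
qed simp

text \<open>The quotient of binomial coefficients is the product of the \<open>(k - i) / (n - i)\<close> for \<open>i < j\<close>,
  and each factor is close to \<open>k / n\<close>. The second conjunct keeps the partial products below 1 in
  the induction.\<close>

lemma binomial_quotient_close_to_power:
  assumes "k \<le> n" "j < n"
  shows "\<bar>real (k choose j) / real (n choose j) - (real k / real n) ^ j\<bar> \<le> (real j)\<^sup>2 / real (n - j)
    \<and> real (k choose j) \<le> real (n choose j)"
  using assms(2)
proof (induction j)
  case (Suc j)
  have nj: "j < n" "real (n - j) > 0" "n choose j > 0" "n choose Suc j > 0" using Suc.prems by auto
  define u where "u = real (k choose j) / real (n choose j)"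
  define v where "v = real (k - j) / real (n - j)"
  have absorb: "real (m choose Suc j) = real (m choose j) * real (m - j) / real (Suc j)" for m
  proof -
    have "Suc j * (m choose Suc j) = (m choose j) * (m - j)"
      using binomial_absorb_comp[of m j] binomial_absorption[of j m] by (simp only: mult.commute)
    then have "real (Suc j) * real (m choose Suc j) = real (m choose j) * real (m - j)"
      by (metis of_nat_mult)
    then show ?thesis by (simp add: field_simps)
  qed
  have eq: "real (k choose Suc j) / real (n choose Suc j) = u * v"
  proof -
    have "x * y / z / (x' * y' / z) = x / x' * (y / y')" if "z \<noteq> 0" for x y z x' y' :: real
      using that by simp
    then show ?thesis unfolding absorb u_def v_def by simp
  qed
  have u: "0 \<le> u" "u \<le> 1" using Suc.IH[OF nj(1)] nj by (auto simp: u_def)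
  have v: "0 \<le> v" "v \<le> 1" using nj assms(1) by (auto simp: v_def)
  have kn: "0 \<le> real k / real n" "real k / real n \<le> 1" using assms(1) nj by auto
  have "\<bar>v - real k / real n\<bar> \<le> real j / real (n - j)"
  proof (cases "j \<le> k")
    case True
    have "real k / real n - v = real j * (real n - real k) / (real n * real (n - j))"
      using nj True by (simp add: v_def field_simps of_nat_diff)
    moreover have "real j * (real n - real k) / (real n * real (n - j)) \<le> real j / real (n - j)"
    proof -
      have "real j * (real n - real k) / (real n * real (n - j))
          = real j / real (n - j) * ((real n - real k) / real n)" by simp
      also have "\<dots> \<le> real j / real (n - j)"
        using nj by (intro mult_left_le) (auto simp: divide_le_eq_1)
      finally show ?thesis .
    qed
    moreover have "0 \<le> real j * (real n - real k) / (real n * real (n - j))"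
      using nj assms(1) by simp
    moreover have "\<bar>q - p\<bar> \<le> r" if "p - q = s" "s \<le> r" "0 \<le> s" for p q r s :: real
      using that by linarith
    ultimately show ?thesis by blast
  next
    case False
    then have "v = 0" by (simp add: v_def)
    moreover have "real k / real n \<le> real j / real (n - j)" using False nj by (intro frac_le) auto
    ultimately show ?thesis using kn by simp
  qed
  moreover have "\<bar>u * v - (real k / real n) ^ Suc j\<bar>
      \<le> \<bar>u - (real k / real n) ^ j\<bar> + \<bar>v - real k / real n\<bar>"
  proof -
    have "u * v - (real k / real n) ^ Suc j
        = (u - (real k / real n) ^ j) * v + (real k / real n) ^ j * (v - real k / real n)"
      by (simp add: algebra_simps)
    moreover have "\<bar>(u - (real k / real n) ^ j) * v\<bar> \<le> \<bar>u - (real k / real n) ^ j\<bar>"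
      using v by (simp add: abs_mult mult_left_le)
    moreover have "\<bar>(real k / real n) ^ j * (v - real k / real n)\<bar> \<le> \<bar>v - real k / real n\<bar>"
      using kn power_le_one[OF kn, of j] by (simp add: abs_mult mult_left_le_one_le)
    ultimately show ?thesis by linarith
  qed
  moreover have "\<bar>u - (real k / real n) ^ j\<bar> \<le> (real j)\<^sup>2 / real (n - j)"
    using Suc.IH[OF nj(1)] by (simp add: u_def)
  moreover have "(real j)\<^sup>2 / real (n - j) + real j / real (n - j) \<le> (real (Suc j))\<^sup>2 / real (n - Suc j)"
  proof -
    have "(real j)\<^sup>2 / real (n - j) + real j / real (n - j) = ((real j)\<^sup>2 + real j) / real (n - j)"
      by (simp add: add_divide_distrib)
    also have "\<dots> \<le> (real (Suc j))\<^sup>2 / real (n - Suc j)"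
      using Suc.prems by (intro frac_le) (auto simp: power2_eq_square algebra_simps)
    finally show ?thesis .
  qed
  ultimately have "\<bar>real (k choose Suc j) / real (n choose Suc j) - (real k / real n) ^ Suc j\<bar>
      \<le> (real (Suc j))\<^sup>2 / real (n - Suc j)"
    unfolding eq by linarith
  moreover have "real (k choose Suc j) \<le> real (n choose Suc j)"
    using assms(1) by (simp add: binomial_right_mono)
  ultimately show ?case by blast
qed simp

text \<open>The Bernstein weights \<open>w n k\<close> at the points \<open>k / n\<close> form probability measures. Their factorial
  moments are exactly \<open>a j 0\<close>, their power moments differ from these by \<open>O(1 / n)\<close>, and Helly's theorem
  provides a weak limit. Powers of \<open>t\<close> are cut off outside \<open>[0, 1]\<close> to be bounded continuous test
  functions.\<close>

theorem hausdorff_moment_normalized: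
  fixes a :: "nat \<Rightarrow> nat \<Rightarrow> real"
  assumes nonneg: "\<And>i q. 0 \<le> a i q" and rec: "\<And>i q. a i q = a (Suc i) q + a i (Suc q)"
    and one: "a 0 0 = 1"
  obtains M where "real_distribution M" "\<And>j. (\<integral>t. (max 0 (min 1 t)) ^ j \<partial>M) = a j 0"
proof -
  define w where "w n k = real (n choose k) * a k (n - k)" for n k
  have w0: "0 \<le> w n k" for n k by (simp add: w_def nonneg)
  have w_sum: "(\<Sum>k\<le>n. w n k) = 1" for n
    using pascal_double_sequence[of a n 0 0, OF rec] one by (simp add: w_def)
  have w_moment: "(\<Sum>k\<le>n. real (k choose j) / real (n choose j) * w n k) = a j 0" if "j \<le> n" for n j
  proof -
    have "(\<Sum>k\<le>n. real (k choose j) / real (n choose j) * w n k)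
        = (\<Sum>k=j..n. real (n - j choose (k - j)) * a k (n - k))"
    proof (rule sum.mono_neutral_cong_right)
      show "\<forall>k\<in>{..n} - {j..n}. real (k choose j) / real (n choose j) * w n k = 0"
        using that by auto
      fix k assume k: "k \<in> {j..n}"
      then have "(n choose k) * (k choose j) = (n choose j) * (n - j choose (k - j))"
        by (intro choose_mult) auto
      then have "real (n choose k) * real (k choose j) = real (n choose j) * real (n - j choose (k - j))"
        by (metis of_nat_mult)
      moreover have "n choose j > 0" using that by simp
      ultimately show "real (k choose j) / real (n choose j) * w n k
          = real (n - j choose (k - j)) * a k (n - k)"
        by (simp add: w_def field_simps)
    qed auto
    also have "\<dots> = (\<Sum>i\<le>n-j. real (n - j choose i) * a (j + i) (0 + (n - j - i)))"
      by (rule sum.reindex_bij_witness[where i="\<lambda>i. j + i" and j="\<lambda>k. k - j"]) (use that in auto)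
    also have "\<dots> = a j 0" by (rule pascal_double_sequence) (rule rec)
    finally show ?thesis .
  qed
  define \<nu> where "\<nu> n = distr (point_measure {..n} (\<lambda>k. ennreal (w n k))) borel (\<lambda>k. real k / real n)" for n
  have integral_\<nu>: "integral\<^sup>L (\<nu> n) g = (\<Sum>k\<le>n. w n k * g (real k / real n))"
    if "g \<in> borel_measurable borel" for g :: "real \<Rightarrow> real" and n
  proof -
    have "integral\<^sup>L (\<nu> n) g = (\<integral>k. g (real k / real n) \<partial>point_measure {..n} (\<lambda>k. ennreal (w n k)))"
      unfolding \<nu>_def by (rule integral_distr) (use that in \<open>auto simp: measurable_def space_point_measure sets_point_measure\<close>)
    also have "\<dots> = (\<Sum>k\<le>n. w n k *\<^sub>R g (real k / real n))"
      by (rule lebesgue_integral_point_measure_finite) (auto simp: w0)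
    finally show ?thesis by simp
  qed
  have emeasure_\<nu>: "emeasure (\<nu> n) S = 1" if "S \<in> sets borel" "{0..1} \<subseteq> S" for n S
  proof -
    have vim: "(\<lambda>k. real k / real n) -` S \<inter> {..n} = {..n}"
    proof -
      have unit: "real k / real n \<in> {0..1}" if "k \<le> n" for k
        using that by (cases "n = 0") auto
      show ?thesis using subsetD[OF that(2) unit] by auto
    qed
    have "emeasure (\<nu> n) S = emeasure (point_measure {..n} (\<lambda>k. ennreal (w n k))) ((\<lambda>k. real k / real n) -` S \<inter> {..n})"
      unfolding \<nu>_def by (subst emeasure_distr) (use that in \<open>auto simp: measurable_def space_point_measure sets_point_measure\<close>)
    also have "\<dots> = (\<Sum>k\<le>n. ennreal (w n k))"
      unfolding vim by (subst emeasure_point_measure_finite) auto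
    also have "\<dots> = 1" by (simp add: w0 w_sum)
    finally show ?thesis .
  qed
  have dist: "real_distribution (\<nu> n)" for n
  proof -
    have "prob_space (\<nu> n)"
      by (rule prob_spaceI) (use emeasure_\<nu>[of UNIV n] in \<open>simp add: \<nu>_def\<close>)
    then show ?thesis by (simp add: real_distribution_def real_distribution_axioms_def \<nu>_def)
  qed
  have "tight \<nu>"
    unfolding tight_def
  proof (intro conjI allI impI)
    show "real_distribution (\<nu> n)" for n by (rule dist)
    fix e :: real assume "e > 0"
    have "measure (\<nu> n) {-1<..1} = 1" for n
      using emeasure_\<nu>[of "{-1<..1}" n] by (simp add: measure_def subset_iff)
    then show "\<exists>a b. a < b \<and> (\<forall>n. 1 - e < measure (\<nu> n) {a<..b})"
      using \<open>e > 0\<close> by (intro exI[of _ "-1"] exI[of _ 1]) auto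
  qed
  then obtain r M where r: "strict_mono r" and M: "real_distribution M"
    and conv: "weak_conv_m (\<nu> \<circ> id \<circ> r) M"
    using tight_imp_convergent_subsubsequence[of \<nu> id] strict_mono_id by blast
  have "(\<integral>t. (max 0 (min 1 t)) ^ j \<partial>M) = a j 0" for j
  proof (rule LIMSEQ_unique)
    let ?f = "\<lambda>t::real. (max 0 (min 1 t)) ^ j"
    have f: "?f \<in> borel_measurable borel" by measurable
    show "(\<lambda>n. integral\<^sup>L ((\<nu> \<circ> id \<circ> r) n) ?f) \<longlonglongrightarrow> integral\<^sup>L M ?f"
    proof (rule weak_conv_imp_integral_bdd_continuous_conv[where B=1])
      show "isCont ?f t" for t by (intro continuous_intros)
      show "norm (?f t) \<le> 1" for t by (simp add: power_le_one)
    qed (use dist M conv in \<open>auto simp: comp_def\<close>)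
    have "(\<lambda>n. integral\<^sup>L (\<nu> n) ?f) \<longlonglongrightarrow> a j 0"
    proof (rule LIM_zero_cancel, rule Lim_null_comparison)
      show "\<forall>\<^sub>F n in sequentially. norm (integral\<^sup>L (\<nu> n) ?f - a j 0) \<le> (real j)\<^sup>2 / real (n - j)"
      proof (rule eventually_sequentiallyI[of "Suc j"])
        fix n assume n: "Suc j \<le> n"
        have "integral\<^sup>L (\<nu> n) ?f - a j 0
            = (\<Sum>k\<le>n. w n k * ((real k / real n) ^ j - real (k choose j) / real (n choose j)))"
        proof -
          have "integral\<^sup>L (\<nu> n) ?f = (\<Sum>k\<le>n. w n k * (real k / real n) ^ j)"
            unfolding integral_\<nu>[OF f] using n by (intro sum.cong) (auto simp: min_def max_def divide_le_eq_1)
          then show ?thesis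
            using w_moment[of j n] n by (simp add: right_diff_distrib sum_subtractf mult.commute)
        qed
        also have "norm \<dots> \<le> (\<Sum>k\<le>n. w n k * ((real j)\<^sup>2 / real (n - j)))"
        proof (rule sum_norm_le)
          fix k assume "k \<in> {..n}"
          then have "\<bar>(real k / real n) ^ j - real (k choose j) / real (n choose j)\<bar> \<le> (real j)\<^sup>2 / real (n - j)"
            using binomial_quotient_close_to_power[of k n j] n by (simp add: abs_minus_commute)
          then show "norm (w n k * ((real k / real n) ^ j - real (k choose j) / real (n choose j)))
              \<le> w n k * ((real j)\<^sup>2 / real (n - j))"
            using mult_left_mono[OF _ w0[of n k]] w0[of n k] by (simp add: abs_mult del: times_divide_eq_right)
        qed
        also have "\<dots> = (real j)\<^sup>2 / real (n - j)"
          by (simp add: sum_distrib_right[symmetric] w_sum del: times_divide_eq_right)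
        finally show "norm (integral\<^sup>L (\<nu> n) ?f - a j 0) \<le> (real j)\<^sup>2 / real (n - j)" .
      qed
      have "(\<lambda>n. (real j)\<^sup>2 / real n) \<longlonglongrightarrow> 0" by (rule lim_const_over_n)
      then show "(\<lambda>n. (real j)\<^sup>2 / real (n - j)) \<longlonglongrightarrow> 0"
        by (intro LIMSEQ_offset[of "\<lambda>n. (real j)\<^sup>2 / real (n - j)" j]) simp
    qed
    from LIMSEQ_subseq_LIMSEQ[OF this r]
    show "(\<lambda>n. integral\<^sup>L ((\<nu> \<circ> id \<circ> r) n) ?f) \<longlonglongrightarrow> a j 0" by (simp add: comp_def)
  qed
  with M that show thesis by blast
qed

text \<open>Hausdorff's theorem: the two assumptions, which integrals of \<open>t\<^sup>i (1 - t)\<^sup>q\<close> over \<open>[0, 1]\<close>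
  clearly satisfy, characterize them. If \<open>a 0 0\<close> vanishes, then so does the whole sequence;
  otherwise it can be normalized.\<close>

theorem hausdorff_moment:
  fixes a :: "nat \<Rightarrow> nat \<Rightarrow> real"
  assumes nonneg: "\<And>i q. 0 \<le> a i q" and rec: "\<And>i q. a i q = a (Suc i) q + a i (Suc q)"
  obtains N :: "real measure" where "finite_measure N" "sets N = sets borel"
    "AE t in N. t \<in> {0..1}" "\<And>j. (\<integral>t. t ^ j \<partial>N) = a j 0"
proof (cases "a 0 0 = 0")
  case True
  have "a i q = 0" for i q
  proof -
    have "a i 0 = 0" for i
    proof (induction i)
      case (Suc i)
      then show ?case using rec[of i 0] nonneg[of "Suc i" 0] nonneg[of i 1] by simp
    qed (rule True)
    then show ?thesis
    proof (induction q arbitrary: i)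
      case (Suc q)
      then show ?case using rec[of i q] nonneg[of "Suc i" q] nonneg[of i "Suc q"] by simp
    qed simp
  qed
  then show thesis
    by (intro that[of "null_measure borel"])
      (auto simp: finite_measureI AE_iff_null null_sets_def integral_null_measure)
next
  case False
  then have c: "a 0 0 > 0" using nonneg[of 0 0] by simp
  obtain M where M: "real_distribution M" "\<And>j. (\<integral>t. (max 0 (min 1 t)) ^ j \<partial>M) = a j 0 / a 0 0"
  proof (rule hausdorff_moment_normalized[of "\<lambda>i q. a i q / a 0 0"])
    show "0 \<le> a i q / a 0 0" for i q using nonneg c by simp
    show "a i q / a 0 0 = a (Suc i) q / a 0 0 + a i (Suc q) / a 0 0" for i q
      by (subst rec) (rule add_divide_distrib)
  qed (use c in auto)
  interpret real_distribution M by fact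
  let ?c = "\<lambda>t::real. max 0 (min 1 t)"
  define N where "N = scale_measure (ennreal (a 0 0)) (distr M borel ?c)"
  have sN: "sets N = sets borel" by (simp add: N_def)
  show thesis
  proof (rule that[of N])
    show "finite_measure N"
      by (rule finite_measureI)
        (use emeasure_finite in \<open>auto simp: N_def emeasure_distr ennreal_mult_eq_top_iff space_scale_measure\<close>)
    show "sets N = sets borel" by (rule sN)
    have "emeasure N (- {0..1}) = 0"
    proof -
      have "?c -` (- {0..1}) \<inter> space M = {}" by auto
      then show ?thesis by (simp add: N_def emeasure_distr)
    qed
    then show "AE t in N. t \<in> {0..1}"
      by (intro AE_I[where N="- {0..1}"]) (auto simp: sN)
    fix j
    have "(\<integral>t. t ^ j \<partial>N) = (\<integral>t. t ^ j \<partial>density (distr M borel ?c) (\<lambda>_. ennreal (a 0 0)))"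
      by (intro arg_cong2[where f="integral\<^sup>L"] measure_eqI refl)
        (auto simp: N_def emeasure_density_const)
    also have "\<dots> = a 0 0 * (\<integral>t. t ^ j \<partial>distr M borel ?c)"
      using c by (subst integral_density) auto
    also have "(\<integral>t. t ^ j \<partial>distr M borel ?c) = (\<integral>t. ?c t ^ j \<partial>M)"
      by (rule integral_distr) auto
    finally show "(\<integral>t. t ^ j \<partial>N) = a j 0" using M(2)[of j] c by simp
  qed
qed

section \<open>The spectral theorem for a positive contraction\<close>

lemma bounded_clinear_limit:
  fixes P :: "nat \<Rightarrow> 'h::chilbert \<Rightarrow> 'h"
  assumes P: "\<And>n. bounded_clinear (P n)" "\<And>n x. norm (P n x) \<le> K * norm x"
    and lim: "\<And>x. (\<lambda>n. P n x) \<longlonglongrightarrow> T x"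
  shows "bounded_clinear T"
proof (rule bounded_clinearI[where K=K])
  show "T (x + y) = T x + T y" for x y
    by (rule LIMSEQ_unique[OF lim])
      (use tendsto_add[OF lim[of x] lim[of y]] in \<open>simp add: bounded_clinear_simps[OF P(1)]\<close>)
  show "T (c *\<^sub>C x) = c *\<^sub>C T x" for c x
    by (rule LIMSEQ_unique[OF lim])
      (use tendsto_scaleC[OF lim[of x], of c] in \<open>simp add: bounded_clinear_simps[OF P(1)]\<close>)
  show "norm (T x) \<le> K * norm x" for x
    by (rule LIMSEQ_le_const2[OF tendsto_norm[OF lim]]) (use P(2) in auto)
qed

lemma symmetric_op_limit:
  fixes P :: "nat \<Rightarrow> 'h::chilbert \<Rightarrow> 'h"
  assumes P: "\<And>n. symmetric_op (P n)" and lim: "\<And>x. (\<lambda>n. P n x) \<longlonglongrightarrow> T x"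
  shows "symmetric_op T"
  unfolding symmetric_op_def
proof (intro allI)
  fix x y
  have "(\<lambda>n. cinner (P n x) y) \<longlonglongrightarrow> cinner (T x) y" "(\<lambda>n. cinner x (P n y)) \<longlonglongrightarrow> cinner x (T y)"
    by (intro tendsto_cinner lim tendsto_const)+
  moreover have "cinner (P n x) y = cinner x (P n y)" for n using P by (simp add: symmetric_op_def)
  ultimately show "cinner (T x) y = cinner x (T y)" by (simp add: LIMSEQ_unique)
qed

text \<open>Continuous ramps of slope \<open>k\<close> decrease to the indicator function; Weierstrass approximates the
  \<open>k\<close>-th one by a polynomial up to \<open>1 / (k + 1)\<close>.\<close>

lemma bounded_polynomials_to_halfline:
  fixes \<alpha> :: real
  obtains a :: "nat \<Rightarrow> nat \<Rightarrow> real" and n :: "nat \<Rightarrow> nat"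
  where "\<And>k t. t \<in> {0..1} \<Longrightarrow> \<bar>\<Sum>i\<le>n k. a k i * t ^ i\<bar> \<le> 2"
    and "\<And>t. t \<in> {0..1} \<Longrightarrow> (\<lambda>k. \<Sum>i\<le>n k. a k i * t ^ i) \<longlonglongrightarrow> indicator {..\<alpha>} t"
proof -
  define f where "f k t = max 0 (min 1 (1 - real k * (t - \<alpha>)))" for k :: nat and t :: real
  have "\<exists>p. real_polynomial_function p \<and> (\<forall>t\<in>{0..1}. \<bar>f k t - p t\<bar> < 1 / real (Suc k))" for k
  proof -
    obtain p where "real_polynomial_function p" "\<And>t. t \<in> {0..1} \<Longrightarrow> \<bar>f k t - p t\<bar> < 1 / real (Suc k)"
    proof (rule Stone_Weierstrass_real_polynomial_function[of "{0..1::real}" "f k" "1 / real (Suc k)"])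
      show "continuous_on {0..1} (f k)" unfolding f_def by (intro continuous_intros)
    qed auto
    then show ?thesis by blast
  qed
  then have "\<exists>a n. \<forall>t\<in>{0..1}. \<bar>f k t - (\<Sum>i\<le>n. a i * t ^ i)\<bar> < 1 / real (Suc k)" for k :: nat
    unfolding real_polynomial_function_iff_sum by blast
  then obtain a where "\<And>k. \<exists>n. \<forall>t\<in>{0..1}. \<bar>f k t - (\<Sum>i\<le>n. a k i * t ^ i)\<bar> < 1 / real (Suc k)"
    using choice[of "\<lambda>k a. \<exists>n. \<forall>t\<in>{0..1}. \<bar>f k t - (\<Sum>i\<le>n. a i * t ^ i)\<bar> < 1 / real (Suc k)"] by blast
  then obtain n where "\<And>k. \<forall>t\<in>{0..1}. \<bar>f k t - (\<Sum>i\<le>n k. a k i * t ^ i)\<bar> < 1 / real (Suc k)"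
    using choice[of "\<lambda>k n. \<forall>t\<in>{0..1}. \<bar>f k t - (\<Sum>i\<le>n. a k i * t ^ i)\<bar> < 1 / real (Suc k)"] by blast
  then have an: "\<bar>f k t - (\<Sum>i\<le>n k. a k i * t ^ i)\<bar> < 1 / real (Suc k)" if "t \<in> {0..1}" for k t
    using that by blast
  show thesis
  proof (rule that)
    fix k and t :: real assume t: "t \<in> {0..1}"
    have "1 / real (Suc k) \<le> 1" "\<bar>f k t\<bar> \<le> 1" by (auto simp: f_def)
    with an[OF t, of k] show "\<bar>\<Sum>i\<le>n k. a k i * t ^ i\<bar> \<le> 2" by linarith
  next
    fix t :: real assume t: "t \<in> {0..1}"
    have "(\<lambda>k. f k t) \<longlonglongrightarrow> indicator {..\<alpha>} t"
    proof (cases "t \<le> \<alpha>")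
      case True
      then have "f k t = 1" for k using mult_nonneg_nonpos[of "real k" "t - \<alpha>"] by (auto simp: f_def)
      with True show ?thesis by simp
    next
      case False
      then obtain N where N: "1 / (t - \<alpha>) < real N" using reals_Archimedean2 by blast
      have "f k t = 0" if "k \<ge> N" for k
      proof -
        have "1 / (t - \<alpha>) \<le> real k" using N that by linarith
        then have "1 \<le> real k * (t - \<alpha>)" using False by (simp add: divide_le_eq)
        then show ?thesis by (simp add: f_def)
      qed
      then have "\<forall>\<^sub>F k in sequentially. f k t = 0" by (auto simp: eventually_sequentially)
      with False show ?thesis by (simp add: tendsto_eventually)
    qed
    moreover have "(\<lambda>k. (\<Sum>i\<le>n k. a k i * t ^ i) - f k t) \<longlonglongrightarrow> 0"
    proof (rule Lim_null_comparison)
      show "\<forall>\<^sub>F k in sequentially. norm ((\<Sum>i\<le>n k. a k i * t ^ i) - f k t) \<le> 1 / real (Suc k)"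
        using an[OF t] by (auto simp: abs_minus_commute intro!: less_imp_le always_eventually)
      show "(\<lambda>k. 1 / real (Suc k)) \<longlonglongrightarrow> 0" by (intro LIMSEQ_Suc lim_1_over_n)
    qed
    ultimately have "(\<lambda>k. (\<Sum>i\<le>n k. a k i * t ^ i) - f k t + f k t) \<longlonglongrightarrow> 0 + indicator {..\<alpha>} t"
      by (intro tendsto_add)
    then show "(\<lambda>k. \<Sum>i\<le>n k. a k i * t ^ i) \<longlonglongrightarrow> indicator {..\<alpha>} t" by simp
  qed
qed

text \<open>The spectral measure of \<open>0 \<le> R \<le> 1\<close>. For each vector \<open>x\<close> the numbers \<open>\<langle>x, R\<^sup>j x\<rangle>\<close> are the moments
  of a measure \<open>\<nu> x\<close> on \<open>[0, 1]\<close>; the projections are then found as the operators with diagonal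
  elements \<open>\<nu> x S\<close>.\<close>

locale positive_contraction =
  fixes R :: "'h::chilbert \<Rightarrow> 'h"
  assumes R: "positive_op R" and R_le: "inner x (R x) \<le> (norm x)\<^sup>2"
begin

lemmas bc_R = positive_opD(1)[OF R]
lemmas lin_R = bounded_clinear_simps[OF bc_R]
lemmas sym_R = positive_op_symmetric[OF R]

definition D :: "'h \<Rightarrow> 'h" where "D x = x - R x"

lemma inner_R: "inner (R x) y = inner x (R y)" by (rule symmetric_op_inner[OF sym_R])
lemma inner_D: "inner (D x) y = inner x (D y)" by (simp add: D_def inner_simps inner_R)

lemma D_pow_R: "(D ^^ j) (R x) = R ((D ^^ j) x)"
  by (induction j) (simp_all add: D_def lin_R)

lemma R_pow_D: "(R ^^ i) (D x) = D ((R ^^ i) x)"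
  by (induction i) (simp_all add: D_def lin_R)

lemma D_pow_add_2: "(D ^^ (j + 2)) x = D ((D ^^ j) (D x))"
  by (simp add: funpow_swap1)

text \<open>Peeling off a factor \<open>R\<close> or \<open>D = 1 - R\<close> on each side lowers an exponent by two. What remains
  is \<open>1\<close>, \<open>R\<close>, \<open>D\<close> or \<open>R D = R - R\<^sup>2\<close>.\<close>

lemma monomial_nonneg: "0 \<le> inner x ((R ^^ i) ((D ^^ j) x))"
proof (induction i arbitrary: x rule: nat_induct2)
  case 0
  show ?case
  proof (induction j arbitrary: x rule: nat_induct2)
    case 1
    show ?case using R_le[of x] by (simp add: D_def inner_simps power2_norm_eq_inner)
  next
    case (step j)
    have "inner x ((R ^^ 0) ((D ^^ (j + 2)) x)) = inner (D x) ((D ^^ j) (D x))"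
      unfolding D_pow_add_2 by (simp add: inner_D)
    with step[of "D x"] show ?case by simp
  qed simp
next
  case 1
  show ?case
  proof (induction j arbitrary: x rule: nat_induct2)
    case 0
    show ?case using positive_opD(2)[OF R] by simp
  next
    case 1
    have "(norm (R x))\<^sup>2 \<le> 1 * inner x (R x)"
      by (rule positive_contraction_norm_le[OF R]) (simp add: R_le)
    then show ?case by (simp add: D_def inner_simps inner_R lin_R power2_norm_eq_inner)
  next
    case (step j)
    have "inner x ((R ^^ 1) ((D ^^ (j + 2)) x)) = inner (D x) ((R ^^ 1) ((D ^^ j) (D x)))"
      unfolding D_pow_add_2 by (simp add: inner_D R_pow_D[of 1, simplified])
    with step[of "D x"] show ?case by simp
  qed
next
  case (step i)
  have "inner x ((R ^^ (i + 2)) ((D ^^ j) x)) = inner (R x) ((R ^^ i) ((D ^^ j) (R x)))"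
    by (simp add: inner_R funpow_swap1 D_pow_R)
  with step[of "R x"] show ?case by simp
qed

lemma moment_measure_exists:
  "\<exists>N. finite_measure N \<and> sets N = sets (borel::real measure) \<and> (AE t in N. t \<in> {0..1}) \<and>
     (\<forall>j. (\<integral>t. t ^ j \<partial>N) = inner x ((R ^^ j) x))"
proof (rule hausdorff_moment[of "\<lambda>i j. inner x ((R ^^ i) ((D ^^ j) x))"])
  show "0 \<le> inner x ((R ^^ i) ((D ^^ j) x))" for i j by (rule monomial_nonneg)
  show "inner x ((R ^^ i) ((D ^^ j) x))
    = inner x ((R ^^ Suc i) ((D ^^ j) x)) + inner x ((R ^^ i) ((D ^^ Suc j) x))" for i j
  proof -
    have "(R ^^ i) ((D ^^ Suc j) x) = (R ^^ i) ((D ^^ j) x) - (R ^^ Suc i) ((D ^^ j) x)"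
      by (simp add: D_def[of "(R ^^ i) ((D ^^ j) x)"] R_pow_D)
    then show ?thesis by (simp add: inner_simps)
  qed
qed auto

definition \<nu> :: "'h \<Rightarrow> real measure" where
  "\<nu> x = (SOME N. finite_measure N \<and> sets N = sets (borel::real measure) \<and> (AE t in N. t \<in> {0..1}) \<and>
     (\<forall>j. (\<integral>t. t ^ j \<partial>N) = inner x ((R ^^ j) x)))"

lemma finite_\<nu> [simp]: "finite_measure (\<nu> x)"
  and sets_\<nu> [simp, measurable_cong]: "sets (\<nu> x) = sets borel"
  and AE_\<nu>: "AE t in \<nu> x. t \<in> {0..1}"
  and moment_\<nu>: "(\<integral>t. t ^ j \<partial>\<nu> x) = inner x ((R ^^ j) x)"
proof -
  note 1 = someI_ex[OF moment_measure_exists, of x, folded \<nu>_def]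
  show "finite_measure (\<nu> x)" "sets (\<nu> x) = sets borel" "AE t in \<nu> x. t \<in> {0..1}"
    "(\<integral>t. t ^ j \<partial>\<nu> x) = inner x ((R ^^ j) x)"
    using 1 by blast+
qed

lemma space_\<nu> [simp]: "space (\<nu> x) = UNIV"
  using sets_eq_imp_space_eq[OF sets_\<nu>[of x]] by simp

lemma measure_\<nu>_UNIV: "measure (\<nu> x) UNIV = (norm x)\<^sup>2"
  using moment_\<nu>[of x 0] by (simp add: power2_norm_eq_inner)

lemma integrable_\<nu>:
  assumes "f \<in> borel_measurable borel" "\<And>t. t \<in> {0..1} \<Longrightarrow> \<bar>f t\<bar> \<le> K"
  shows "integrable (\<nu> x) (f :: real \<Rightarrow> real)"
proof -
  interpret finite_measure "\<nu> x" by simp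
  show ?thesis
    by (rule integrable_const_bound[where B=K]) (use assms AE_\<nu>[of x] in \<open>auto elim: eventually_mono\<close>)
qed

definition poly_op :: "(nat \<Rightarrow> real) \<Rightarrow> nat \<Rightarrow> 'h \<Rightarrow> 'h" where
  "poly_op a n x = (\<Sum>i\<le>n. a i *\<^sub>R (R ^^ i) x)"

lemma bounded_clinear_poly_op: "bounded_clinear (poly_op a n)"
proof (induction n)
  case 0
  show ?case unfolding poly_op_def by (simp add: bounded_clinear_scaleR[OF bounded_clinear_ident])
next
  case (Suc n)
  have "poly_op a (Suc n) = (\<lambda>x. poly_op a n x + a (Suc n) *\<^sub>R (R ^^ Suc n) x)"
    by (simp add: fun_eq_iff poly_op_def)
  then show ?case
    using bounded_clinear_add[OF Suc bounded_clinear_scaleR[OF bounded_clinear_funpow[OF bc_R]]]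
    by (simp only:)
qed

lemma symmetric_poly_op: "symmetric_op (poly_op a n)"
  using symmetric_op_funpow[OF sym_R]
  by (simp add: symmetric_op_def poly_op_def cinner_sum_left cinner_sum_right cinner_simps)

lemma integrable_monomial: "integrable (\<nu> x) (\<lambda>t. t ^ j)"
  by (rule integrable_\<nu>[where K=1]) (auto simp: power_le_one)

lemma inner_poly_op: "inner x (poly_op a n x) = (\<integral>t. (\<Sum>i\<le>n. a i * t ^ i) \<partial>\<nu> x)"
  by (simp add: poly_op_def inner_sum_right moment_\<nu> integrable_monomial)

lemma inner_poly_op_poly_op:
  "inner (poly_op a n x) (poly_op b m x) = (\<integral>t. (\<Sum>i\<le>n. a i * t ^ i) * (\<Sum>j\<le>m. b j * t ^ j) \<partial>\<nu> x)"
proof -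
  have pow: "inner ((R ^^ i) x) ((R ^^ j) x) = (\<integral>t. t ^ (i + j) \<partial>\<nu> x)" for i j
    using symmetric_op_inner[OF symmetric_op_funpow[OF sym_R], of i x "(R ^^ j) x"]
    by (simp add: moment_\<nu> funpow_add)
  have "inner (poly_op a n x) (poly_op b m x) = (\<Sum>i\<le>n. \<Sum>j\<le>m. a i * b j * (\<integral>t. t ^ (i + j) \<partial>\<nu> x))"
    by (simp add: poly_op_def inner_sum_left inner_sum_right pow sum_distrib_left mult.assoc)
      (subst sum.swap, simp add: mult.left_commute)
  also have "\<dots> = (\<integral>t. (\<Sum>i\<le>n. \<Sum>j\<le>m. a i * b j * t ^ (i + j)) \<partial>\<nu> x)"
    by (simp add: integrable_monomial)
  also have "(\<lambda>t. \<Sum>i\<le>n. \<Sum>j\<le>m. a i * b j * t ^ (i + j))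
      = (\<lambda>t. (\<Sum>i\<le>n. a i * t ^ i) * (\<Sum>j\<le>m. b j * t ^ j))"
    by (simp add: fun_eq_iff sum_product power_add mult.assoc mult.left_commute)
  finally show ?thesis .
qed

lemma integral_poly_limit:
  assumes f: "\<And>k. f k \<in> borel_measurable borel" "\<And>k t. t \<in> {0..1} \<Longrightarrow> \<bar>f k t\<bar> \<le> K"
    "\<And>t. t \<in> {0..1} \<Longrightarrow> (\<lambda>k. f k t) \<longlonglongrightarrow> g t" and g: "g \<in> borel_measurable borel"
  shows "(\<lambda>k. \<integral>t. f k t \<partial>\<nu> x) \<longlonglongrightarrow> (\<integral>t. g t \<partial>\<nu> x :: real)"
proof (rule integral_dominated_convergence[where w="\<lambda>_. K"])
  interpret finite_measure "\<nu> x" by simp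
  show "integrable (\<nu> x) (\<lambda>_. K)" by simp
  show "AE t in \<nu> x. (\<lambda>k. f k t) \<longlonglongrightarrow> g t" using AE_\<nu> by eventually_elim (rule f(3))
  show "AE t in \<nu> x. norm (f k t) \<le> K" for k using AE_\<nu> by eventually_elim (simp add: f(2))
qed (use f g in simp_all)

text \<open>For the half-line below \<open>\<alpha>\<close> the projection is a strong limit of polynomials in \<open>R\<close>. The
  approximating polynomials do not depend on \<open>x\<close>, so the limit is linear, and products of two such
  limits are controlled by the products of the polynomials.\<close>

lemma halfline_projections:
  obtains T :: "real \<Rightarrow> 'h \<Rightarrow> 'h" where
    "\<And>\<alpha>. bounded_clinear (T \<alpha>)" "\<And>\<alpha>. symmetric_op (T \<alpha>)"
    "\<And>\<alpha> x. inner x (T \<alpha> x) = measure (\<nu> x) {..\<alpha>}"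
    "\<And>\<alpha> \<beta> x. inner (T \<alpha> x) (T \<beta> x) = measure (\<nu> x) ({..\<alpha>} \<inter> {..\<beta>})"
proof -
  define Q :: "real \<Rightarrow> (nat \<Rightarrow> nat \<Rightarrow> real) \<Rightarrow> (nat \<Rightarrow> nat) \<Rightarrow> bool" where
    "Q \<alpha> a n \<longleftrightarrow> (\<forall>t\<in>{0..1}. (\<forall>k. \<bar>\<Sum>i\<le>n k. a k i * t ^ i\<bar> \<le> 2) \<and>
      (\<lambda>k. \<Sum>i\<le>n k. a k i * t ^ i) \<longlonglongrightarrow> indicator {..\<alpha>} t)" for \<alpha> a n
  have "\<exists>a n. Q \<alpha> a n" for \<alpha> :: real
  proof (rule bounded_polynomials_to_halfline[of \<alpha>])
    fix a n
    assume "\<And>k t. t \<in> {0..1} \<Longrightarrow> \<bar>\<Sum>i\<le>n k. a k i * t ^ i\<bar> \<le> 2"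
      "\<And>t. t \<in> {0..1} \<Longrightarrow> (\<lambda>k. \<Sum>i\<le>n k. a k i * t ^ i) \<longlonglongrightarrow> indicator {..\<alpha>} t"
    then have "Q \<alpha> a n" unfolding Q_def by blast
    then show ?thesis by blast
  qed
  then obtain a n where "\<And>\<alpha>. Q \<alpha> (a \<alpha>) (n \<alpha>)" by metis
  then have an: "\<bar>\<Sum>i\<le>n \<alpha> k. a \<alpha> k i * t ^ i\<bar> \<le> 2"
      "(\<lambda>k. \<Sum>i\<le>n \<alpha> k. a \<alpha> k i * t ^ i) \<longlonglongrightarrow> indicator {..\<alpha>} t"
    if "t \<in> {0..1}" for \<alpha> t k
    using that by (auto simp: Q_def)
  define p where "p \<alpha> k t = (\<Sum>i\<le>n \<alpha> k. a \<alpha> k i * t ^ i)" for \<alpha> k and t :: real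
  define P where "P \<alpha> k = poly_op (a \<alpha> k) (n \<alpha> k)" for \<alpha> k
  have p_meas[measurable]: "p \<alpha> k \<in> borel_measurable borel" for \<alpha> k unfolding p_def by measurable
  have p_le: "\<bar>p \<alpha> k t\<bar> \<le> 2" if "t \<in> {0..1}" for \<alpha> k t using an(1)[OF that] by (simp add: p_def)
  have p_lim: "(\<lambda>k. p \<alpha> k t) \<longlonglongrightarrow> indicator {..\<alpha>} t" if "t \<in> {0..1}" for \<alpha> t
    using an(2)[OF that] by (simp add: p_def)
  have PP: "inner (P \<alpha> k x) (P \<beta> l x) = (\<integral>t. p \<alpha> k t * p \<beta> l t \<partial>\<nu> x)" for \<alpha> k \<beta> l x
    by (simp add: P_def p_def inner_poly_op_poly_op)
  have pp_le: "\<bar>p \<alpha> k t * p \<beta> l t\<bar> \<le> 4" if "t \<in> {0..1}" for \<alpha> k \<beta> l t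
    using mult_mono[OF p_le[OF that, of \<alpha> k] p_le[OF that, of \<beta> l]] by (simp add: abs_mult)
  have pp_int: "integrable (\<nu> x) (\<lambda>t. p \<alpha> k t * p \<beta> l t)" for \<alpha> k \<beta> l x
    by (rule integrable_\<nu>[where K=4]) (use pp_le in auto)
  have P_le: "norm (P \<alpha> k x) \<le> 2 * norm x" for \<alpha> k x
  proof (rule power2_le_imp_le)
    interpret finite_measure "\<nu> x" by simp
    have "(norm (P \<alpha> k x))\<^sup>2 = (\<integral>t. p \<alpha> k t * p \<alpha> k t \<partial>\<nu> x)" by (simp add: power2_norm_eq_inner PP)
    also have "\<dots> \<le> (\<integral>t. 4 \<partial>\<nu> x)"
    proof (rule integral_mono_AE[OF pp_int])
      show "AE t in \<nu> x. p \<alpha> k t * p \<alpha> k t \<le> 4"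
        using AE_\<nu> by eventually_elim (rule order_trans[OF abs_ge_self pp_le])
    qed simp
    also have "\<dots> = (2 * norm x)\<^sup>2" by (simp add: measure_\<nu>_UNIV power_mult_distrib)
    finally show "(norm (P \<alpha> k x))\<^sup>2 \<le> (2 * norm x)\<^sup>2" .
  qed simp
  have "\<exists>y. (\<lambda>k. P \<alpha> k x) \<longlonglongrightarrow> y" for \<alpha> x
  proof -
    let ?i = "indicator {..\<alpha>} :: real \<Rightarrow> real"
    have dist: "(\<lambda>k. \<integral>t. (p \<alpha> k t - ?i t)\<^sup>2 \<partial>\<nu> x) \<longlonglongrightarrow> (\<integral>t. 0 \<partial>\<nu> x)"
    proof (rule integral_poly_limit[where K=9])
      show "\<bar>(p \<alpha> k t - ?i t)\<^sup>2\<bar> \<le> 9" if "t \<in> {0..1}" for k t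
      proof -
        have "\<bar>p \<alpha> k t - ?i t\<bar> \<le> 3" using p_le[OF that, of \<alpha> k] by (auto simp: indicator_def)
        from power_mono[OF this, of 2] show ?thesis by simp
      qed
      show "(\<lambda>k. (p \<alpha> k t - ?i t)\<^sup>2) \<longlonglongrightarrow> 0" if "t \<in> {0..1}" for t
        using tendsto_power[OF tendsto_diff[OF p_lim[OF that, of \<alpha>] tendsto_const[of "?i t"]], of 2] by simp
    qed measurable
    have int2: "integrable (\<nu> x) (\<lambda>t. (p \<alpha> k t - ?i t)\<^sup>2)" for k
    proof (rule integrable_\<nu>[where K=9])
      show "\<bar>(p \<alpha> k t - ?i t)\<^sup>2\<bar> \<le> 9" if "t \<in> {0..1}" for t
      proof -
        have "\<bar>p \<alpha> k t - ?i t\<bar> \<le> 3" using p_le[OF that, of \<alpha> k] by (auto simp: indicator_def)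
        from power_mono[OF this, of 2] show ?thesis by simp
      qed
    qed measurable
    have "convergent (\<lambda>k. P \<alpha> k x)"
      by (rule convergent_if_L2_convergent[OF PP pp_int int2]) (use dist in simp)
    then show ?thesis by (simp add: convergent_def)
  qed
  then obtain T where T: "\<And>\<alpha> x. (\<lambda>k. P \<alpha> k x) \<longlonglongrightarrow> T \<alpha> x" by metis
  show thesis
  proof (rule that[of T])
    show "bounded_clinear (T \<alpha>)" for \<alpha>
      by (rule bounded_clinear_limit[OF _ P_le T]) (simp add: P_def bounded_clinear_poly_op)
    show "symmetric_op (T \<alpha>)" for \<alpha>
      by (rule symmetric_op_limit[OF _ T]) (simp add: P_def symmetric_poly_op)
    show "inner x (T \<alpha> x) = measure (\<nu> x) {..\<alpha>}" for \<alpha> x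
    proof (rule LIMSEQ_unique)
      show "(\<lambda>k. inner x (P \<alpha> k x)) \<longlonglongrightarrow> inner x (T \<alpha> x)" by (intro tendsto_intros T)
      have "(\<lambda>k. \<integral>t. p \<alpha> k t \<partial>\<nu> x) \<longlonglongrightarrow> (\<integral>t. indicator {..\<alpha>} t \<partial>\<nu> x)"
        by (rule integral_poly_limit[where K=2]) (use p_le p_lim in auto)
      then show "(\<lambda>k. inner x (P \<alpha> k x)) \<longlonglongrightarrow> measure (\<nu> x) {..\<alpha>}"
        by (simp add: P_def p_def inner_poly_op)
    qed
    show "inner (T \<alpha> x) (T \<beta> x) = measure (\<nu> x) ({..\<alpha>} \<inter> {..\<beta>})" for \<alpha> \<beta> x
    proof (rule LIMSEQ_unique)
      show "(\<lambda>k. inner (P \<alpha> k x) (P \<beta> k x)) \<longlonglongrightarrow> inner (T \<alpha> x) (T \<beta> x)" by (intro tendsto_intros T)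
      have "(\<lambda>k. \<integral>t. p \<alpha> k t * p \<beta> k t \<partial>\<nu> x) \<longlonglongrightarrow> (\<integral>t. indicator ({..\<alpha>} \<inter> {..\<beta>}) t \<partial>\<nu> x)"
        unfolding indicator_inter_arith
        by (rule integral_poly_limit[where K=4]) (use pp_le p_lim in \<open>auto intro: tendsto_mult\<close>)
      then show "(\<lambda>k. inner (P \<alpha> k x) (P \<beta> k x)) \<longlonglongrightarrow> measure (\<nu> x) ({..\<alpha>} \<inter> {..\<beta>})"
        unfolding PP by simp
    qed
  qed
qed

text \<open>The sets \<open>S\<close> that are represented by an operator form a Dynkin system that contains the
  half-lines.\<close>

definition represents :: "real set \<Rightarrow> ('h \<Rightarrow> 'h) \<Rightarrow> bool" where
  "represents S T \<longleftrightarrow> bounded_clinear T \<and> symmetric_op T \<and> (\<forall>x. inner x (T x) = measure (\<nu> x) S)"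

lemma represents_unique: "represents S T \<Longrightarrow> represents S T' \<Longrightarrow> T = T'"
  unfolding represents_def by (rule bounded_clinear_eqI) (auto simp: symmetric_op_diag)

lemma represents_compl:
  assumes "represents S T" "S \<in> sets borel"
  shows "represents (UNIV - S) (\<lambda>x. x - T x)"
proof -
  have "measure (\<nu> x) (UNIV - S) = (norm x)\<^sup>2 - measure (\<nu> x) S" for x
    using finite_measure.finite_measure_compl[OF finite_\<nu>, of S x] assms(2) by (simp add: measure_\<nu>_UNIV)
  then show ?thesis
    using assms(1) bounded_clinear_diff[OF bounded_clinear_ident, of T]
    by (auto simp: represents_def symmetric_op_def cinner_simps inner_simps power2_norm_eq_inner)
qed

lemma represents_norm_le:
  assumes "represents S T"
  shows "(norm (T x))\<^sup>2 \<le> measure (\<nu> x) S"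
proof -
  have T: "positive_op T" using assms by (intro positive_opI) (auto simp: represents_def)
  have "inner y (T y) \<le> 1 * (norm y)\<^sup>2" for y
  proof -
    interpret finite_measure "\<nu> y" by simp
    show ?thesis using assms bounded_measure[of S] by (simp add: represents_def measure_\<nu>_UNIV)
  qed
  from positive_contraction_norm_le[OF T this, of x] assms show ?thesis
    by (simp add: represents_def)
qed

lemma represents_sum:
  assumes T: "\<And>i. i \<in> I \<Longrightarrow> represents (S i) (T i)" and S: "\<And>i. i \<in> I \<Longrightarrow> S i \<in> sets borel"
    and d: "disjoint_family_on S I" and I: "finite I"
  shows "represents (\<Union>i\<in>I. S i) (\<lambda>x. \<Sum>i\<in>I. T i x)"
proof -
  have "bounded_clinear (\<lambda>x. \<Sum>i\<in>I. T i x)"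
    using I T
  proof (induction I rule: finite_induct)
    case (insert i I)
    then show ?case using bounded_clinear_add[of "T i" "\<lambda>x. \<Sum>i\<in>I. T i x"] by (simp add: represents_def)
  qed (simp add: bounded_clinear_zero)
  moreover have "symmetric_op (\<lambda>x. \<Sum>i\<in>I. T i x)"
    using T by (simp add: represents_def symmetric_op_def cinner_sum_left cinner_sum_right)
  moreover have "inner x (\<Sum>i\<in>I. T i x) = measure (\<nu> x) (\<Union>i\<in>I. S i)" for x
  proof -
    interpret finite_measure "\<nu> x" by simp
    have "measure (\<nu> x) (\<Union>i\<in>I. S i) = (\<Sum>i\<in>I. measure (\<nu> x) (S i))"
      by (rule finite_measure_finite_Union[OF I _ d]) (use S in auto)
    then show ?thesis using T by (simp add: represents_def inner_sum_right)
  qed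
  ultimately show ?thesis by (simp add: represents_def)
qed

text \<open>A sum of representing operators represents a union, so its squared norm at \<open>x\<close> is at most the
  measure of the union: the series is Cauchy because the measures are summable.\<close>

lemma represents_UN:
  fixes S :: "nat \<Rightarrow> real set"
  assumes T: "\<And>i. represents (S i) (T i)" and S: "\<And>i. S i \<in> sets borel" and d: "disjoint_family S"
  obtains U where "represents (\<Union>i. S i) U" "\<And>x. (\<lambda>i. T i x) sums U x"
proof -
  have fin: "represents (\<Union>i\<in>I. S i) (\<lambda>x. \<Sum>i\<in>I. T i x)" if "finite I" for I
    by (rule represents_sum) (use T S d that in \<open>auto simp: disjoint_family_on_def\<close>)
  have m_sums: "(\<lambda>i. measure (\<nu> x) (S i)) sums measure (\<nu> x) (\<Union>i. S i)" for x
  proof -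
    interpret finite_measure "\<nu> x" by simp
    show ?thesis by (rule finite_measure_UNION) (use S d in auto)
  qed
  have "summable (\<lambda>i. T i x)" for x
    unfolding summable_Cauchy
  proof (intro allI impI)
    fix e :: real assume e: "e > 0"
    interpret finite_measure "\<nu> x" by simp
    obtain N where N: "\<And>m n. m \<ge> N \<Longrightarrow> norm (\<Sum>i=m..<n. measure (\<nu> x) (S i)) < e\<^sup>2"
      using sums_summable[OF m_sums[of x]] e unfolding summable_Cauchy by (meson zero_less_power)
    have "norm (\<Sum>i=m..<n. T i x) < e" if "m \<ge> N" for m n
    proof (rule power2_less_imp_less)
      have "(norm (\<Sum>i=m..<n. T i x))\<^sup>2 \<le> measure (\<nu> x) (\<Union>i\<in>{m..<n}. S i)"
        by (rule represents_norm_le[OF fin]) simp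
      also have "\<dots> = (\<Sum>i=m..<n. measure (\<nu> x) (S i))"
        by (rule finite_measure_finite_Union) (use S d in \<open>auto simp: disjoint_family_on_def\<close>)
      finally show "(norm (\<Sum>i=m..<n. T i x))\<^sup>2 < e\<^sup>2" using N[OF that, of n] by simp
    qed (use e in simp)
    then show "\<exists>N. \<forall>m\<ge>N. \<forall>n. norm (\<Sum>i=m..<n. T i x) < e" by blast
  qed
  then have U: "(\<lambda>i. T i x) sums (\<Sum>i. T i x)" for x by (rule summable_sums)
  have lim: "(\<lambda>n. \<Sum>i<n. T i x) \<longlonglongrightarrow> (\<Sum>i. T i x)" for x using U[of x] by (simp add: sums_def)
  have "represents (\<Union>i. S i) (\<lambda>x. \<Sum>i. T i x)"
    unfolding represents_def
  proof (intro conjI allI)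
    show "bounded_clinear (\<lambda>x. \<Sum>i. T i x)"
    proof (rule bounded_clinear_limit[OF _ _ lim, where K=1])
      show "bounded_clinear (\<lambda>x. \<Sum>i<n. T i x)" for n using fin[of "{..<n}"] by (simp add: represents_def)
      show "norm (\<Sum>i<n. T i x) \<le> 1 * norm x" for n x
      proof (rule power2_le_imp_le)
        interpret finite_measure "\<nu> x" by simp
        have "(norm (\<Sum>i<n. T i x))\<^sup>2 \<le> measure (\<nu> x) (space (\<nu> x))"
          by (rule order_trans[OF represents_norm_le[OF fin[of "{..<n}"], of x] bounded_measure]) simp
        then show "(norm (\<Sum>i<n. T i x))\<^sup>2 \<le> (1 * norm x)\<^sup>2"
          by (simp only: space_\<nu> measure_\<nu>_UNIV mult_1)
      qed simp
    qed
    show "symmetric_op (\<lambda>x. \<Sum>i. T i x)"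
      by (rule symmetric_op_limit[OF _ lim]) (use fin[of "{..<_}"] in \<open>simp add: represents_def\<close>)
    show "inner x (\<Sum>i. T i x) = measure (\<nu> x) (\<Union>i. S i)" for x
    proof (rule sums_unique2)
      show "(\<lambda>i. inner x (T i x)) sums inner x (\<Sum>i. T i x)"
        by (rule bounded_linear.sums[OF bounded_linear_inner_right U])
      show "(\<lambda>i. inner x (T i x)) sums measure (\<nu> x) (\<Union>i. S i)"
        using m_sums[of x] T by (simp add: represents_def)
    qed
  qed
  with U that show thesis by blast
qed

lemma borel_induct [consumes 1, case_names halfline empty compl union]:
  assumes "S \<in> sets (borel :: real measure)"
    and "\<And>\<alpha>. P {..\<alpha>}" "P {}" "\<And>S. S \<in> sets borel \<Longrightarrow> P S \<Longrightarrow> P (UNIV - S)"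
    and "\<And>F. disjoint_family F \<Longrightarrow> range F \<subseteq> sets borel \<Longrightarrow> (\<And>i. P (F i)) \<Longrightarrow> P (\<Union>i::nat. F i)"
  shows "P S"
proof -
  have b: "sets (borel :: real measure) = sigma_sets UNIV (range (\<lambda>\<alpha>. {..\<alpha>}))"
    by (subst borel_eq_atMost) simp
  have "Int_stable (range (\<lambda>\<alpha>::real. {..\<alpha>}))"
    by (auto simp: Int_stable_def)
  then show ?thesis
    by (rule sigma_sets_induct_disjoint[where \<Omega>=UNIV and A=S and P=P])
      (use assms in \<open>auto simp: b[symmetric]\<close>)
qed

lemma represents_exists: "S \<in> sets borel \<Longrightarrow> \<exists>T. represents S T"
proof (induction S rule: borel_induct)
  case (halfline \<alpha>)
  obtain T where "bounded_clinear (T \<alpha>)" "symmetric_op (T \<alpha>)" "\<And>x. inner x (T \<alpha> x) = measure (\<nu> x) {..\<alpha>}"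
    using halfline_projections by metis
  then show ?case by (auto simp: represents_def)
next
  case empty
  have "represents {} (\<lambda>_. 0)" by (simp add: represents_def bounded_clinear_zero symmetric_op_def)
  then show ?case by blast
next
  case (compl S)
  then show ?case using represents_compl by blast
next
  case (union F)
  then obtain T where "\<And>i. represents (F i) (T i)" by metis
  with union(1,2) show ?case by (metis represents_UN range_subsetD)
qed

definition F :: "real set \<Rightarrow> 'h \<Rightarrow> 'h" where "F S = (SOME T. represents S T)"

lemma represents_F: "S \<in> sets borel \<Longrightarrow> represents S (F S)"
  unfolding F_def by (rule someI_ex[OF represents_exists])

lemma F_eqI: "S \<in> sets borel \<Longrightarrow> represents S T \<Longrightarrow> F S = T"
  using represents_F represents_unique by blast

lemma F_compl: "S \<in> sets borel \<Longrightarrow> F (UNIV - S) x = x - F S x"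
  using F_eqI[OF _ represents_compl[OF represents_F]] by (simp add: fun_eq_iff borel_comp)

lemma F_empty: "F {} x = 0"
  by (subst F_eqI[where T="\<lambda>_. 0"]) (simp_all add: represents_def bounded_clinear_zero symmetric_op_def)

lemma F_sums:
  assumes "range S \<subseteq> sets borel" "disjoint_family S"
  shows "(\<lambda>i::nat. F (S i) x) sums F (\<Union>i. S i) x"
proof -
  have S: "S i \<in> sets borel" for i using assms(1) by auto
  then obtain U where U: "represents (\<Union>i. S i) U" "\<And>x. (\<lambda>i. F (S i) x) sums U x"
    using represents_UN[of S "\<lambda>i. F (S i)"] represents_F assms(2) by metis
  have "F (\<Union>i. S i) = U" by (rule F_eqI[OF _ U(1)]) (use S in auto)
  with U(2) show ?thesis by simp
qed

lemma bounded_clinear_F: "S \<in> sets borel \<Longrightarrow> bounded_clinear (F S)"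
  and symmetric_F: "S \<in> sets borel \<Longrightarrow> symmetric_op (F S)"
  and inner_F: "S \<in> sets borel \<Longrightarrow> inner x (F S x) = measure (\<nu> x) S"
  using represents_F by (auto simp: represents_def)

text \<open>For \<open>\<alpha> \<le> \<beta>\<close> the vector \<open>y = F {..\<alpha>} x\<close> satisfies \<open>\<langle>y, F {..\<beta>} y\<rangle> = \<parallel>y\<parallel>\<^sup>2\<close>, hence is fixed by
  \<open>F {..\<beta>}\<close>. The other order of the factors follows by taking adjoints.\<close>

lemma F_halfline_Int: "F {..\<alpha>} (F {..\<beta>} x) = F ({..\<alpha>} \<inter> {..\<beta>}) x"
proof -
  obtain T where T: "\<And>\<alpha>. bounded_clinear (T \<alpha>)" "\<And>\<alpha>. symmetric_op (T \<alpha>)"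
    "\<And>\<alpha> x. inner x (T \<alpha> x) = measure (\<nu> x) {..\<alpha>}"
    "\<And>\<alpha> \<beta> x. inner (T \<alpha> x) (T \<beta> x) = measure (\<nu> x) ({..\<alpha>} \<inter> {..\<beta>})"
    using halfline_projections by blast
  have FT: "F {..\<alpha>} = T \<alpha>" for \<alpha> by (rule F_eqI) (use T in \<open>simp_all add: represents_def\<close>)
  have m: "{..\<alpha>} \<inter> {..\<beta>} = {..min \<alpha> \<beta>}" for \<alpha> \<beta> :: real by auto
  have eq: "inner (T \<alpha> x) (T \<beta> x) = inner x (T (min \<alpha> \<beta>) x)" for \<alpha> \<beta> x by (simp add: T(3,4) m)
  have idem: "T \<gamma> (T \<gamma> x) = T \<gamma> x" for \<gamma> x
  proof -
    have "(\<lambda>x. T \<gamma> (T \<gamma> x)) = T \<gamma>"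
    proof (rule bounded_clinear_eqI[OF bounded_clinear_compose[OF T(1) T(1)] T(1)])
      fix x
      have s: "symmetric_op (\<lambda>x. T \<gamma> (T \<gamma> x))" using T(2) by (simp add: symmetric_op_def)
      show "cinner x (T \<gamma> (T \<gamma> x)) = cinner x (T \<gamma> x)"
        using symmetric_op_diag[OF s, of x] symmetric_op_diag[OF T(2), of x] eq[of \<gamma> x \<gamma>]
          symmetric_op_inner[OF T(2), of \<gamma> x "T \<gamma> x"] by simp
    qed
    then show ?thesis by (rule fun_cong)
  qed
  have le: "T \<beta> (T \<alpha> x) = T \<alpha> x" if "\<alpha> \<le> \<beta>" for \<alpha> \<beta> x
  proof -
    let ?y = "T \<alpha> x"
    have y: "inner ?y (T \<beta> ?y) = inner ?y ?y"
      using eq[of \<alpha> ?y \<beta>] that by (simp add: idem)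
    have "inner (T \<beta> ?y) (T \<beta> ?y) = inner ?y (T \<beta> ?y)"
      using eq[of \<beta> ?y \<beta>] by simp
    with y have "inner (T \<beta> ?y - ?y) (T \<beta> ?y - ?y) = 0"
      by (simp add: inner_simps inner_commute)
    then show ?thesis by simp
  qed
  show ?thesis
  proof (cases "\<alpha> \<le> \<beta>")
    case True
    have "cinner z (T \<alpha> (T \<beta> x) - T \<alpha> x) = 0" for z
    proof -
      have "cinner z (T \<alpha> (T \<beta> x)) = cinner (T \<beta> (T \<alpha> z)) x"
        using T(2) by (simp add: symmetric_op_def)
      also have "\<dots> = cinner z (T \<alpha> x)" using le[OF True] T(2) by (simp add: symmetric_op_def)
      finally show ?thesis by (simp add: cinner_diff_right)
    qed
    then have "T \<alpha> (T \<beta> x) - T \<alpha> x = 0" by (rule cinner_extensionality)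
    with True show ?thesis by (simp add: m FT)
  next
    case False
    then show ?thesis using le[of \<beta> \<alpha>] by (simp add: m FT)
  qed
qed

text \<open>Multiplicativity spreads from half-lines to Borel sets one factor at a time; taking adjoints
  exchanges the factors.\<close>

lemma F_Int_if_halflines:
  assumes S: "S \<in> sets borel" and half: "\<And>\<alpha> x. F S (F {..\<alpha>} x) = F (S \<inter> {..\<alpha>}) x"
    and W: "W \<in> sets borel"
  shows "F S (F W x) = F (S \<inter> W) x"
  using W
proof (induction W arbitrary: x rule: borel_induct)
  case (halfline \<beta>)
  show ?case by (rule half)
next
  case empty
  show ?case by (simp add: F_empty bounded_clinear_simps[OF bounded_clinear_F[OF S]])
next
  case (compl W)
  have "F (S \<inter> (UNIV - W)) = (\<lambda>x. F S x - F (S \<inter> W) x)"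
  proof (rule F_eqI)
    have "measure (\<nu> x) (S \<inter> (UNIV - W)) = measure (\<nu> x) S - measure (\<nu> x) (S \<inter> W)" for x
    proof -
      interpret finite_measure "\<nu> x" by simp
      have "S \<inter> (UNIV - W) = S - S \<inter> W" by auto
      then show ?thesis using S compl(1) by (simp add: finite_measure_Diff)
    qed
    then show "represents (S \<inter> (UNIV - W)) (\<lambda>x. F S x - F (S \<inter> W) x)"
      using S compl(1) bounded_clinear_diff[OF bounded_clinear_F bounded_clinear_F, of S "S \<inter> W"]
        symmetric_F[of S] symmetric_F[of "S \<inter> W"]
      by (simp add: represents_def inner_diff_right inner_F symmetric_op_def cinner_simps)
  qed (use S compl(1) in auto)
  then show ?case
    using compl by (simp add: F_compl bounded_clinear_simps[OF bounded_clinear_F[OF S]])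
next
  case (union G)
  have G: "range (\<lambda>i. S \<inter> G i) \<subseteq> sets borel" "disjoint_family (\<lambda>i. S \<inter> G i)"
    using S union(1,2) by (auto simp: disjoint_family_on_def)
  have "(\<lambda>i. F S (F (G i) x)) sums F S (F (\<Union>i. G i) x)"
    by (rule bounded_linear.sums[OF bounded_clinear_bounded_linear[OF bounded_clinear_F[OF S]]
          F_sums[OF union(2,1)]])
  moreover have "(\<lambda>i. F (S \<inter> G i) x) sums F (S \<inter> (\<Union>i. G i)) x"
    using F_sums[OF G] by simp
  ultimately show ?case unfolding union(3) by (rule sums_unique2)
qed

lemma F_Int:
  assumes S: "S \<in> sets borel" and W: "W \<in> sets borel"
  shows "F S (F W x) = F (S \<inter> W) x"
proof (rule F_Int_if_halflines[OF S _ W])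
  fix \<alpha> x
  have half: "F {..\<alpha>} (F S y) = F ({..\<alpha>} \<inter> S) y" for y
    by (rule F_Int_if_halflines[OF _ F_halfline_Int S]) simp
  have sym: "cinner (F U y) z = cinner y (F U z)" if "U \<in> sets borel" for U y z
    using symmetric_F[OF that] by (simp add: symmetric_op_def)
  have "cinner z (F S (F {..\<alpha>} x) - F (S \<inter> {..\<alpha>}) x) = 0" for z
  proof -
    have "cinner z (F S (F {..\<alpha>} x)) = cinner (F {..\<alpha>} (F S z)) x" using S by (simp add: sym)
    also have "\<dots> = cinner (F (S \<inter> {..\<alpha>}) z) x" by (simp only: half Int_commute)
    also have "\<dots> = cinner z (F (S \<inter> {..\<alpha>}) x)" using S by (intro sym) auto
    finally show ?thesis by (simp add: cinner_diff_right)
  qed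
  then show "F S (F {..\<alpha>} x) = F (S \<inter> {..\<alpha>}) x"
    using cinner_extensionality[of "F S (F {..\<alpha>} x) - F (S \<inter> {..\<alpha>}) x"] by simp
qed

lemma projection_valued_measure_F: "projection_valued_measure F"
  unfolding projection_valued_measure_def
proof (intro conjI ballI allI impI)
  fix S :: "real set" assume S: "S \<in> sets borel"
  show "bounded_clinear (F S)" by (rule bounded_clinear_F[OF S])
  show "F S \<circ> F S = F S" using F_Int[OF S S] by (simp add: fun_eq_iff)
  show "cinner (F S x) y = cinner x (F S y)" for x y
    using symmetric_F[OF S] by (simp add: symmetric_op_def)
next
  show "F UNIV = id" using F_compl[of "{}"] by (simp add: fun_eq_iff F_empty)
next
  fix S T :: "real set" assume "S \<in> sets borel" "T \<in> sets borel"
  then show "F (S \<inter> T) = F S \<circ> F T" by (simp add: fun_eq_iff F_Int)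
next
  fix G :: "nat \<Rightarrow> real set" and x
  assume "range G \<subseteq> sets borel" "disjoint_family G"
  then show "(\<lambda>n. F (G n) x) sums F (\<Union>n. G n) x" by (rule F_sums)
qed

sublocale pvm F by unfold_locales (rule projection_valued_measure_F)

lemma scalar_measure_F: "scalar_measure F x = \<nu> x"
proof (rule measure_eqI)
  fix S assume "S \<in> sets (scalar_measure F x)"
  then have S: "S \<in> sets borel" by simp
  interpret finite_measure "\<nu> x" by simp
  show "emeasure (scalar_measure F x) S = emeasure (\<nu> x) S"
    by (simp add: emeasure_\<mu>[OF S] inner_F[OF S] emeasure_eq_measure)
qed simp

lemma R_eq_bint: "bint (\<lambda>u. u * indicator {0..1} u) = R"
proof (rule bint_eqI)
  have "integral\<^sup>L (\<nu> x) (\<lambda>u. u * indicator {0..1} u) = (\<integral>u. u ^ 1 \<partial>\<nu> x)" for x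
  proof (rule integral_cong_AE)
    show "AE u in \<nu> x. u * indicator {0..1} u = u ^ 1" using AE_\<nu>[of x] by eventually_elim simp
  qed simp_all
  then show "is_integral (\<lambda>u. u * indicator {0..1} u) R"
    using bc_R moment_\<nu>[of _ 1] by (simp add: is_integral_def scalar_measure_F symmetric_op_diag[OF sym_R])
qed

end

section \<open>Self-adjoint operators: resolvent, spectrum and form\<close>

lemma app_eqI: "linear_operator A \<Longrightarrow> (x, y) \<in> A \<Longrightarrow> app A x = y"
  unfolding app_def by (rule the_equality) (auto simp: linear_operator_def single_valued_def)

lemma app_in: "linear_operator A \<Longrightarrow> x \<in> Domain A \<Longrightarrow> (x, app A x) \<in> A"
  using app_eqI by (metis DomainE)

lemma linear_operator_add:
  assumes "linear_operator A" "x \<in> Domain A" "y \<in> Domain A"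
  shows "x + y \<in> Domain A" "app A (x + y) = app A x + app A y"
proof -
  have "(x + y, app A x + app A y) \<in> A"
    using app_in[OF assms(1,2)] app_in[OF assms(1,3)] assms(1) unfolding linear_operator_def by fast
  then show "x + y \<in> Domain A" "app A (x + y) = app A x + app A y"
    using app_eqI[OF assms(1)] by auto
qed

lemma linear_operator_scaleC:
  assumes "linear_operator A" "x \<in> Domain A"
  shows "c *\<^sub>C x \<in> Domain A" "app A (c *\<^sub>C x) = c *\<^sub>C app A x"
proof -
  have "(c *\<^sub>C x, c *\<^sub>C app A x) \<in> A"
    using app_in[OF assms] assms(1) unfolding linear_operator_def by fast
  then show "c *\<^sub>C x \<in> Domain A" "app A (c *\<^sub>C x) = c *\<^sub>C app A x"
    using app_eqI[OF assms(1)] by auto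
qed

lemma linear_operator_scaleR:
  assumes "linear_operator A" "x \<in> Domain A"
  shows "c *\<^sub>R x \<in> Domain A" "app A (c *\<^sub>R x) = c *\<^sub>R app A x"
  using linear_operator_scaleC[OF assms, of "complex_of_real c"] by (simp_all add: scaleC_of_real)

lemma linear_operator_diff:
  assumes "linear_operator A" "x \<in> Domain A" "y \<in> Domain A"
  shows "x - y \<in> Domain A" "app A (x - y) = app A x - app A y"
  using linear_operator_add[OF assms(1,2) linear_operator_scaleR(1)[OF assms(1,3), of "-1"]]
    linear_operator_scaleR[OF assms(1,3), of "-1"] by simp_all

lemma linear_operator_zero:
  assumes "linear_operator A"
  shows "0 \<in> Domain A" "app A 0 = 0"
  using assms app_eqI[OF assms, of 0 0] by (auto simp: linear_operator_def)

locale self_adjoint_operator =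
  fixes A :: "'h::chilbert operator"
  assumes sa: "self_adjoint A"
begin

lemma lin: "linear_operator A" and dense: "closure (Domain A) = UNIV" and adj: "adjoint_op A = A"
  using sa by (auto simp: self_adjoint_def)

lemmas dom_add = linear_operator_add[OF lin] and dom_scaleC = linear_operator_scaleC[OF lin]
  and dom_scaleR = linear_operator_scaleR[OF lin] and dom_diff = linear_operator_diff[OF lin]
  and dom_zero = linear_operator_zero[OF lin]

lemma cinner_sym: "x \<in> Domain A \<Longrightarrow> y \<in> Domain A \<Longrightarrow> cinner (app A x) y = cinner x (app A y)"
proof -
  assume "x \<in> Domain A" "y \<in> Domain A"
  then have "(x, app A x) \<in> adjoint_op A" "(y, app A y) \<in> A" using app_in[OF lin] by (auto simp: adj)
  then show ?thesis unfolding adjoint_op_def by auto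
qed

lemma inner_sym: "x \<in> Domain A \<Longrightarrow> y \<in> Domain A \<Longrightarrow> inner (app A x) y = inner x (app A y)"
  by (metis cinner_sym Re_cinner)

lemma op_form_inner: "op_form A x = inner x (app A x)"
  by (simp add: op_form_def Re_cinner)

lemma graphI:
  assumes "\<And>u v. (u, v) \<in> A \<Longrightarrow> cinner x v = cinner y u"
  shows "(x, y) \<in> A"
proof -
  have "(x, y) \<in> adjoint_op A" using assms by (auto simp: adjoint_op_def)
  then show ?thesis by (simp only: adj)
qed

lemma closed_graph:
  assumes "\<And>n. X n \<in> Domain A" "X \<longlonglongrightarrow> x" "(\<lambda>n. app A (X n)) \<longlonglongrightarrow> y"
  shows "x \<in> Domain A" "app A x = y"
proof -
  have "cinner x v = cinner y u" if "(u, v) \<in> A" for u v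
  proof (rule LIMSEQ_unique)
    have u: "u \<in> Domain A" "app A u = v" using that app_eqI[OF lin] by auto
    show "(\<lambda>n. cinner (X n) v) \<longlonglongrightarrow> cinner x v" by (intro tendsto_cinner assms tendsto_const)
    have "cinner (X n) v = cinner (app A (X n)) u" for n
      unfolding cinner_sym[OF assms(1) u(1)] u(2) ..
    moreover have "(\<lambda>n. cinner (app A (X n)) u) \<longlonglongrightarrow> cinner y u"
      by (intro tendsto_cinner assms tendsto_const)
    ultimately show "(\<lambda>n. cinner (X n) v) \<longlonglongrightarrow> cinner y u" by (simp only:)
  qed
  then have "(x, y) \<in> A" by (rule graphI)
  then show "x \<in> Domain A" "app A x = y" using app_eqI[OF lin] by auto
qed

definition lower_bound :: "real \<Rightarrow> bool" where
  "lower_bound c \<longleftrightarrow> (\<forall>x\<in>Domain A. c * (norm x)\<^sup>2 \<le> inner x (app A x))"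

lemma lower_boundD: "lower_bound c \<Longrightarrow> x \<in> Domain A \<Longrightarrow> c * (norm x)\<^sup>2 \<le> inner x (app A x)"
  by (simp add: lower_bound_def)

text \<open>\<open>res a\<close> is \<open>(A + a)\<^sup>-\<^sup>1\<close>.\<close>

definition res :: "real \<Rightarrow> 'h \<Rightarrow> 'h" where "res a = resolvent A (- complex_of_real a)"

lemma shift_eq: "y - (- complex_of_real a) *\<^sub>C x = y + a *\<^sub>R (x::'h)"
  by (simp add: scaleC_minus_left scaleC_of_real)

context
  fixes a c :: real
  assumes lb: "lower_bound c" and pos: "0 < a + c"
begin

lemma shift_coercive:
  assumes x: "x \<in> Domain A"
  shows "(a + c) * (norm x)\<^sup>2 \<le> inner x (app A x + a *\<^sub>R x)" "(a + c) * norm x \<le> norm (app A x + a *\<^sub>R x)"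
proof -
  show 1: "(a + c) * (norm x)\<^sup>2 \<le> inner x (app A x + a *\<^sub>R x)"
    using lower_boundD[OF lb x] by (simp add: inner_simps power2_norm_eq_inner distrib_right)
  also have "\<dots> \<le> norm x * norm (app A x + a *\<^sub>R x)" by (rule norm_cauchy_schwarz)
  finally have "norm x * ((a + c) * norm x) \<le> norm x * norm (app A x + a *\<^sub>R x)"
    by (simp add: power2_eq_square mult.left_commute)
  then show "(a + c) * norm x \<le> norm (app A x + a *\<^sub>R x)"
    by (cases "x = 0") (simp_all add: dom_zero)
qed

lemma shift_inj:
  assumes "x \<in> Domain A" "y \<in> Domain A" "app A x + a *\<^sub>R x = app A y + a *\<^sub>R y"
  shows "x = y"
proof -
  have "app A (x - y) + a *\<^sub>R (x - y) = 0"
    using assms by (simp add: dom_diff scaleR_diff_right algebra_simps)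
  then have "(a + c) * norm (x - y) \<le> 0" using shift_coercive(2)[OF dom_diff(1)[OF assms(1,2)]] by simp
  then show ?thesis using pos by (simp add: mult_le_0_iff)
qed

text \<open>The range of \<open>A + a\<close> is closed by coercivity and closedness of \<open>A\<close>; a vector orthogonal to it
  lies in the domain of \<open>A\<^sup>* = A\<close> and is annihilated by \<open>A + a\<close>.\<close>

lemma shift_surj: "\<exists>x\<in>Domain A. app A x + a *\<^sub>R x = u"
proof -
  define V where "V = (\<lambda>x. app A x + a *\<^sub>R x) ` Domain A"
  have "closed V"
    unfolding closed_sequential_limits
  proof (intro allI impI, elim conjE)
    fix Y y assume Y: "\<forall>n. Y n \<in> V" and y: "Y \<longlonglongrightarrow> y"
    have "\<exists>x. x \<in> Domain A \<and> v = app A x + a *\<^sub>R x" if "v \<in> V" for v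
      using that unfolding V_def by blast
    with Y have "\<forall>n. \<exists>x. x \<in> Domain A \<and> Y n = app A x + a *\<^sub>R x" by blast
    then obtain X where X: "\<And>n. X n \<in> Domain A" "\<And>n. Y n = app A (X n) + a *\<^sub>R X n" by metis
    have XY: "(a + c) * norm (X m - X n) \<le> norm (Y m - Y n)" for m n
      using shift_coercive(2)[OF dom_diff(1)[OF X(1) X(1)], of m n]
      by (simp add: X(2) dom_diff(2)[OF X(1) X(1)] scaleR_diff_right algebra_simps)
    have "Cauchy X"
    proof (rule CauchyI)
      fix e :: real assume "e > 0"
      then obtain N where N: "\<And>m n. m \<ge> N \<Longrightarrow> n \<ge> N \<Longrightarrow> norm (Y m - Y n) < (a + c) * e"
        using CauchyD[OF LIMSEQ_imp_Cauchy[OF y], of "(a + c) * e"] pos by auto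
      have "norm (X m - X n) < e" if "m \<ge> N" "n \<ge> N" for m n
      proof -
        have "(a + c) * norm (X m - X n) < (a + c) * e" using XY N[OF that] by (rule le_less_trans)
        then show ?thesis using pos by simp
      qed
      then show "\<exists>M. \<forall>m\<ge>M. \<forall>n\<ge>M. norm (X m - X n) < e" by blast
    qed
    then obtain x where x: "X \<longlonglongrightarrow> x" using Cauchy_convergent convergent_def by blast
    have "(\<lambda>n. Y n - a *\<^sub>R X n) \<longlonglongrightarrow> y - a *\<^sub>R x" by (intro tendsto_intros y x)
    then have "(\<lambda>n. app A (X n)) \<longlonglongrightarrow> y - a *\<^sub>R x" by (simp add: X(2))
    from closed_graph[OF X(1) x this] have "x \<in> Domain A" "y = app A x + a *\<^sub>R x"
      by (simp_all only: diff_add_cancel)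
    then show "y \<in> V" unfolding V_def by blast
  qed
  then have V: "closed_csubspace V"
    unfolding closed_csubspace_def
  proof (intro conjI ballI allI)
    show "0 \<in> V" using dom_zero by (auto simp: V_def image_iff intro!: bexI[of _ 0])
    show "x + y \<in> V" if "x \<in> V" "y \<in> V" for x y
    proof -
      obtain x' y' where xy: "x' \<in> Domain A" "x = app A x' + a *\<^sub>R x'" "y' \<in> Domain A" "y = app A y' + a *\<^sub>R y'"
        using \<open>x \<in> V\<close> \<open>y \<in> V\<close> unfolding V_def by blast
      have "x + y = app A (x' + y') + a *\<^sub>R (x' + y')"
        unfolding xy(2,4) dom_add(2)[OF xy(1,3)] by (simp add: scaleR_add_right)
      then show ?thesis using dom_add(1)[OF xy(1,3)] unfolding V_def by (rule image_eqI)
    qed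
    show "k *\<^sub>C x \<in> V" if xV: "x \<in> V" for k x
    proof -
      obtain x' where x': "x' \<in> Domain A" "x = app A x' + a *\<^sub>R x'" using xV unfolding V_def by blast
      have "k *\<^sub>C x = app A (k *\<^sub>C x') + a *\<^sub>R (k *\<^sub>C x')"
        unfolding x'(2) dom_scaleC(2)[OF x'(1)] by (simp add: scaleC_add_right scaleC_scaleR_commute)
      then show ?thesis using dom_scaleC(1)[OF x'(1)] unfolding V_def by (rule image_eqI)
    qed
  qed
  define w where "w = u - orth_proj V u"
  have orth: "cinner (app A x + a *\<^sub>R x) w = 0" if "x \<in> Domain A" for x
    unfolding w_def by (rule orth_proj_orth[OF V]) (use that in \<open>auto simp: V_def\<close>)
  have "cinner w v = cinner (- a *\<^sub>R w) x" if xv: "(x, v) \<in> A" for x v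
  proof -
    have "cinner w (v + a *\<^sub>R x) = 0"
      using orth[of x] xv app_eqI[OF lin xv] cinner_commute[of w "v + a *\<^sub>R x"] by auto
    then show ?thesis by (simp add: cinner_simps add_eq_0_iff)
  qed
  then have "(w, - a *\<^sub>R w) \<in> A" by (rule graphI)
  then have "w \<in> Domain A" "app A w + a *\<^sub>R w = 0" using app_eqI[OF lin, of w "- a *\<^sub>R w"] by auto
  then have "w = 0" using shift_coercive(2)[of w] pos by (simp add: mult_le_0_iff)
  then have "u \<in> V" using orth_proj_in[OF V, of u] by (simp add: w_def)
  then show ?thesis by (auto simp: V_def)
qed

lemma res_spec: "res a u \<in> Domain A \<and> app A (res a u) + a *\<^sub>R res a u = u"
proof -
  obtain x where x: "x \<in> Domain A" "app A x + a *\<^sub>R x = u" using shift_surj by blast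
  have "res a u = x"
    unfolding res_def resolvent_def shift_eq
    by (rule the_equality) (use x shift_inj in auto)
  with x show ?thesis by simp
qed

lemmas res_in = res_spec[THEN conjunct1] and shift_res = res_spec[THEN conjunct2]

lemma res_shift: "x \<in> Domain A \<Longrightarrow> res a (app A x + a *\<^sub>R x) = x"
  by (rule shift_inj) (use res_spec in auto)

lemma res_eqI: "x \<in> Domain A \<Longrightarrow> app A x + a *\<^sub>R x = u \<Longrightarrow> res a u = x"
  using res_shift by blast

lemma norm_res_le: "norm (res a u) \<le> norm u / (a + c)"
  using shift_coercive(2)[OF res_in, of u] pos by (simp add: shift_res pos_le_divide_eq mult.commute)

lemma bounded_clinear_res: "bounded_clinear (res a)"
proof (rule bounded_clinearI[where K="1 / (a + c)"])
  show "res a (x + y) = res a x + res a y" for x y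
  proof (rule res_eqI)
    have "app A (res a x + res a y) + a *\<^sub>R (res a x + res a y)
        = (app A (res a x) + a *\<^sub>R res a x) + (app A (res a y) + a *\<^sub>R res a y)"
      by (simp add: dom_add res_in scaleR_add_right add_ac)
    then show "app A (res a x + res a y) + a *\<^sub>R (res a x + res a y) = x + y" by (simp add: shift_res)
  qed (simp add: dom_add res_in)
  show "res a (k *\<^sub>C x) = k *\<^sub>C res a x" for k x
  proof (rule res_eqI)
    have "app A (k *\<^sub>C res a x) + a *\<^sub>R (k *\<^sub>C res a x) = k *\<^sub>C (app A (res a x) + a *\<^sub>R res a x)"
      by (simp add: dom_scaleC res_in scaleC_add_right scaleC_scaleR_commute)
    then show "app A (k *\<^sub>C res a x) + a *\<^sub>R (k *\<^sub>C res a x) = k *\<^sub>C x" by (simp add: shift_res)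
  qed (simp add: dom_scaleC res_in)
  show "norm (res a x) \<le> 1 / (a + c) * norm x" for x using norm_res_le[of x] by simp
qed

lemma positive_res: "positive_op (res a)"
proof (rule positive_opI[OF bounded_clinear_res])
  show "symmetric_op (res a)"
    unfolding symmetric_op_def
  proof (intro allI)
    fix x y
    have "cinner (res a x) y = cinner (res a x) (app A (res a y) + a *\<^sub>R res a y)" by (simp add: shift_res)
    also have "\<dots> = cinner (app A (res a x) + a *\<^sub>R res a x) (res a y)"
      by (simp add: cinner_simps cinner_sym res_in)
    finally show "cinner (res a x) y = cinner x (res a y)" by (simp add: shift_res)
  qed
  show "0 \<le> inner x (res a x)" for x
  proof -
    have "0 \<le> (a + c) * (norm (res a x))\<^sup>2" using pos by simp
    also have "\<dots> \<le> inner (res a x) x" using shift_coercive(1)[OF res_in, of x] by (simp add: shift_res)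
    finally show ?thesis by (simp add: inner_commute)
  qed
qed

lemma in_resolvent_set: "- complex_of_real a \<in> resolvent_set A"
  unfolding resolvent_set_def mem_Collect_eq shift_eq
proof (intro conjI allI)
  show "\<exists>!x. x \<in> Domain A \<and> app A x + a *\<^sub>R x = u" for u
    using shift_surj[of u] shift_inj by blast
  show "bounded_clinear (resolvent A (- complex_of_real a))"
    using bounded_clinear_res by (simp add: res_def)
qed

end

text \<open>A best lower bound \<open>c\<close> belongs to the spectrum: otherwise \<open>T = (A - c)\<^sup>-\<^sup>1\<close> is a bounded
  positive operator, and \<open>T \<le> K\<close> gives \<open>A - c \<ge> 1 / K\<close>.\<close>

lemma lower_bound_above_spectrum:
  assumes lsb: "lower_semibounded A" and a: "- inf_spectrum A < ereal a"
  obtains c where "lower_bound c" "0 < a + c"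
proof (rule ccontr)
  assume "\<not> thesis"
  then have le: "c \<le> - a" if "lower_bound c" for c using that \<open>\<And>c. lower_bound c \<Longrightarrow> 0 < a + c \<Longrightarrow> thesis\<close> by force
  define L where "L = {c. lower_bound c}"
  have "\<exists>c. lower_bound c" using lsb by (simp add: lower_semibounded_def lower_bound_def Re_cinner)
  then have ne: "L \<noteq> {}" by (auto simp: L_def)
  have bdd: "bdd_above L" using le by (auto simp: L_def intro!: bdd_aboveI)
  define c where "c = Sup L"
  have c_le: "c \<le> - a" unfolding c_def by (rule cSup_least[OF ne]) (use le in \<open>auto simp: L_def\<close>)
  have c_lb: "lower_bound c"
    unfolding lower_bound_def
  proof
    fix x assume x: "x \<in> Domain A"
    show "c * (norm x)\<^sup>2 \<le> inner x (app A x)"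
    proof (cases "x = 0")
      case False
      have "c \<le> inner x (app A x) / (norm x)\<^sup>2"
        unfolding c_def
        by (rule cSup_least[OF ne]) (use x False in \<open>auto simp: L_def lower_bound_def pos_le_divide_eq\<close>)
      with False show ?thesis by (simp add: pos_le_divide_eq)
    qed simp
  qed
  have "complex_of_real c \<in> resolvent_set A"
  proof (rule ccontr)
    assume "complex_of_real c \<notin> resolvent_set A"
    then have "inf_spectrum A \<le> ereal (Re (complex_of_real c))"
      unfolding inf_spectrum_def by (intro INF_lower) (simp add: spectrum_def)
    also have "\<dots> \<le> ereal (- a)" using c_le by simp
    finally have "ereal a \<le> - inf_spectrum A"
      by (metis ereal_minus_le_minus ereal_uminus_uminus uminus_ereal.simps(1))
    with a show False by simp
  qed
  then have bij: "\<And>u. \<exists>!x. x \<in> Domain A \<and> app A x - complex_of_real c *\<^sub>C x = u"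
    and bc: "bounded_clinear (resolvent A (complex_of_real c))" by (auto simp: resolvent_set_def)
  define T where "T = resolvent A (complex_of_real c)"
  have T: "T u \<in> Domain A" "app A (T u) - c *\<^sub>R T u = u" for u
    using theI'[OF bij[of u]] by (simp_all add: T_def resolvent_def scaleC_of_real)
  have T_shift: "T (app A x - c *\<^sub>R x) = x" if "x \<in> Domain A" for x
    using bij[of "app A x - c *\<^sub>R x"] T[of "app A x - c *\<^sub>R x"] that by (auto simp: scaleC_of_real)
  have posT: "positive_op T"
  proof (rule positive_opI)
    show "bounded_clinear T" using bc by (simp add: T_def)
    show "symmetric_op T"
      unfolding symmetric_op_def
    proof (intro allI)
      fix x y
      have "cinner (T x) y = cinner (T x) (app A (T y) - c *\<^sub>R T y)" by (simp add: T)
      also have "\<dots> = cinner (app A (T x) - c *\<^sub>R T x) (T y)"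
        by (simp add: cinner_simps cinner_sym T(1))
      finally show "cinner (T x) y = cinner x (T y)" by (simp add: T)
    qed
    show "0 \<le> inner x (T x)" for x
    proof -
      have "0 \<le> inner (T x) (app A (T x) - c *\<^sub>R T x)"
        using lower_boundD[OF c_lb T(1), of x] by (simp add: inner_simps power2_norm_eq_inner)
      then show ?thesis by (simp add: T inner_commute)
    qed
  qed
  obtain K where K: "K > 0" "\<And>x. norm (T x) \<le> K * norm x"
    using bounded_clinear_bound[OF positive_opD(1)[OF posT]] by blast
  have T_le: "inner x (T x) \<le> K * (norm x)\<^sup>2" for x
  proof -
    have "inner x (T x) \<le> norm x * norm (T x)" by (rule norm_cauchy_schwarz)
    also have "\<dots> \<le> norm x * (K * norm x)" by (intro mult_left_mono K) simp
    finally show ?thesis by (simp add: power2_eq_square mult.left_commute)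
  qed
  have "lower_bound (c + 1 / K)"
    unfolding lower_bound_def
  proof
    fix x assume x: "x \<in> Domain A"
    let ?u = "app A x - c *\<^sub>R x"
    have "(norm x)\<^sup>2 \<le> K * inner ?u x"
      using positive_contraction_norm_le[OF posT T_le, of ?u] by (simp add: T_shift[OF x])
    then have "1 / K * (norm x)\<^sup>2 \<le> inner ?u x" using K(1) by (simp add: field_simps)
    then show "(c + 1 / K) * (norm x)\<^sup>2 \<le> inner x (app A x)"
      by (simp add: distrib_right inner_simps power2_norm_eq_inner inner_commute)
  qed
  then have "c + 1 / K \<le> c" unfolding c_def by (intro cSup_upper bdd) (simp add: L_def)
  with K(1) show False by simp
qed

text \<open>The choice \<open>a = 1 - c\<close> makes \<open>\<langle>(A + a) x, y\<rangle>\<close> an inner product on the domain whose norm dominates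
  the one of the Hilbert space.\<close>

definition form_b :: "real \<Rightarrow> 'h \<Rightarrow> 'h \<Rightarrow> real" where
  "form_b a x y = inner (app A x + a *\<^sub>R x) y"

context
  fixes c a :: real
  assumes lb: "lower_bound c" and a: "a = 1 - c"
begin

lemma form_b_commute: "x \<in> Domain A \<Longrightarrow> y \<in> Domain A \<Longrightarrow> form_b a x y = form_b a y x"
  using inner_sym[of x y] by (simp add: form_b_def inner_simps inner_commute)

lemma form_b_ge: "x \<in> Domain A \<Longrightarrow> (norm x)\<^sup>2 \<le> form_b a x x"
  using lower_boundD[OF lb, of x] by (simp add: form_b_def a inner_simps power2_norm_eq_inner inner_commute algebra_simps)

lemma form_b_nonneg: "x \<in> Domain A \<Longrightarrow> 0 \<le> form_b a x x"
  using form_b_ge order_trans zero_le_power2 by blast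

lemma form_b_cs:
  assumes x: "x \<in> Domain A" and y: "y \<in> Domain A"
  shows "(form_b a x y)\<^sup>2 \<le> form_b a x x * form_b a y y"
proof (rule nonneg_quadratic_discriminant)
  fix r :: real
  let ?z = "x + r *\<^sub>R y"
  have z: "?z \<in> Domain A" using x y by (simp add: dom_add dom_scaleR)
  have "0 \<le> (norm ?z)\<^sup>2" by simp
  also have "\<dots> \<le> form_b a ?z ?z" by (rule form_b_ge[OF z])
  also have "\<dots> = form_b a x x + r * form_b a x y + r * form_b a y x + r\<^sup>2 * form_b a y y"
    using x y by (simp add: form_b_def dom_add dom_scaleR inner_simps power2_eq_square algebra_simps)
  finally show "0 \<le> form_b a x x + 2 * r * form_b a x y + r\<^sup>2 * form_b a y y"
    using form_b_commute[OF x y] by simp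
qed (rule form_b_nonneg[OF y])

lemma form_b_op_form: "form_b a x x = op_form A x + a * (norm x)\<^sup>2"
  by (simp add: form_b_def op_form_inner inner_simps power2_norm_eq_inner inner_commute)

definition form_norm :: "'h \<Rightarrow> real" where "form_norm x = sqrt (form_b a x x)"

lemma form_norm_nonneg: "x \<in> Domain A \<Longrightarrow> 0 \<le> form_norm x"
  and form_norm_sq: "x \<in> Domain A \<Longrightarrow> (form_norm x)\<^sup>2 = form_b a x x"
  using form_b_nonneg by (auto simp: form_norm_def)

lemma form_b_le_form_norm:
  assumes x: "x \<in> Domain A" and y: "y \<in> Domain A"
  shows "form_b a x y \<le> form_norm x * form_norm y"
proof (rule power2_le_imp_le)
  show "(form_b a x y)\<^sup>2 \<le> (form_norm x * form_norm y)\<^sup>2"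
    using form_b_cs[OF x y] by (simp add: power_mult_distrib form_norm_sq x y)
qed (simp add: form_norm_nonneg x y)

lemma form_norm_diff_le:
  assumes x: "x \<in> Domain A" and y: "y \<in> Domain A"
  shows "form_norm (x - y) \<le> form_norm x + form_norm y"
    and "\<bar>form_norm x - form_norm y\<bar> \<le> form_norm (x - y)"
proof -
  have neg: "- v \<in> Domain A" "form_norm (- v) = form_norm v" if "v \<in> Domain A" for v
    using dom_scaleR[OF that, of "- 1"] by (auto simp: form_norm_def form_b_def inner_simps)
  have tri: "form_norm (u - v) \<le> form_norm u + form_norm v" if u: "u \<in> Domain A" and v: "v \<in> Domain A" for u v
  proof (rule power2_le_imp_le)
    have "form_b a u (- v) = - form_b a u v" by (simp add: form_b_def)
    then have "- form_b a u v \<le> form_norm u * form_norm v"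
      using form_b_le_form_norm[OF u neg(1)[OF v]] neg(2)[OF v] by simp
    moreover have "form_b a (u - v) (u - v) = form_b a u u - 2 * form_b a u v + form_b a v v"
      using u v form_b_commute[OF u v] by (simp add: form_b_def dom_diff inner_simps algebra_simps)
    ultimately show "(form_norm (u - v))\<^sup>2 \<le> (form_norm u + form_norm v)\<^sup>2"
      unfolding power2_sum form_norm_sq[OF dom_diff(1)[OF u v]] form_norm_sq[OF u] form_norm_sq[OF v]
      by (simp add: mult.assoc)
  qed (simp add: form_norm_nonneg u v)
  show "form_norm (x - y) \<le> form_norm x + form_norm y" by (rule tri[OF x y])
  have "form_norm x \<le> form_norm (x - y) + form_norm y"
    using tri[OF dom_diff(1)[OF x y] neg(1)[OF y]] neg(2)[OF y] by simp
  moreover have "form_norm y \<le> form_norm (x - y) + form_norm x"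
    using tri[OF neg(1)[OF dom_diff(1)[OF x y]] neg(1)[OF x]] neg(2)[OF dom_diff(1)[OF x y]] neg(2)[OF x]
    by simp
  ultimately show "\<bar>form_norm x - form_norm y\<bar> \<le> form_norm (x - y)" by linarith
qed

lemma form_approx_cauchy:
  assumes X: "form_approx A X x" and e: "e > 0"
  shows "\<exists>N. \<forall>j\<ge>N. \<forall>k\<ge>N. form_norm (X j - X k) < e"
proof -
  have e2: "e\<^sup>2 > 0" using e by simp
  have lim: "X \<longlonglongrightarrow> x" and "\<exists>N. \<forall>j\<ge>N. \<forall>k\<ge>N. \<bar>op_form A (X j - X k)\<bar> < e\<^sup>2 / 2"
    using X half_gt_zero[OF e2] unfolding form_approx_def by blast+
  then obtain N where N: "\<And>j k. j \<ge> N \<Longrightarrow> k \<ge> N \<Longrightarrow> \<bar>op_form A (X j - X k)\<bar> < e\<^sup>2 / 2" by blast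
  define d where "d = sqrt (e\<^sup>2 / (2 * (\<bar>a\<bar> + 1)))"
  have d: "d > 0" "d\<^sup>2 = e\<^sup>2 / (2 * (\<bar>a\<bar> + 1))" using e by (simp_all add: d_def)
  obtain M where M: "\<And>j k. j \<ge> M \<Longrightarrow> k \<ge> M \<Longrightarrow> norm (X j - X k) < d"
    using CauchyD[OF LIMSEQ_imp_Cauchy[OF lim] d(1)] by blast
  have "form_norm (X j - X k) < e" if "j \<ge> max N M" "k \<ge> max N M" for j k
  proof -
    have "(norm (X j - X k))\<^sup>2 \<le> d\<^sup>2" using M[of j k] that by (intro power_mono) auto
    then have "a * (norm (X j - X k))\<^sup>2 \<le> (\<bar>a\<bar> + 1) * d\<^sup>2"
      by (intro mult_mono) auto
    also have "\<dots> = e\<^sup>2 / 2" unfolding d(2) by (simp add: field_simps)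
    finally have "form_b a (X j - X k) (X j - X k) < e\<^sup>2"
      using N[of j k] that by (simp add: form_b_op_form)
    then show ?thesis unfolding form_norm_def using real_sqrt_less_mono e by fastforce
  qed
  then show ?thesis by blast
qed

lemma form_approx_dom: "form_approx A X x \<Longrightarrow> X n \<in> Domain A"
  by (auto simp: form_approx_def)

text \<open>The form is closable. With \<open>Z = X - Y\<close>, the form norm of \<open>Z n - Z m\<close> is small for large indices,
  and \<open>\<langle>(A + a) (Z n), Z m\<rangle>\<close> tends to \<open>0\<close> with \<open>Z m\<close>; together they bound \<open>\<langle>(A + a) (Z n), Z n\<rangle>\<close>. So the
  form of the limit is well defined.\<close>

lemma form_approx_diff_null:
  assumes X: "form_approx A X x" and Y: "form_approx A Y x"
  shows "(\<lambda>n. form_norm (X n - Y n)) \<longlonglongrightarrow> 0"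
proof (rule LIMSEQ_I)
  fix e :: real assume e: "e > 0"
  note dX = form_approx_dom[OF X] and dY = form_approx_dom[OF Y]
  define Z where "Z n = X n - Y n" for n
  have Zd: "Z n \<in> Domain A" for n using dX dY by (simp add: Z_def dom_diff)
  have "X \<longlonglongrightarrow> x" "Y \<longlonglongrightarrow> x" using X Y by (auto simp: form_approx_def)
  then have Z0: "Z \<longlonglongrightarrow> 0" unfolding Z_def using tendsto_diff by fastforce
  obtain N1 where N1: "\<And>j k. j \<ge> N1 \<Longrightarrow> k \<ge> N1 \<Longrightarrow> form_norm (X j - X k) < e / 4"
    using form_approx_cauchy[OF X, of "e / 4"] e by auto
  obtain N2 where N2: "\<And>j k. j \<ge> N2 \<Longrightarrow> k \<ge> N2 \<Longrightarrow> form_norm (Y j - Y k) < e / 4"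
    using form_approx_cauchy[OF Y, of "e / 4"] e by auto
  have "form_norm (Z n) \<le> e / 2" if n: "n \<ge> max N1 N2" for n
  proof -
    let ?q = "form_norm (Z n)"
    note q0 = form_norm_nonneg[OF Zd[of n]]
    have "(\<lambda>m. form_b a (Z n) (Z n) - form_b a (Z n) (Z m)) \<longlonglongrightarrow> form_b a (Z n) (Z n) - form_b a (Z n) 0"
      unfolding form_b_def by (intro tendsto_intros Z0)
    then have lim: "(\<lambda>m. form_b a (Z n) (Z n - Z m)) \<longlonglongrightarrow> ?q\<^sup>2"
      by (simp add: form_norm_sq[OF Zd] form_b_def inner_simps)
    have "?q\<^sup>2 \<le> ?q * (e / 2)"
    proof (rule LIMSEQ_le_const2[OF lim], intro exI allI impI)
      fix m assume m: "max N1 N2 \<le> m"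
      have "Z n - Z m = (X n - X m) - (Y n - Y m)" by (simp add: Z_def)
      then have "form_norm (Z n - Z m) \<le> form_norm (X n - X m) + form_norm (Y n - Y m)"
        using form_norm_diff_le(1)[OF dom_diff(1)[OF dX dX] dom_diff(1)[OF dY dY]] by simp
      also have "\<dots> \<le> e / 2" using N1[of n m] N2[of n m] n m by simp
      finally have "?q * form_norm (Z n - Z m) \<le> ?q * (e / 2)" using q0 by (rule mult_left_mono)
      then show "form_b a (Z n) (Z n - Z m) \<le> ?q * (e / 2)"
        using form_b_le_form_norm[OF Zd dom_diff(1)[OF Zd Zd]] by (rule order_trans[rotated])
    qed
    then show ?thesis using q0 e by (cases "?q = 0") (auto simp: power2_eq_square)
  qed
  then show "\<exists>no. \<forall>n\<ge>no. norm (form_norm (X n - Y n) - 0) < e"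
    using form_norm_nonneg[OF Zd] e unfolding Z_def by (intro exI[of _ "max N1 N2"]) fastforce
qed

lemma form_approx_op_form_convergent:
  assumes X: "form_approx A X x"
  shows "convergent (\<lambda>n. op_form A (X n))"
proof -
  note dom = form_approx_dom[OF X]
  have "Cauchy (\<lambda>n. form_norm (X n))"
    using form_approx_cauchy[OF X] form_norm_diff_le(2)[OF dom dom]
    by (intro CauchyI) (metis le_less_trans real_norm_def)
  then obtain l where l: "(\<lambda>n. form_norm (X n)) \<longlonglongrightarrow> l" using Cauchy_convergent convergent_def by blast
  have "X \<longlonglongrightarrow> x" using X by (simp add: form_approx_def)
  then have "(\<lambda>n. (form_norm (X n))\<^sup>2 - a * (norm (X n))\<^sup>2) \<longlonglongrightarrow> l\<^sup>2 - a * (norm x)\<^sup>2"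
    by (intro tendsto_intros l)
  then show ?thesis unfolding form_norm_sq[OF dom] form_b_op_form by (auto simp: convergent_def)
qed

lemma form_limit_unique:
  assumes X: "form_approx A X x" "(\<lambda>n. op_form A (X n)) \<longlonglongrightarrow> r"
    and Y: "form_approx A Y x" "(\<lambda>n. op_form A (Y n)) \<longlonglongrightarrow> s"
  shows "r = s"
proof -
  have lim: "(\<lambda>n. form_norm (W n)) \<longlonglongrightarrow> sqrt (t + a * (norm x)\<^sup>2)"
    if "form_approx A W x" "(\<lambda>n. op_form A (W n)) \<longlonglongrightarrow> t" for W t
    unfolding form_norm_def form_b_op_form using that by (intro tendsto_intros) (auto simp: form_approx_def)
  have "(\<lambda>n. form_norm (X n) - form_norm (Y n)) \<longlonglongrightarrow> 0"
    by (rule Lim_null_comparison[OF _ form_approx_diff_null[OF X(1) Y(1)]])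
      (use form_norm_diff_le(2)[OF form_approx_dom[OF X(1)] form_approx_dom[OF Y(1)]] in auto)
  moreover have "(\<lambda>n. form_norm (X n) - form_norm (Y n))
      \<longlonglongrightarrow> sqrt (r + a * (norm x)\<^sup>2) - sqrt (s + a * (norm x)\<^sup>2)"
    by (intro tendsto_diff lim X Y)
  ultimately have "sqrt (r + a * (norm x)\<^sup>2) - sqrt (s + a * (norm x)\<^sup>2) = 0"
    using LIMSEQ_unique by blast
  then show ?thesis by simp
qed

lemma quad_form_eqI:
  assumes "form_approx A X x" "(\<lambda>n. op_form A (X n)) \<longlonglongrightarrow> r"
  shows "quad_form A x = r"
  unfolding quad_form_def
proof (rule the_equality)
  show "\<exists>X. form_approx A X x \<and> (\<lambda>n. op_form A (X n)) \<longlonglongrightarrow> r" using assms by blast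
  show "s = r" if "\<exists>X. form_approx A X x \<and> (\<lambda>n. op_form A (X n)) \<longlonglongrightarrow> s" for s
    using that assms form_limit_unique by (elim exE conjE) blast
qed

end

lemma quad_form_approximants:
  assumes lsb: "lower_semibounded A" and x: "x \<in> form_domain A"
  obtains X where "\<And>n. X n \<in> Domain A" "X \<longlonglongrightarrow> x" "(\<lambda>n. op_form A (X n)) \<longlonglongrightarrow> quad_form A x"
proof -
  obtain c where c: "lower_bound c" using lsb by (auto simp: lower_semibounded_def lower_bound_def Re_cinner)
  obtain X where X: "form_approx A X x" using x by (auto simp: form_domain_def)
  obtain r where r: "(\<lambda>n. op_form A (X n)) \<longlonglongrightarrow> r"
    using form_approx_op_form_convergent[OF c refl X] by (auto simp: convergent_def)
  show thesis
    using that[of X] X r quad_form_eqI[OF c refl X r] by (auto simp: form_approx_def)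
qed

lemma
  assumes lsb: "lower_semibounded A" and x: "x \<in> Domain A"
  shows domain_subset_form_domain: "x \<in> form_domain A" and quad_form_domain: "quad_form A x = op_form A x"
proof -
  obtain c where c: "lower_bound c" using lsb by (auto simp: lower_semibounded_def lower_bound_def Re_cinner)
  have X: "form_approx A (\<lambda>_. x) x"
    using x dom_zero by (auto simp: form_approx_def op_form_inner)
  then show "x \<in> form_domain A" by (auto simp: form_domain_def)
  show "quad_form A x = op_form A x" by (rule quad_form_eqI[OF c refl X]) simp
qed

end

section \<open>The spectral theorem for a self-adjoint operator\<close>

context pvm begin

lemma integral_\<mu>_E:
  assumes T: "T \<in> sets borel" and h: "h \<in> borel_measurable borel"
  shows "integral\<^sup>L (\<mu> (E T x)) h = (\<integral>s. indicator T s * h s \<partial>\<mu> x :: real)"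
    and "integrable (\<mu> (E T x)) h \<longleftrightarrow> integrable (\<mu> x) (\<lambda>s. indicator T s * h s)"
  unfolding \<mu>_E[OF T] using T h
  by (subst integral_density integrable_density; simp)+

lemma E_eq_0_iff: "S \<in> sets borel \<Longrightarrow> E S x = 0 \<longleftrightarrow> emeasure (\<mu> x) S = 0"
  by (simp add: emeasure_\<mu> inner_E)

lemma E_UN_eq_0:
  assumes "\<And>n::nat. S n \<in> sets borel" "\<And>n. E (S n) x = 0"
  shows "E (\<Union>n. S n) x = 0"
proof -
  have "emeasure (\<mu> x) (\<Union>n. S n) = 0"
    by (rule emeasure_UN_eq_0) (use assms in \<open>auto simp: E_eq_0_iff\<close>)
  then show ?thesis using assms(1) by (simp add: E_eq_0_iff)
qed

lemma E_add_compl: "S \<in> sets borel \<Longrightarrow> E S x + E (- S) x = x"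
proof -
  assume S: "S \<in> sets borel"
  have "(\<lambda>x. E S x + E (- S) x) = (\<lambda>x. x)"
  proof (rule bounded_clinear_eqI)
    show "bounded_clinear (\<lambda>x. E S x + E (- S) x)"
      using S by (intro bounded_clinear_add bounded_clinear_E) auto
    fix x
    have "measure (\<mu> x) (- S) = measure (\<mu> x) UNIV - measure (\<mu> x) S"
      using finite_measure.finite_measure_compl[OF finite_\<mu>[of x], of S] S by (simp add: Compl_eq_Diff_UNIV)
    then have "inner x (E S x + E (- S) x) = inner x x"
      using S by (simp add: measure_\<mu> inner_add_right)
    moreover have s: "symmetric_op (\<lambda>x. E S x + E (- S) x)"
      using symmetric_E[OF S] symmetric_E[of "- S"] S by (simp add: symmetric_op_def cinner_simps)
    ultimately show "cinner x (E S x + E (- S) x) = cinner x x"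
      unfolding symmetric_op_diag[OF s, of x] cinner_self power2_norm_eq_inner by simp
  qed (rule bounded_clinear_ident)
  then show ?thesis by (rule fun_cong)
qed

text \<open>This places vectors into the domain of an unbounded integral: \<open>z\<close> is the value at \<open>x\<close> of the
  integral of \<open>h\<close>.\<close>

lemma bint_convergent:
  assumes f: "\<And>n. bnn (f n)" and h: "h \<in> borel_measurable borel"
    and fh: "\<And>n s. f n s \<le> h s" "\<And>s. (\<lambda>n. f n s) \<longlonglongrightarrow> h s"
    and int: "integrable (\<mu> x) (\<lambda>s. (h s)\<^sup>2)"
  obtains z where "(\<lambda>n. bint (f n) x) \<longlonglongrightarrow> z"
proof -
  have fm[measurable]: "f n \<in> borel_measurable borel" for n using f bnn_measurable by blast
  note h[measurable]
  have dom: "(f n s - h s)\<^sup>2 \<le> (h s)\<^sup>2" for n s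
  proof -
    have "0 \<le> f n s" using f[of n] by (simp add: bnn_def)
    then show ?thesis using fh(1)[of n s] by (intro abs_le_square_iff[THEN iffD1]) auto
  qed
  have int2: "integrable (\<mu> x) (\<lambda>s. (f n s - h s)\<^sup>2)" for n
    by (rule Bochner_Integration.integrable_bound[OF int]) (use dom in auto)
  have dist: "(\<lambda>n. \<integral>s. (f n s - h s)\<^sup>2 \<partial>\<mu> x) \<longlonglongrightarrow> (\<integral>s. 0 \<partial>\<mu> x)"
  proof (rule integral_dominated_convergence[OF _ _ int])
    have "(\<lambda>n. (f n s - h s)\<^sup>2) \<longlonglongrightarrow> (h s - h s)\<^sup>2" for s by (intro tendsto_intros fh)
    then show "AE s in \<mu> x. (\<lambda>n. (f n s - h s)\<^sup>2) \<longlonglongrightarrow> 0" by simp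
  qed (use dom in auto)
  have "convergent (\<lambda>n. bint (f n) x)"
    by (rule convergent_if_L2_convergent[where f=f and h=h and M="\<mu> x"])
      (use dist int2 in \<open>auto simp: inner_bint_bint f intro!: bnn_integrable bnn_mult\<close>)
  then show thesis using that by (auto simp: convergent_def)
qed

end

context self_adjoint_operator begin

lemma cinner_app_real: "x \<in> Domain A \<Longrightarrow> cinner x (app A x) = complex_of_real (inner x (app A x))"
  using cinner_sym[of x x] cinner_commute[of "app A x" x]
  by (simp add: complex_eq_iff Re_cinner)

text \<open>The spectral measure of \<open>A\<close> is the image of that of the contraction \<open>R = (A + k)\<^sup>-\<^sup>1\<close> under
  \<open>g u = 1 / u - k\<close>. A vector in the domain is \<open>R y\<close>, so its measure has density \<open>u\<^sup>2\<close>, which absorbs the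
  singularity of \<open>g\<^sup>2\<close>. Conversely, if \<open>g\<^sup>2\<close> is integrable at \<open>x\<close>, then \<open>x = R z\<close> with \<open>z\<close> the integral of
  \<open>1 / u\<close> at \<open>x\<close>.\<close>

theorem spectral_theorem:
  assumes lb: "lower_bound c"
  shows "\<exists>E. projection_valued_measure E \<and> has_spectral_integral E (\<lambda>s. s) A"
proof -
  define k where "k = 1 - c"
  have kc: "0 < k + c" "k + c = 1" by (simp_all add: k_def)
  let ?R = "res k"
  note posR = positive_res[OF lb kc(1)] and bcR = bounded_clinear_res[OF lb kc(1)]
    and res_in = res_in[OF lb kc(1)] and shift_res = shift_res[OF lb kc(1)]
    and res_shift = res_shift[OF lb kc(1)]
  interpret PC: positive_contraction ?R
  proof
    show "positive_op ?R" by (rule posR)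
    fix x
    have "inner x (?R x) \<le> norm x * norm (?R x)" by (rule norm_cauchy_schwarz)
    also have "\<dots> \<le> norm x * norm x"
      using norm_res_le[OF lb kc(1), of x] by (intro mult_left_mono) (auto simp: kc(2))
    finally show "inner x (?R x) \<le> (norm x)\<^sup>2" by (simp add: power2_eq_square)
  qed
  define f where "f = (\<lambda>u::real. u * indicator {0..1} u)"
  define g where "g = (\<lambda>u::real. 1 / u - k)"
  have f: "PC.bnn f" unfolding f_def by (rule PC.bnnI[where M=1]) (auto simp: indicator_def)
  have Rf: "PC.bint f = ?R" unfolding f_def by (rule PC.R_eq_bint)
  have fm[measurable]: "f \<in> borel_measurable borel" unfolding f_def by measurable
  have gm[measurable]: "g \<in> borel_measurable borel" unfolding g_def by measurable
  have gS: "g -` S \<in> sets borel" if "S \<in> sets borel" for S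
    using measurable_sets[OF gm that] by simp
  \<comment> \<open>zero is not an eigenvalue of the resolvent\<close>
  have F0: "PC.F (- {0<..1}) x = 0" for x
  proof -
    let ?y = "PC.F (- {0<..1}) x"
    have "?R ?y = PC.bint (\<lambda>u. f u * indicator (- {0<..1}) u) x"
      using PC.bint_bint[OF f PC.bnn_indicator, of "- {0<..1}" x] by (simp add: PC.bint_indicator Rf)
    also have "(\<lambda>u. f u * indicator (- {0<..1}) u) = (\<lambda>_. 0)"
      by (rule ext) (auto simp: f_def split: split_indicator)
    also have "PC.bint (\<lambda>_. 0) = (\<lambda>_. 0)"
      by (rule PC.bint_eqI) (simp add: PC.is_integral_def bounded_clinear_zero)
    finally have "?R ?y = 0" .
    then show ?thesis using shift_res[of ?y] by (simp add: dom_zero)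
  qed
  have AE01: "AE u in PC.\<mu> x. u \<in> {0<..1}" for x
  proof (rule AE_I[where N="- {0<..1}"])
    show "emeasure (PC.\<mu> x) (- {0<..1}) = 0" using F0[of x] by (subst PC.E_eq_0_iff[symmetric]) auto
  qed auto
  define E where "E S = PC.F (g -` S)" for S
  have pvm_E: "projection_valued_measure E"
    unfolding projection_valued_measure_def
  proof (intro conjI ballI allI impI)
    fix S :: "real set" assume S: "S \<in> sets borel"
    show "bounded_clinear (E S)" unfolding E_def by (rule PC.bounded_clinear_E[OF gS[OF S]])
    show "E S \<circ> E S = E S" using PC.E_idem[OF gS[OF S]] by (simp add: E_def fun_eq_iff)
    show "cinner (E S x) y = cinner x (E S y)" for x y
      using PC.symmetric_E[OF gS[OF S]] by (simp add: symmetric_op_def E_def)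
  next
    show "E UNIV = id" by (simp add: E_def fun_eq_iff)
  next
    fix S T :: "real set" assume "S \<in> sets borel" "T \<in> sets borel"
    then show "E (S \<inter> T) = E S \<circ> E T" using PC.E_Int[OF gS gS] by (simp add: E_def fun_eq_iff)
  next
    fix G :: "nat \<Rightarrow> real set" and x
    assume G: "range G \<subseteq> sets borel" "disjoint_family G"
    have "(\<lambda>n. PC.F (g -` G n) x) sums PC.F (\<Union>n. g -` G n) x"
      by (rule PC.E_sums) (use G gS in \<open>auto simp: disjoint_family_on_def\<close>)
    then show "(\<lambda>n. E (G n) x) sums E (\<Union>n. G n) x" by (simp add: E_def vimage_UN)
  qed
  interpret pvm E by unfold_locales (rule pvm_E)
  have \<mu>_distr: "\<mu> x = distr (PC.\<mu> x) borel g" for x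
  proof (rule measure_eqI)
    fix S assume "S \<in> sets (\<mu> x)"
    then have S: "S \<in> sets borel" by simp
    show "emeasure (\<mu> x) S = emeasure (distr (PC.\<mu> x) borel g) S"
      using S gS[OF S] by (simp add: emeasure_\<mu> emeasure_distr PC.emeasure_\<mu> E_def)
  qed simp
  have int_iff: "integrable (\<mu> x) (\<lambda>s. s\<^sup>2) \<longleftrightarrow> integrable (PC.\<mu> x) (\<lambda>u. (g u)\<^sup>2)" for x
    unfolding \<mu>_distr by (rule integrable_distr_eq) auto
  have resolvent_case: "integrable (PC.\<mu> (?R y)) (\<lambda>u. (g u)\<^sup>2)"
    "integral\<^sup>L (PC.\<mu> (?R y)) g = inner (?R y) (app A (?R y))" for y
  proof -
    have d: "PC.\<mu> (?R y) = density (PC.\<mu> y) (\<lambda>u. ennreal ((f u)\<^sup>2))"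
      using PC.\<mu>_bint[OF f, of y] by (simp add: Rf)
    interpret N: finite_measure "PC.\<mu> y" by simp
    have "integrable (PC.\<mu> y) (\<lambda>u. (f u)\<^sup>2 * (g u)\<^sup>2)"
    proof (rule N.integrable_const_bound[where B="(1 + \<bar>k\<bar>)\<^sup>2"])
      show "AE u in PC.\<mu> y. norm ((f u)\<^sup>2 * (g u)\<^sup>2) \<le> (1 + \<bar>k\<bar>)\<^sup>2"
        using AE01[of y]
      proof eventually_elim
        case (elim u)
        have "\<bar>k * u\<bar> \<le> \<bar>k\<bar> * 1" unfolding abs_mult using elim by (intro mult_left_mono) auto
        then have b: "\<bar>1 - k * u\<bar> \<le> 1 + \<bar>k\<bar>" by linarith
        have "f u * g u = 1 - k * u" using elim by (simp add: f_def g_def field_simps)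
        then have "(f u)\<^sup>2 * (g u)\<^sup>2 = \<bar>1 - k * u\<bar>\<^sup>2" by (metis power_mult_distrib power2_abs)
        also have "\<dots> \<le> (1 + \<bar>k\<bar>)\<^sup>2" by (rule power_mono[OF b]) simp
        finally show ?case by simp
      qed
    qed simp
    then show "integrable (PC.\<mu> (?R y)) (\<lambda>u. (g u)\<^sup>2)"
      unfolding d by (subst integrable_density) auto
    have "integral\<^sup>L (PC.\<mu> (?R y)) g = (\<integral>u. (f u)\<^sup>2 * g u \<partial>PC.\<mu> y)"
      unfolding d by (subst integral_density) auto
    also have "\<dots> = (\<integral>u. f u - k * (f u * f u) \<partial>PC.\<mu> y)"
    proof (rule integral_cong_AE)
      show "AE u in PC.\<mu> y. (f u)\<^sup>2 * g u = f u - k * (f u * f u)"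
        using AE01[of y]
        by eventually_elim (auto simp: f_def g_def power2_eq_square field_simps)
    qed auto
    also have "\<dots> = integral\<^sup>L (PC.\<mu> y) f - k * (\<integral>u. f u * f u \<partial>PC.\<mu> y)"
      using PC.bnn_integrable[OF f] PC.bnn_integrable[OF PC.bnn_mult[OF f f]] by simp
    also have "\<dots> = inner y (?R y) - k * inner (?R y) (?R y)"
      using PC.inner_bint_diag[OF f, of y] PC.inner_bint_bint[OF f f, of y] by (simp add: Rf)
    also have "\<dots> = inner (?R y) (app A (?R y))"
    proof -
      have "app A (?R y) = y - k *\<^sub>R ?R y" using shift_res[of y] by (simp add: algebra_simps)
      then show ?thesis by (simp add: inner_simps inner_commute)
    qed
    finally show "integral\<^sup>L (PC.\<mu> (?R y)) g = inner (?R y) (app A (?R y))" .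
  qed
  have dom_res: "\<exists>y. x = ?R y" if "x \<in> Domain A" for x using res_shift[OF that] by metis
  have converse: "x \<in> Domain A" if int: "integrable (PC.\<mu> x) (\<lambda>u. (g u)\<^sup>2)" for x
  proof -
    define q where "q n = 1 / real (Suc n)" for n
    have q0: "0 < q n" for n by (simp add: q_def)
    have q_lim: "q \<longlonglongrightarrow> 0" unfolding q_def by (intro LIMSEQ_Suc lim_1_over_n)
    \<comment> \<open>\<open>h u = 1 / u\<close> is the unbounded integrand, the \<open>fn\<close> cut it off near zero\<close>
    define h where "h = (\<lambda>u::real. indicator {0<..1} u / u)"
    define fn where "fn n = (\<lambda>u::real. indicator {q n..1} u / u)" for n
    have bnn: "PC.bnn (fn n)" for n
      unfolding fn_def
    proof (rule PC.bnnI[where M="1 / q n"])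
      fix s :: real
      show "0 \<le> indicator {q n..1} s / s" "indicator {q n..1} s / s \<le> 1 / q n"
        using q0[of n] by (auto simp: indicator_def frac_le)
    qed measurable
    have hm: "h \<in> borel_measurable borel" unfolding h_def by measurable
    have le: "fn n s \<le> h s" for n s
    proof -
      have "0 < q n" by (rule q0)
      then show ?thesis unfolding fn_def h_def by (auto simp: indicator_def)
    qed
    have lim: "(\<lambda>n. indicator {q n..1} s) \<longlonglongrightarrow> (indicator {0<..1} s :: real)" for s :: real
    proof (cases "s \<in> {0<..1}")
      case True
      have "\<forall>\<^sub>F n in sequentially. q n < s"
        using True by (intro order_tendstoD(2)[OF q_lim]) auto
      then have "\<forall>\<^sub>F n in sequentially. indicator {q n..1} s = (1::real)"
        by eventually_elim (use True in auto)
      with True show ?thesis by (simp add: tendsto_eventually)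
    next
      case False
      have "s \<notin> {q n..1}" for n
      proof -
        have "0 < q n" by (rule q0)
        with False show ?thesis by auto
      qed
      then show ?thesis using False by simp
    qed
    have lim': "(\<lambda>n. fn n s) \<longlonglongrightarrow> h s" for s
      unfolding fn_def h_def divide_inverse by (intro tendsto_intros lim)
    have "integrable (PC.\<mu> x) (\<lambda>u. (h u)\<^sup>2)"
    proof (rule Bochner_Integration.integrable_bound)
      interpret N: finite_measure "PC.\<mu> x" by simp
      show "integrable (PC.\<mu> x) (\<lambda>u. 2 * (g u)\<^sup>2 + 2 * k\<^sup>2)" using int by simp
      show "AE u in PC.\<mu> x. norm ((h u)\<^sup>2) \<le> norm (2 * (g u)\<^sup>2 + 2 * k\<^sup>2)"
        using AE01[of x]
      proof eventually_elim
        case (elim u)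
        then have "h u = g u + k" by (simp add: h_def g_def)
        moreover have "(g u + k)\<^sup>2 \<le> 2 * (g u)\<^sup>2 + 2 * k\<^sup>2"
          using zero_le_power2[of "g u - k"] by (simp add: power2_eq_square algebra_simps)
        ultimately show ?case by simp
      qed
    qed (use hm in auto)
    then obtain z where z: "(\<lambda>n. PC.bint (fn n) x) \<longlonglongrightarrow> z"
      by (rule PC.bint_convergent[OF bnn hm le lim'])
    have Rz: "?R (PC.bint (fn n) x) = PC.F {q n..1} x" for n
    proof -
      have "(\<lambda>u. f u * fn n u) = indicator {q n..1}"
      proof
        fix u :: real
        have "0 < q n" by (rule q0)
        then show "f u * fn n u = indicator {q n..1} u"
          by (auto simp: f_def fn_def indicator_def)
      qed
      then show ?thesis using PC.bint_bint[OF f bnn, of n x] by (simp add: Rf PC.bint_indicator)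
    qed
    have "(\<lambda>n. PC.F {q n..1} x) \<longlonglongrightarrow> x"
    proof -
      have "(\<lambda>n. \<integral>u. indicator {q n..1} u \<partial>PC.\<mu> x) \<longlonglongrightarrow> (\<integral>u. indicator {0<..1} u \<partial>PC.\<mu> x :: real)"
      proof (rule integral_dominated_convergence[where w="\<lambda>_. 1"])
        interpret N: finite_measure "PC.\<mu> x" by simp
        show "integrable (PC.\<mu> x) (\<lambda>_. 1 :: real)" by simp
      qed (use lim in \<open>auto simp: indicator_def\<close>)
      moreover have "(\<integral>u. indicator {0<..1} u \<partial>PC.\<mu> x :: real) = (norm x)\<^sup>2"
      proof -
        have "(\<integral>u. indicator {0<..1} u \<partial>PC.\<mu> x :: real) = (\<integral>u. 1 \<partial>PC.\<mu> x)"
        proof (rule integral_cong_AE)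
          show "AE u in PC.\<mu> x. indicator {0<..1} u = (1::real)" using AE01[of x] by eventually_elim simp
        qed auto
        then show ?thesis by (simp add: PC.measure_\<mu>_UNIV)
      qed
      ultimately have "(\<lambda>n. inner x (PC.F {q n..1} x)) \<longlonglongrightarrow> (norm x)\<^sup>2"
        by (simp add: PC.measure_\<mu>)
      then have "(\<lambda>n. (norm x)\<^sup>2 - inner x (PC.F {q n..1} x)) \<longlonglongrightarrow> (norm x)\<^sup>2 - (norm x)\<^sup>2"
        by (intro tendsto_intros)
      moreover have "(norm x)\<^sup>2 - inner x (PC.F {q n..1} x)
          = (norm (PC.F {q n..1} x - x))\<^sup>2" for n
        using PC.inner_E[of "{q n..1}" x]
        by (simp add: power2_norm_eq_inner inner_simps inner_commute)
      ultimately have "(\<lambda>n. (norm (PC.F {q n..1} x - x))\<^sup>2) \<longlonglongrightarrow> 0" by simp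
      then have "(\<lambda>n. sqrt ((norm (PC.F {q n..1} x - x))\<^sup>2)) \<longlonglongrightarrow> sqrt 0"
        by (rule tendsto_real_sqrt)
      then have "(\<lambda>n. norm (PC.F {q n..1} x - x)) \<longlonglongrightarrow> 0"
        by simp
      then show ?thesis by (rule LIM_zero_cancel[OF tendsto_norm_zero_cancel])
    qed
    moreover have "(\<lambda>n. PC.F {q n..1} x) \<longlonglongrightarrow> ?R z"
      using bounded_clinear_tendsto[OF bcR z] unfolding Rz .
    ultimately have "x = ?R z" by (rule LIMSEQ_unique)
    then show ?thesis using res_in by simp
  qed
  have "has_spectral_integral E (\<lambda>s. s) A"
    unfolding has_spectral_integral_def
  proof (intro conjI)
    show "(\<lambda>s::real. s) \<in> borel_measurable borel" by simp
    show "linear_operator A" by (rule lin)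
    show "Domain A = {x. integrable (\<mu> x) (\<lambda>s. s\<^sup>2)}"
    proof (intro equalityI subsetI)
      fix x assume "x \<in> Domain A"
      then obtain y where "x = ?R y" using dom_res by blast
      with resolvent_case(1)[of y] show "x \<in> {x. integrable (\<mu> x) (\<lambda>s. s\<^sup>2)}" by (simp add: int_iff)
    next
      fix x assume "x \<in> {x. integrable (\<mu> x) (\<lambda>s. s\<^sup>2)}"
      then show "x \<in> Domain A" using converse by (simp add: int_iff)
    qed
    show "\<forall>(x, y)\<in>A. cinner x y = complex_of_real (\<integral>s. s \<partial>\<mu> x)"
    proof (intro ballI, clarify)
      fix x z assume xz: "(x, z) \<in> A"
      then have x: "x \<in> Domain A" and z: "z = app A x" using app_eqI[OF lin xz] by auto
      obtain y where y: "x = ?R y" using dom_res[OF x] by blast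
      have "(\<integral>s. s \<partial>\<mu> x) = integral\<^sup>L (PC.\<mu> x) g"
        unfolding \<mu>_distr by (rule integral_distr) auto
      also have "\<dots> = inner x (app A x)" using resolvent_case(2)[of y] y by simp
      finally show "cinner x z = complex_of_real (\<integral>s. s \<partial>\<mu> x)" using cinner_app_real[OF x] z by simp
    qed
  qed
  with pvm_E show ?thesis by blast
qed

end

section \<open>Spectral subspaces, resolvent and heat semigroup\<close>

text \<open>\<open>E\<close> is any measure with the two properties that define the spectral measure of \<open>A\<close>.\<close>

locale spectral_operator = self_adjoint_operator A + pvm E
  for A :: "'h::chilbert operator" and E :: "real set \<Rightarrow> 'h \<Rightarrow> 'h" +
  fixes c :: real
  assumes hsi: "has_spectral_integral E (\<lambda>s. s) A" and lb: "lower_bound c"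
begin

lemma dom_iff: "x \<in> Domain A \<longleftrightarrow> integrable (\<mu> x) (\<lambda>s. s\<^sup>2)"
  using hsi by (auto simp: has_spectral_integral_def)

lemma inner_app: "x \<in> Domain A \<Longrightarrow> inner x (app A x) = (\<integral>s. s \<partial>\<mu> x)"
proof -
  assume "x \<in> Domain A"
  then have "(x, app A x) \<in> A" by (rule app_in[OF lin])
  then have "cinner x (app A x) = complex_of_real (\<integral>s. s \<partial>\<mu> x)"
    using hsi by (auto simp: has_spectral_integral_def)
  then show ?thesis by (simp add: Re_cinner[symmetric])
qed

lemma integrable_id: "x \<in> Domain A \<Longrightarrow> integrable (\<mu> x) (\<lambda>s. s)"
proof -
  assume x: "x \<in> Domain A"
  interpret finite_measure "\<mu> x" by simp
  show ?thesis
  proof (rule Bochner_Integration.integrable_bound)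
    show "integrable (\<mu> x) (\<lambda>s. 1 + s\<^sup>2)" using x by (simp add: dom_iff)
    have "\<bar>s\<bar> \<le> 1 + s\<^sup>2" for s :: real
      using zero_le_power2[of "\<bar>s\<bar> - 1"] by (simp add: power2_eq_square algebra_simps)
    then show "AE s in \<mu> x. norm s \<le> norm (1 + s\<^sup>2)" by simp
  qed simp
qed

lemma E_dom: "S \<in> sets borel \<Longrightarrow> x \<in> Domain A \<Longrightarrow> E S x \<in> Domain A"
  unfolding dom_iff
  using integrable_real_mult_indicator[of S "\<mu> x" "\<lambda>s. s\<^sup>2"]
  by (subst integral_\<mu>_E(2)) (auto simp: mult.commute)

lemma E_bounded_dom:
  assumes S: "S \<in> sets borel" "S \<subseteq> {l..u}"
  shows "E S x \<in> Domain A"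
  unfolding dom_iff
proof (subst integral_\<mu>_E(2)[OF S(1)])
  interpret finite_measure "\<mu> x" by simp
  show "integrable (\<mu> x) (\<lambda>s. indicator S s * s\<^sup>2)"
  proof (rule integrable_const_bound[where B="(\<bar>l\<bar> + \<bar>u\<bar>)\<^sup>2"])
    have "norm (indicator S s * s\<^sup>2) \<le> (\<bar>l\<bar> + \<bar>u\<bar>)\<^sup>2" for s
    proof (cases "s \<in> S")
      case True
      then have "\<bar>s\<bar> \<le> \<bar>l\<bar> + \<bar>u\<bar>" using S(2) by (auto simp: subset_iff)
      from power_mono[OF this, of 2] True show ?thesis by simp
    qed simp
    then show "AE s in \<mu> x. norm (indicator S s * s\<^sup>2) \<le> (\<bar>l\<bar> + \<bar>u\<bar>)\<^sup>2" by simp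
  qed (use S(1) in measurable)
qed simp

lemma integrable_const_indicator: "S \<in> sets borel \<Longrightarrow> integrable (\<mu> x) (\<lambda>s. k * indicator S s :: real)"
  by (intro integrable_mult_right bnn_integrable bnn_indicator)

lemma norm_E_integral: "S \<in> sets borel \<Longrightarrow> (norm (E S x))\<^sup>2 = (\<integral>s. indicator S s \<partial>\<mu> x)"
  by (simp add: measure_\<mu> inner_E)

lemma integrable_indicator_id:
  assumes S: "S \<in> sets borel" and y: "E S x \<in> Domain A"
  shows "integrable (\<mu> x) (\<lambda>s. indicator S s * s)"
  using integrable_id[OF y] by (subst (asm) integral_\<mu>_E(2)[OF S]) auto

lemma inner_app_E:
  assumes S: "S \<in> sets borel" and y: "E S x \<in> Domain A"
  shows "inner (E S x) (app A (E S x)) = (\<integral>s. indicator S s * s \<partial>\<mu> x)"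
  by (simp add: inner_app[OF y] integral_\<mu>_E(1)[OF S])

lemma form_on_E_le:
  assumes S: "S \<in> sets borel" "S \<subseteq> {..u}" and y: "E S x \<in> Domain A"
  shows "inner (E S x) (app A (E S x)) \<le> u * (norm (E S x))\<^sup>2"
proof -
  interpret finite_measure "\<mu> x" by simp
  have "(\<integral>s. indicator S s * s \<partial>\<mu> x) \<le> (\<integral>s. u * indicator S s \<partial>\<mu> x)"
    by (rule integral_mono[OF integrable_indicator_id[OF S(1) y] integrable_const_indicator[OF S(1)]])
      (use S in \<open>auto simp: indicator_def subset_iff\<close>)
  then show ?thesis by (simp add: inner_app_E[OF S(1) y] norm_E_integral[OF S(1)])
qed

lemma form_on_E_ge:
  assumes S: "S \<in> sets borel" "S \<subseteq> {l..}" and y: "E S x \<in> Domain A"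
  shows "l * (norm (E S x))\<^sup>2 \<le> inner (E S x) (app A (E S x))"
proof -
  interpret finite_measure "\<mu> x" by simp
  have "(\<integral>s. l * indicator S s \<partial>\<mu> x) \<le> (\<integral>s. indicator S s * s \<partial>\<mu> x)"
    by (rule integral_mono[OF integrable_const_indicator[OF S(1)] integrable_indicator_id[OF S(1) y]])
      (use S in \<open>auto simp: indicator_def subset_iff\<close>)
  then show ?thesis by (simp add: inner_app_E[OF S(1) y] norm_E_integral[OF S(1)])
qed

text \<open>On the spectral subspace of a bounded interval below \<open>c\<close> the form of \<open>A - c\<close> would be negative.\<close>

lemma E_below_eq_0: "E {..<c} x = 0"
proof -
  have bin: "E {l..<c} x = 0" if "l < c" for l
  proof -
    let ?S = "{l..<c}"
    have y: "E ?S x \<in> Domain A" by (rule E_bounded_dom[where l=l and u=c]) auto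
    interpret finite_measure "\<mu> x" by simp
    have i1: "integrable (\<mu> x) (\<lambda>s. indicator ?S s * s)" by (rule integrable_indicator_id[OF _ y]) simp
    have i2: "integrable (\<mu> x) (\<lambda>s. c * indicator ?S s)" by (rule integrable_const_indicator) simp
    have "c * (norm (E ?S x))\<^sup>2 \<le> inner (E ?S x) (app A (E ?S x))" by (rule lower_boundD[OF lb y])
    then have "(\<integral>s. c * indicator ?S s - indicator ?S s * s \<partial>\<mu> x) \<le> 0"
      using i1 i2 by (simp add: inner_app_E[OF _ y] norm_E_integral)
    moreover have nonneg: "0 \<le> c * indicator ?S s - indicator ?S s * s" for s by (simp add: indicator_def)
    ultimately have "(\<integral>s. c * indicator ?S s - indicator ?S s * s \<partial>\<mu> x) = 0"
      using integral_nonneg_AE[of "\<lambda>s. c * indicator ?S s - indicator ?S s * s" "\<mu> x"] by (simp add: order_antisym)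
    then have "AE s in \<mu> x. c * indicator ?S s - indicator ?S s * s = 0"
      using integral_nonneg_eq_0_iff_AE[OF Bochner_Integration.integrable_diff[OF i2 i1]] nonneg by simp
    then have "AE s in \<mu> x. s \<notin> ?S" by eventually_elim (auto simp: indicator_def split: if_splits)
    then have "emeasure (\<mu> x) ?S = 0" by (subst (asm) AE_iff_measurable[where N="?S"]) auto
    then show ?thesis by (simp add: E_eq_0_iff)
  qed
  have "E (\<Union>n. {c - real (Suc n)..<c}) x = 0" by (rule E_UN_eq_0) (use bin in auto)
  moreover have "(\<Union>n. {c - real (Suc n)..<c}) = {..<c}"
  proof (intro equalityI subsetI)
    fix s assume "s \<in> {..<c}"
    moreover obtain n where "c - s < real n" using reals_Archimedean2 by blast
    ultimately show "s \<in> (\<Union>n. {c - real (Suc n)..<c})" by (intro UN_I[of n]) auto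
  qed auto
  ultimately show ?thesis by simp
qed

lemma E_above: "S \<in> sets borel \<Longrightarrow> {c..} \<subseteq> S \<Longrightarrow> E S x = x"
proof -
  assume S: "S \<in> sets borel" "{c..} \<subseteq> S"
  have "E (- S) x = E (- S) (E {..<c} x)"
  proof -
    have "- S = - S \<inter> {..<c}" using S(2) by (auto simp: subset_iff not_le[symmetric])
    then show ?thesis using E_Int[of "- S" "{..<c}" x] S(1) by simp
  qed
  then have "E (- S) x = 0" using S(1) by (simp add: E_below_eq_0 bounded_clinear_simps[OF bounded_clinear_E])
  then show ?thesis using E_add_compl[OF S(1), of x] by simp
qed

lemma AE_ge_c: "AE s in \<mu> x. c \<le> s"
proof (rule AE_I[where N="{..<c}"])
  show "emeasure (\<mu> x) {..<c} = 0" using E_below_eq_0[of x] by (simp add: E_eq_0_iff)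
qed auto

lemma inner_dense_0:
  assumes "\<And>y. y \<in> Domain A \<Longrightarrow> inner y w = 0"
  shows "w = 0"
proof -
  have "closed {y. inner y w = 0}" by (intro closed_Collect_eq continuous_intros)
  then have "closure (Domain A) \<subseteq> {y. inner y w = 0}" by (intro closure_minimal) (use assms in auto)
  then have "w \<in> {y. inner y w = 0}" using dense by blast
  then show ?thesis by simp
qed

text \<open>The definition of the spectral integral only knows diagonal elements. As the scalar measures
  split along \<open>S\<close> and its complement, so does the diagonal of \<open>A\<close>, and polarization removes the
  off-diagonal block.\<close>

lemma form_cross_0:
  assumes S: "S \<in> sets borel" and x: "x \<in> Domain A"
  shows "E (- S) (app A (E S x)) = 0"
proof (rule inner_dense_0)
  fix y assume y: "y \<in> Domain A"
  have S': "- S \<in> sets borel" using S by auto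
  define p q where "p = E S x" and "q = E (- S) y"
  have pd: "p \<in> Domain A" and qd: "q \<in> Domain A" using E_dom S S' x y by (auto simp: p_def q_def)
  let ?z = "p + q"
  have z: "?z \<in> Domain A" by (rule dom_add(1)[OF pd qd])
  have cross: "E S (E (- S) w) = 0" "E (- S) (E S w) = 0" for w
    using E_Int[OF S S', of w] E_Int[OF S' S, of w] by simp_all
  have zp: "E S ?z = p" and zq: "E (- S) ?z = q"
    using S S' by (simp_all add: p_def q_def bounded_clinear_simps[OF bounded_clinear_E] E_idem cross)
  have "inner ?z (app A ?z) = (\<integral>s. indicator S s * s + indicator (- S) s * s \<partial>\<mu> ?z)"
    unfolding inner_app[OF z] by (intro Bochner_Integration.integral_cong) (auto simp: indicator_def)
  also have "\<dots> = inner p (app A p) + inner q (app A q)"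
    using inner_app_E[OF S, of ?z] inner_app_E[OF S', of ?z]
      integrable_indicator_id[OF S, of ?z] integrable_indicator_id[OF S', of ?z] pd qd
    by (simp add: zp zq)
  finally have "inner p (app A q) + inner q (app A p) = 0"
    by (simp add: dom_add(2)[OF pd qd] inner_simps)
  then have "inner q (app A p) = 0" using inner_sym[OF pd qd] by (simp add: inner_commute)
  then show "inner y (E (- S) (app A (E S x))) = 0"
    using symmetric_op_inner[OF symmetric_E[OF S'], of y "app A p"] by (simp add: p_def q_def)
qed

lemma E_app:
  assumes S: "S \<in> sets borel" and x: "x \<in> Domain A"
  shows "app A (E S x) = E S (app A x)"
proof -
  have S': "- S \<in> sets borel" using S by auto
  note bc = bounded_clinear_simps[OF bounded_clinear_E[OF S]]
  have "app A x = app A (E S x) + app A (E (- S) x)"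
    using dom_add(2)[OF E_dom[OF S x] E_dom[OF S' x]] by (simp add: E_add_compl[OF S])
  then have "E S (app A x) = E S (app A (E S x)) + E S (app A (E (- S) x))" by (simp add: bc)
  also have "E S (app A (E (- S) x)) = 0" using form_cross_0[OF S' x] by simp
  also have "E S (app A (E S x)) = app A (E S x)"
    using E_add_compl[OF S, of "app A (E S x)"] form_cross_0[OF S x] by simp
  finally show ?thesis by simp
qed

context
  fixes a :: real
  assumes ac: "0 < a + c"
begin

lemmas pos_res = positive_res[OF lb ac]
  and res_dom = res_in[OF lb ac] and shift_res' = shift_res[OF lb ac] and res_shift' = res_shift[OF lb ac]

lemma E_res: "S \<in> sets borel \<Longrightarrow> E S (res a x) = res a (E S x)"
proof -
  assume S: "S \<in> sets borel"
  note bc = bounded_clinear_simps[OF bounded_clinear_E[OF S]]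
  have "res a (E S x) = E S (res a x)"
  proof (rule res_eqI[OF lb ac E_dom[OF S res_dom]])
    have "app A (E S (res a x)) + a *\<^sub>R E S (res a x) = E S (app A (res a x) + a *\<^sub>R res a x)"
      by (simp add: E_app[OF S res_dom] bc)
    then show "app A (E S (res a x)) + a *\<^sub>R E S (res a x) = E S x" by (simp add: shift_res')
  qed
  then show ?thesis by simp
qed

lemma E_res_pow: "S \<in> sets borel \<Longrightarrow> E S ((res a ^^ n) x) = (res a ^^ n) (E S x)"
  by (induction n) (simp_all add: E_res)

lemma norm_res_pow_le:
  assumes S: "S \<in> sets borel" "S \<subseteq> {l..}" and la: "0 < l + a" and x: "E S x = x"
  shows "norm ((res a ^^ n) x) \<le> norm x / (l + a) ^ n"
proof (induction n)
  case (Suc n)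
  let ?y = "(res a ^^ n) x" and ?w = "res a ((res a ^^ n) x)"
  have "E S ?w = ?w" using E_res_pow[OF S(1), of "Suc n" x] by (simp add: x)
  then have "l * (norm ?w)\<^sup>2 \<le> inner ?w (app A ?w)"
    using form_on_E_ge[OF S, of ?w] res_dom[of ?y] by simp
  then have "(l + a) * (norm ?w)\<^sup>2 \<le> inner ?w (app A ?w + a *\<^sub>R ?w)"
    by (simp add: inner_simps power2_norm_eq_inner distrib_right)
  also have "\<dots> = inner ?w ?y" by (simp add: shift_res')
  also have "\<dots> \<le> norm ?w * norm ?y" by (rule norm_cauchy_schwarz)
  finally have "norm ?w * ((l + a) * norm ?w) \<le> norm ?w * norm ?y"
    by (simp add: power2_eq_square mult.left_commute)
  then have "(l + a) * norm ?w \<le> norm ?y" by (cases "?w = 0") simp_all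
  also have "\<dots> \<le> norm x / (l + a) ^ n" by (rule Suc)
  finally have "norm ?w \<le> norm x / (l + a) ^ n / (l + a)"
    using la by (simp add: pos_le_divide_eq mult.commute del: divide_divide_eq_left)
  then show ?case by (simp add: mult.commute)
qed simp

text \<open>On the range of \<open>E {..<u}\<close> the operator \<open>A + a\<close> is bounded by \<open>u + a\<close>; with \<open>w = res a z\<close> this is an
  estimate of \<open>\<langle>z, res a z\<rangle>\<close>, which Cauchy--Schwarz for the form of \<open>res a\<close> turns into one of
  \<open>\<parallel>w\<parallel>\<close>.\<close>

lemma norm_le_res_pow:
  assumes u: "0 < u + a" and x: "E {..<u} x = x"
  shows "norm x \<le> (u + a) ^ n * norm ((res a ^^ n) x)"
proof -
  have step: "norm w \<le> (u + a) * norm (res a w)" if w: "E {..<u} w = w" for w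
  proof -
    have cu: "E {c..<u} v = v" if "E {..<u} v = v" for v
    proof -
      have "{c..<u} = {c..} \<inter> {..<u}" by auto
      then show ?thesis using E_Int[of "{c..}" "{..<u}" v] E_above[of "{c..}"] that by simp
    qed
    have "E {c..<u} w \<in> Domain A" by (rule E_bounded_dom[where l=c and u=u]) auto
    then have wd: "w \<in> Domain A" by (simp only: cu[OF w])
    define z where "z = app A w + a *\<^sub>R w"
    have Rz: "res a z = w" by (simp add: z_def res_shift'[OF wd])
    have zw: "inner z (res a z) \<le> (u + a) * (norm w)\<^sup>2"
    proof -
      have "inner w (app A w) \<le> u * (norm w)\<^sup>2"
        using form_on_E_le[of "{c..<u}" u w] cu[OF w] wd by (auto simp: subset_iff)
      then show ?thesis
        unfolding Rz by (simp add: z_def inner_simps power2_norm_eq_inner inner_commute distrib_right)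
    qed
    have "((norm w)\<^sup>2)\<^sup>2 = (inner w (res a z))\<^sup>2" by (simp add: Rz power2_norm_eq_inner)
    also have "\<dots> \<le> inner w (res a w) * inner z (res a z)" by (rule positive_op_cauchy_schwarz[OF pos_res])
    also have "\<dots> \<le> inner w (res a w) * ((u + a) * (norm w)\<^sup>2)"
      by (rule mult_left_mono[OF zw positive_opD(2)[OF pos_res]])
    also have "\<dots> \<le> (norm w * norm (res a w)) * ((u + a) * (norm w)\<^sup>2)"
      by (rule mult_right_mono[OF norm_cauchy_schwarz]) (use u in simp)
    finally have "norm w ^ 3 * norm w \<le> norm w ^ 3 * ((u + a) * norm (res a w))"
      by (simp add: power2_eq_square power3_eq_cube mult_ac)
    then show ?thesis by (cases "w = 0") (use u in \<open>simp_all add: mult_le_cancel_left\<close>)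
  qed
  show ?thesis
  proof (induction n)
    case (Suc n)
    let ?y = "(res a ^^ n) x"
    have "E {..<u} ?y = ?y" using E_res_pow[of "{..<u}" n x] by (simp add: x)
    then have "(u + a) ^ n * norm ?y \<le> (u + a) ^ n * ((u + a) * norm (res a ?y))"
      using u by (intro mult_left_mono step) auto
    with Suc show ?case by (simp add: mult.assoc mult.left_commute)
  qed simp
qed

text \<open>The range of \<open>E {l..}\<close> consists of the vectors on which the powers of the resolvent grow at
  most like \<open>(l + a)\<^sup>-\<^sup>n\<close>. A contraction that commutes with the resolvent preserves this growth, hence
  this range.\<close>

lemma commuting_projection_halfline:
  assumes V: "closed_csubspace V" and comm: "\<And>x. orth_proj V (res a x) = res a (orth_proj V x)"
    and l: "c \<le> l"
  shows "orth_proj V (E {l..} x) = E {l..} (orth_proj V x)"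
proof -
  let ?P = "orth_proj V"
  have la: "0 < l + a" using l ac by simp
  have comm_pow: "?P ((res a ^^ n) x) = (res a ^^ n) (?P x)" for n x
    by (induction n) (simp_all add: comm)
  have zero: "E {..<l} (?P (E {l..} x)) = 0" for x
  proof -
    let ?x = "E {l..} x"
    have "E {..<u} (?P ?x) = 0" if u: "u < l" for u
    proof (cases "u \<le> c")
      case True
      have "{..<u} = {..<u} \<inter> {..<c}" using True by auto
      then show ?thesis using E_Int[of "{..<u}" "{..<c}" "?P ?x"]
        by (simp add: E_below_eq_0 bounded_clinear_simps[OF bounded_clinear_E])
    next
      case False
      then have ua: "0 < u + a" using ac by simp
      let ?y = "E {..<u} (?P ?x)"
      have xx: "E {l..} ?x = ?x" by (rule E_idem) simp
      have "norm ?y \<le> ((u + a) / (l + a)) ^ n * norm ?x" for n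
      proof -
        have "norm ?y \<le> (u + a) ^ n * norm ((res a ^^ n) ?y)"
          by (rule norm_le_res_pow[OF ua]) (simp add: E_idem)
        also have "norm ((res a ^^ n) ?y) = norm (E {..<u} (?P ((res a ^^ n) ?x)))"
          by (simp add: E_res_pow comm_pow)
        also have "\<dots> \<le> norm (?P ((res a ^^ n) ?x))" by (rule norm_E_le) simp
        also have "\<dots> \<le> norm ((res a ^^ n) ?x)" by (rule norm_orth_proj_le[OF V])
        also have "\<dots> \<le> norm ?x / (l + a) ^ n" by (rule norm_res_pow_le[OF _ _ la xx]) auto
        finally show ?thesis using ua by (simp add: power_divide mult_left_mono)
      qed
      moreover have "(\<lambda>n. ((u + a) / (l + a)) ^ n * norm ?x) \<longlonglongrightarrow> 0 * norm ?x"
        using ua la u by (intro tendsto_intros LIMSEQ_realpow_zero) auto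
      ultimately have "norm ?y \<le> 0 * norm ?x" by (intro LIMSEQ_le_const) auto
      then show ?thesis by simp
    qed
    then have "E (\<Union>n. {..<l - 1 / real (Suc n)}) (?P ?x) = 0" by (intro E_UN_eq_0) auto
    moreover have "(\<Union>n. {..<l - 1 / real (Suc n)}) = {..<l}"
    proof (intro equalityI subsetI)
      fix s assume "s \<in> {..<l}"
      then obtain n where "1 / real (Suc n) < l - s" using nat_approx_posE[of "l - s"] by auto
      then show "s \<in> (\<Union>n. {..<l - 1 / real (Suc n)})" by (intro UN_I[of n]) auto
    qed (auto intro: less_le_trans)
    ultimately show ?thesis by simp
  qed
  have compl: "- {l..} = {..<l}" by auto
  have EPE: "E {l..} (?P (E {l..} x)) = ?P (E {l..} x)" for x
    using E_add_compl[of "{l..}" "?P (E {l..} x)"] zero[of x] by (simp add: compl)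
  have symP: "cinner (?P x) y = cinner x (?P y)" for x y
    using symmetric_orth_proj[OF V] by (simp add: symmetric_op_def)
  have symE: "cinner (E {l..} x) y = cinner x (E {l..} y)" for x y
    using symmetric_E[of "{l..}"] by (simp add: symmetric_op_def)
  have "cinner z (E {l..} (?P x) - E {l..} (?P (E {l..} x))) = 0" for z
  proof -
    have "cinner z (E {l..} (?P x)) = cinner (?P (E {l..} z)) x" by (simp add: symP symE)
    also have "\<dots> = cinner (E {l..} (?P (E {l..} z))) x" by (simp add: EPE)
    also have "\<dots> = cinner z (E {l..} (?P (E {l..} x)))" by (simp add: symP symE)
    finally show ?thesis by (simp add: cinner_diff_right)
  qed
  then have "E {l..} (?P x) = E {l..} (?P (E {l..} x))"
    using cinner_extensionality[of "E {l..} (?P x) - E {l..} (?P (E {l..} x))"] by simp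
  then show ?thesis by (simp add: EPE)
qed

end

text \<open>The exponential is cut off below the spectrum to be bounded.\<close>

definition heat_fun :: "real \<Rightarrow> real \<Rightarrow> real" where
  "heat_fun t s = exp (- t * s) * indicator {c..} s"

lemma bnn_heat_fun: "t > 0 \<Longrightarrow> bnn (heat_fun t)"
proof (rule bnnI[where M="exp (- t * c)"])
  show "heat_fun t \<in> borel_measurable borel" unfolding heat_fun_def[abs_def] by measurable
qed (auto simp: heat_fun_def indicator_def)

lemma heat_has_spectral_integral:
  assumes t: "t > 0"
  shows "has_spectral_integral E (\<lambda>s. exp (- t * s)) {(x, bint (heat_fun t) x) |x. True}"
    and "has_spectral_integral E (\<lambda>s. exp (- t * s)) G \<Longrightarrow> G = {(x, bint (heat_fun t) x) |x. True}"
proof -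
  let ?T = "bint (heat_fun t)" and ?H = "{(x, bint (heat_fun t) x) |x. True}"
  note T = bounded_clinear_bint[OF bnn_heat_fun[OF t]]
  have int: "integrable (\<mu> x) (\<lambda>s. (exp (- t * s))\<^sup>2)" for x
  proof -
    interpret finite_measure "\<mu> x" by simp
    show ?thesis
    proof (rule integrable_const_bound[where B="(exp (- t * c))\<^sup>2"])
      show "AE s in \<mu> x. norm ((exp (- t * s))\<^sup>2) \<le> (exp (- t * c))\<^sup>2"
        using AE_ge_c[of x] by eventually_elim (use t in \<open>auto intro!: power_mono\<close>)
    qed measurable
  qed
  have diag: "cinner x (?T x) = complex_of_real (\<integral>s. exp (- t * s) \<partial>\<mu> x)" for x
  proof -
    have "(\<integral>s. exp (- t * s) \<partial>\<mu> x) = integral\<^sup>L (\<mu> x) (heat_fun t)"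
    proof (rule integral_cong_AE)
      show "AE s in \<mu> x. exp (- t * s) = heat_fun t s"
        using AE_ge_c[of x] by eventually_elim (simp add: heat_fun_def)
    qed (use bnn_measurable[OF bnn_heat_fun[OF t]] in auto)
    then show ?thesis using is_integral_bint[OF bnn_heat_fun[OF t]] by (simp add: is_integral_def)
  qed
  show "has_spectral_integral E (\<lambda>s. exp (- t * s)) ?H"
    unfolding has_spectral_integral_def
  proof (intro conjI)
    show "linear_operator ?H"
      unfolding linear_operator_def single_valued_def by (auto simp: bounded_clinear_simps[OF T])
    show "Domain ?H = {x. integrable (\<mu> x) (\<lambda>s. (exp (- t * s))\<^sup>2)}" using int by auto
    show "\<forall>(x, y)\<in>?H. cinner x y = complex_of_real (\<integral>s. exp (- t * s) \<partial>\<mu> x)" using diag by auto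
  qed measurable
  show "G = ?H" if G: "has_spectral_integral E (\<lambda>s. exp (- t * s)) G"
  proof -
    have lG: "linear_operator G" and dG: "x \<in> Domain G" for x
      using G int by (auto simp: has_spectral_integral_def)
    have "app G = ?T"
    proof (rule op_eqI)
      show "cinner x (app G x) = cinner x (?T x)" for x
        unfolding diag using G app_in[OF lG dG, of x] by (auto simp: has_spectral_integral_def)
    qed (simp_all add: linear_operator_add(2)[OF lG dG dG] linear_operator_scaleC(2)[OF lG dG]
        bounded_clinear_simps[OF T])
    then have "(x, y) \<in> G \<longleftrightarrow> y = ?T x" for x y
      using app_in[OF lG dG, of x] app_eqI[OF lG, of x y] by auto
    then show ?thesis by auto
  qed
qed

lemma heat_op_eq:
  assumes E: "E = spectral_measure A" and t: "t > 0"
  shows "heat_op t A = bint (heat_fun t)"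
proof -
  have fc: "fun_calc (\<lambda>s. exp (- t * s)) A = {(x, bint (heat_fun t) x) |x. True}"
    unfolding fun_calc_def E[symmetric]
    by (rule the_equality, rule heat_has_spectral_integral(1)[OF t],
        erule heat_has_spectral_integral(2)[OF t])
  have "linear_operator {(x, bint (heat_fun t) x) |x. True}"
    using heat_has_spectral_integral(1)[OF t] by (simp add: has_spectral_integral_def)
  then show ?thesis
    unfolding heat_op_def fc by (intro ext app_eqI) blast+
qed

lemma heat_le:
  assumes t: "t > 0" and S: "S \<in> sets borel" "S \<subseteq> {l..}" and x: "E S x = x"
  shows "inner x (bint (heat_fun t) x) \<le> exp (- t * l) * (norm x)\<^sup>2"
proof -
  have "integral\<^sup>L (\<mu> x) (heat_fun t) = (\<integral>s. indicator S s * heat_fun t s \<partial>\<mu> x)"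
    using integral_\<mu>_E(1)[OF S(1) bnn_measurable[OF bnn_heat_fun[OF t]], of x] by (simp add: x)
  also have "\<dots> \<le> (\<integral>s. exp (- t * l) \<partial>\<mu> x)"
  proof (rule integral_mono)
    interpret finite_measure "\<mu> x" by simp
    show "integrable (\<mu> x) (\<lambda>s. indicator S s * heat_fun t s)"
      by (intro bnn_integrable bnn_mult bnn_indicator S bnn_heat_fun t)
    show "integrable (\<mu> x) (\<lambda>s. exp (- t * l))" by simp
    show "indicator S s * heat_fun t s \<le> exp (- t * l)" for s
      using S(2) t by (auto simp: indicator_def heat_fun_def subset_iff)
  qed
  finally show ?thesis by (simp add: inner_bint_diag[OF bnn_heat_fun[OF t]] measure_\<mu>_UNIV mult.commute)
qed

text \<open>Jensen's inequality for the convex function \<open>s \<mapsto> exp (- t s)\<close>: integrate its tangent at \<open>l\<close>.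
  Unlike the usual form, this one is continuous in the form norm and survives the passage to the
  form domain.\<close>

lemma heat_tangent:
  assumes t: "t > 0" and x: "x \<in> Domain A"
  shows "exp (- t * l) * ((1 + t * l) * (norm x)\<^sup>2 - t * inner x (app A x)) \<le> inner x (bint (heat_fun t) x)"
proof -
  interpret finite_measure "\<mu> x" by simp
  have "exp (- t * l) * ((1 + t * l) * (norm x)\<^sup>2 - t * inner x (app A x))
      = (\<integral>s. exp (- t * l) * ((1 + t * l) - t * s) \<partial>\<mu> x)"
    using integrable_id[OF x] by (simp add: inner_app[OF x] measure_\<mu>_UNIV mult.commute)
  also have "\<dots> \<le> integral\<^sup>L (\<mu> x) (heat_fun t)"
  proof (rule integral_mono_AE)
    show "integrable (\<mu> x) (\<lambda>s. exp (- t * l) * ((1 + t * l) - t * s))" using integrable_id[OF x] by simp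
    show "integrable (\<mu> x) (heat_fun t)" by (rule bnn_integrable[OF bnn_heat_fun[OF t]])
    show "AE s in \<mu> x. exp (- t * l) * ((1 + t * l) - t * s) \<le> heat_fun t s"
      using AE_ge_c[of x]
    proof eventually_elim
      case (elim s)
      have "(1 + t * l) - t * s = 1 + t * (l - s)" by (simp add: algebra_simps)
      also have "\<dots> \<le> exp (t * (l - s))" by (rule exp_ge_add_one_self)
      finally have "exp (- t * l) * ((1 + t * l) - t * s) \<le> exp (- t * l) * exp (t * (l - s))"
        by (rule mult_left_mono) simp
      also have "\<dots> = exp (- t * s)" by (simp add: exp_add[symmetric] algebra_simps)
      finally show ?case using elim by (simp add: heat_fun_def)
    qed
  qed
  also have "\<dots> = inner x (bint (heat_fun t) x)" by (simp add: inner_bint_diag[OF bnn_heat_fun[OF t]])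
  finally show ?thesis .
qed

end

section \<open>Comparison of traces\<close>

lemma compression_positive:
  assumes V: "closed_csubspace V" and X: "positive_op X"
  shows "positive_op (orth_proj V \<circ> X \<circ> orth_proj V)"
proof (rule positive_opI)
  let ?P = "orth_proj V"
  have symP: "cinner (?P x) y = cinner x (?P y)" for x y
    using symmetric_orth_proj[OF V] by (simp add: symmetric_op_def)
  show "bounded_clinear (?P \<circ> X \<circ> ?P)"
    using bounded_clinear_compose[OF bounded_clinear_orth_proj[OF V]
      bounded_clinear_compose[OF positive_opD(1)[OF X] bounded_clinear_orth_proj[OF V]]]
    by (simp add: comp_def)
  show "symmetric_op (?P \<circ> X \<circ> ?P)"
    using positive_op_symmetric[OF X] by (simp add: symmetric_op_def symP)
  show "0 \<le> inner x ((?P \<circ> X \<circ> ?P) x)" for x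
    using positive_opD(2)[OF X, of "?P x"] symP[of x "X (?P x)"] by (simp add: Re_cinner[symmetric])
qed

context pvm begin

text \<open>Cut the half-line into bins of length \<open>d\<close>. Since the projection onto \<open>V\<close> commutes with the
  spectral projections of the bins, there is an orthonormal basis whose elements are orthogonal to
  \<open>V\<close> or lie in \<open>V\<close> and in the spectral subspace of one bin, and the traces can be compared term by
  term.\<close>

lemma proj_trace_comparison:
  assumes V: "closed_csubspace V"
    and supp: "\<And>x. E {c..} x = x"
    and comm: "\<And>l x. c \<le> l \<Longrightarrow> orth_proj V (E {l..} x) = E {l..} (orth_proj V x)"
    and X: "positive_op X" and Y: "positive_op Y" and d: "0 < d" and K: "0 \<le> K"
    and le: "\<And>l x. c \<le> l \<Longrightarrow> x \<in> V \<Longrightarrow> norm x = 1 \<Longrightarrow> E {l..<l+d} x = x \<Longrightarrow>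
      inner x (X x) \<le> K * inner x (Y x)"
  shows "proj_trace V X \<le> ennreal K * proj_trace V Y"
proof -
  let ?P = "orth_proj V"
  define I where "I j = {c + real j * d..<c + real j * d + d}" for j :: nat
  have I_borel: "I j \<in> sets borel" for j by (simp add: I_def)
  have I_diff: "E (I j) x = E {c + real j * d..} x - E {c + real (Suc j) * d..} x" for j x
  proof -
    let ?A = "{c + real j * d..}" and ?B = "{c + real (Suc j) * d..}"
    have 1: "E ?A (E ?B x) = E ?B x"
    proof -
      have "?A \<inter> ?B = ?B" using d by (auto simp: algebra_simps)
      then show ?thesis using E_Int[of ?A ?B x] by simp
    qed
    have 2: "E ?A (E (- ?B) x) = E (I j) x"
    proof -
      have "?A \<inter> - ?B = I j" by (auto simp: I_def algebra_simps)
      then show ?thesis using E_Int[of ?A "- ?B" x] by simp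
    qed
    have "E ?B x + E (- ?B) x = x" by (rule E_add_compl) simp
    then have "E ?A x = E ?A (E ?B x + E (- ?B) x)" by (simp only:)
    also have "\<dots> = E ?A (E ?B x) + E ?A (E (- ?B) x)"
      by (rule bounded_clinear_simps(1)[OF bounded_clinear_E]) simp
    also have "\<dots> = E ?B x + E (I j) x" by (simp only: 1 2)
    finally show ?thesis by simp
  qed
  have P_I: "?P (E (I j) x) = E (I j) (?P x)" for j x
    using d by (simp add: I_diff bounded_clinear_simps[OF bounded_clinear_orth_proj[OF V]] comm)
  have disj: "disjoint_family I"
    unfolding disjoint_family_on_def
  proof (intro ballI impI)
    fix i j :: nat assume "i \<noteq> j"
    then show "I i \<inter> I j = {}"
    proof (induction i j rule: linorder_wlog)
      case (le i j)
      then have "real i + 1 \<le> real j" by linarith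
      then have "(real i + 1) * d \<le> real j * d" using d by (intro mult_right_mono) auto
      then show ?case by (auto simp: I_def algebra_simps)
    qed (auto simp: Int_commute)
  qed
  have UN_I: "(\<Union>j. I j) = {c..}"
  proof (intro equalityI subsetI)
    fix s assume "s \<in> {c..}"
    define j where "j = nat \<lfloor>(s - c) / d\<rfloor>"
    have "0 \<le> (s - c) / d" using \<open>s \<in> {c..}\<close> d by simp
    then have "real j \<le> (s - c) / d" "(s - c) / d < real j + 1" unfolding j_def by linarith+
    then have "real j * d \<le> s - c" "s - c < (real j + 1) * d" using d by (simp_all add: field_simps)
    then have "s \<in> I j" by (auto simp: I_def algebra_simps)
    then show "s \<in> (\<Union>j. I j)" by blast
  next
    fix s assume "s \<in> (\<Union>j. I j)"
    then obtain j where "c + real j * d \<le> s" by (auto simp: I_def)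
    moreover have "0 \<le> real j * d" using d by simp
    ultimately show "s \<in> {c..}" by simp
  qed
  \<comment> \<open>the vectors admitted to the adapted basis\<close>
  define G where "G = {x. x \<in> V \<and> (\<exists>j. E (I j) x = x)} \<union> {x. ?P x = 0}"
  note bcP = bounded_clinear_simps[OF bounded_clinear_orth_proj[OF V]]
    and bcE = bounded_clinear_simps[OF bounded_clinear_E[OF I_borel]]
  have symP: "cinner (?P x) y = cinner x (?P y)" for x y
    using symmetric_orth_proj[OF V] by (simp add: symmetric_op_def)
  have symE: "cinner (E (I j) x) y = cinner x (E (I j) y)" for j x y
    using symmetric_E[OF I_borel] by (simp add: symmetric_op_def)
  obtain Es where Es: "Es \<subseteq> G" "orthonormal_basis Es"
  proof (rule orthonormal_basis_in[of G])
    fix r x assume x: "x \<in> G"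
    have "r *\<^sub>R y \<in> V" if "y \<in> V" for y
      using V that by (auto simp: closed_csubspace_def scaleC_of_real[symmetric])
    with x show "r *\<^sub>R x \<in> G" by (auto simp: G_def bcP bcE)
  next
    fix Es x assume sub: "Es \<subseteq> G" and x: "x \<noteq> 0" and orth: "\<And>e. e \<in> Es \<Longrightarrow> cinner e x = 0"
    show "\<exists>y\<in>G. y \<noteq> 0 \<and> (\<forall>e\<in>Es. cinner e y = 0)"
    proof (cases "?P x = 0")
      case True
      then show ?thesis using x orth by (auto simp: G_def)
    next
      case False
      have "(\<lambda>j. E (I j) (?P x)) sums ?P x"
        using E_sums[OF _ disj, of "?P x"] I_borel by (simp add: UN_I supp image_subset_iff)
      then obtain j where j: "E (I j) (?P x) \<noteq> 0"
        using False sums_zero sums_unique2 by (metis (no_types, lifting) sums_cong)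
      let ?y = "E (I j) (?P x)"
      have PV: "?y \<in> V" using orth_proj_in[OF V, of "E (I j) x"] by (simp add: P_I)
      have "cinner e ?y = 0" if eEs: "e \<in> Es" for e
      proof -
        consider i where "e \<in> V" "E (I i) e = e" | "?P e = 0" using sub eEs unfolding G_def by blast
        then show ?thesis
        proof cases
          case 1
          have "cinner e ?y = cinner (E (I j) (E (I i) e)) (?P x)" using 1(2) by (simp add: symE)
          also have "\<dots> = 0"
          proof (cases "i = j")
            case True
            have "cinner (E (I j) (E (I i) e)) (?P x) = cinner e (?P x)"
              using 1(2) True by simp
            also have "\<dots> = cinner (?P e) x" by (simp add: symP)
            also have "\<dots> = 0" using orth_proj_id[OF V 1(1)] orth[OF eEs] by simp
            finally show ?thesis .
          next
            case False
            then have "I j \<inter> I i = {}" using disj by (auto simp: disjoint_family_on_def)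
            then show ?thesis using E_Int[OF I_borel[of j] I_borel[of i], of e] by simp
          qed
          finally show ?thesis .
        next
          case 2
          have "cinner e ?y = cinner e (?P ?y)" using orth_proj_id[OF V PV] by simp
          also have "\<dots> = cinner (?P e) ?y" by (simp add: symP)
          finally show ?thesis using 2 by simp
        qed
      qed
      moreover have "?y \<in> G" unfolding G_def using PV E_idem[OF I_borel] by blast
      ultimately show ?thesis using j by blast
    qed
  qed
  have tr: "proj_trace V Z = infsum (\<lambda>e. ennreal (inner e ((?P \<circ> Z \<circ> ?P) e))) Es" if "positive_op Z" for Z
    unfolding proj_trace_def by (rule trace_eq[OF compression_positive[OF V that] Es(2)])
  have le_e: "ennreal (inner e ((?P \<circ> X \<circ> ?P) e)) \<le> ennreal K * ennreal (inner e ((?P \<circ> Y \<circ> ?P) e))"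
    if e: "e \<in> Es" for e
  proof -
    have n: "norm e = 1"
    proof -
      have "cinner e e = 1" using Es(2) e unfolding orthonormal_basis_def by auto
      then have "(norm e)\<^sup>2 = 1\<^sup>2" unfolding cinner_self of_real_eq_1_iff by simp
      then show ?thesis by (rule power2_eq_imp_eq) auto
    qed
    have diag: "inner e ((?P \<circ> Z \<circ> ?P) e) = inner (?P e) (Z (?P e))" for Z
      using symmetric_op_inner[OF symmetric_orth_proj[OF V], of e "Z (?P e)"] by simp
    consider i where "e \<in> V" "E (I i) e = e" | "?P e = 0" using Es(1) e unfolding G_def by blast
    then show ?thesis
    proof cases
      case 1
      have "inner e (X e) \<le> K * inner e (Y e)"
        by (rule le[of "c + real i * d"]) (use 1 n d in \<open>auto simp: I_def\<close>)
      then show ?thesis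
        unfolding diag orth_proj_id[OF V 1(1)] ennreal_mult'[OF K, symmetric] by (rule ennreal_leI)
    next
      case 2
      then show ?thesis unfolding diag by simp
    qed
  qed
  have "proj_trace V X \<le> infsum (\<lambda>e. ennreal K * ennreal (inner e ((?P \<circ> Y \<circ> ?P) e))) Es"
    unfolding tr[OF X] by (rule infsum_ennreal_mono) (rule le_e)
  also have "\<dots> = ennreal K * proj_trace V Y"
    unfolding tr[OF Y] by (simp add: infsum_ennreal_SUP sum_distrib_left[symmetric] SUP_mult_left_ennreal)
  finally show ?thesis .
qed

end

lemma ennreal_le_limit_factor:
  fixes K :: "nat \<Rightarrow> real" and a b :: ennreal
  assumes le: "\<And>n. a \<le> ennreal (K n) * b" and lim: "K \<longlonglongrightarrow> 1"
  shows "a \<le> b"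
proof (cases "b = top")
  case False
  have "(\<lambda>n. ennreal (K n)) \<longlonglongrightarrow> ennreal 1" by (intro tendsto_ennrealI lim)
  then have "(\<lambda>n. ennreal (K n) * b) \<longlonglongrightarrow> ennreal 1 * b"
    using False by (intro tendsto_mult_ennreal tendsto_const) auto
  then have "a \<le> ennreal 1 * b" using le by (intro LIMSEQ_le_const) auto
  then show ?thesis by simp
qed simp

lemma positive_op_power_of_two:
  assumes R: "positive_op R"
  shows "positive_op (R ^^ (2 ^ n))"
proof (cases n)
  case 0
  then show ?thesis using R by simp
next
  case (Suc k)
  note sym = symmetric_op_funpow[OF positive_op_symmetric[OF R]]
  show ?thesis
  proof (rule positive_opI)
    show "bounded_clinear (R ^^ (2 ^ n))" by (rule bounded_clinear_funpow[OF positive_opD(1)[OF R]])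
    show "symmetric_op (R ^^ (2 ^ n))" by (rule sym)
    have "(R ^^ (2 ^ n)) x = (R ^^ (2 ^ k)) ((R ^^ (2 ^ k)) x)" for x
      by (simp add: Suc mult_2 funpow_add)
    then show "0 \<le> inner x ((R ^^ (2 ^ n)) x)" for x
      using symmetric_op_inner[OF sym, of "2 ^ k" x "(R ^^ (2 ^ k)) x"] by (metis inner_ge_zero)
  qed
qed

text \<open>Jensen's inequality for powers of two, by iterating \<open>\<langle>x, T x\<rangle>\<^sup>2 \<le> \<parallel>T x\<parallel>\<^sup>2 = \<langle>x, T\<^sup>2 x\<rangle>\<close>.\<close>

lemma inner_power_ge:
  assumes R: "positive_op R" and x: "norm x = 1" and q: "0 \<le> q" "q \<le> inner x (R x)"
  shows "q ^ (2 ^ n) \<le> inner x ((R ^^ (2 ^ n)) x)"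
proof (induction n)
  case (Suc n)
  let ?T = "R ^^ (2 ^ n)"
  note sym = symmetric_op_funpow[OF positive_op_symmetric[OF R], of "2 ^ n"]
  have "q ^ (2 ^ n) \<le> norm x * norm (?T x)" using Suc norm_cauchy_schwarz order_trans by blast
  then have "(q ^ (2 ^ n))\<^sup>2 \<le> (norm (?T x))\<^sup>2" using x q(1) by (intro power_mono) auto
  also have "\<dots> = inner x (?T (?T x))"
    using symmetric_op_inner[OF sym, of x "?T x"] by (simp add: power2_norm_eq_inner)
  also have "?T (?T x) = (R ^^ (2 ^ Suc n)) x" by (simp add: mult_2 funpow_add)
  finally show ?case by (simp add: power_mult[symmetric] mult.commute)
qed (use q in simp)

context self_adjoint_operator begin

text \<open>For \<open>\<psi>\<close> in the domain, Cauchy--Schwarz for the form of \<open>res a\<close> at \<open>x\<close> and \<open>(A + a) \<psi>\<close> bounds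
  \<open>\<langle>x, \<psi>\<rangle>\<^sup>2\<close> by \<open>\<langle>x, res a x\<rangle>\<close> times the form of \<open>A + a\<close> at \<open>\<psi>\<close>. Let \<open>\<psi>\<close> tend to \<open>x\<close>.\<close>

lemma resolvent_form_ge:
  assumes lsb: "lower_semibounded A" and lb: "lower_bound c" and ac: "0 < a + c"
    and x: "x \<in> form_domain A" "norm x = 1" and q: "quad_form A x \<le> u" and ua: "0 < u + a"
  shows "1 / (u + a) \<le> inner x (res a x)"
proof -
  obtain X where X: "\<And>n. X n \<in> Domain A" "X \<longlonglongrightarrow> x" "(\<lambda>n. op_form A (X n)) \<longlonglongrightarrow> quad_form A x"
    using quad_form_approximants[OF lsb x(1)] by blast
  note pos = positive_res[OF lb ac]
  have "(inner x (X n))\<^sup>2 \<le> inner x (res a x) * (op_form A (X n) + a * (norm (X n))\<^sup>2)" for n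
  proof -
    let ?z = "app A (X n) + a *\<^sub>R X n"
    have Rz: "res a ?z = X n" by (rule res_shift[OF lb ac X(1)])
    have "(inner x (res a ?z))\<^sup>2 \<le> inner x (res a x) * inner ?z (res a ?z)"
      by (rule positive_op_cauchy_schwarz[OF pos])
    also have "inner ?z (res a ?z) = op_form A (X n) + a * (norm (X n))\<^sup>2"
      unfolding Rz by (simp add: op_form_inner inner_simps power2_norm_eq_inner inner_commute)
    finally show ?thesis by (simp only: Rz)
  qed
  moreover have "(\<lambda>n. (inner x (X n))\<^sup>2) \<longlonglongrightarrow> (inner x x)\<^sup>2" by (intro tendsto_intros X)
  moreover have "(\<lambda>n. inner x (res a x) * (op_form A (X n) + a * (norm (X n))\<^sup>2))
      \<longlonglongrightarrow> inner x (res a x) * (quad_form A x + a * (norm x)\<^sup>2)" by (intro tendsto_intros X)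
  ultimately have "(inner x x)\<^sup>2 \<le> inner x (res a x) * (quad_form A x + a * (norm x)\<^sup>2)"
    by (intro LIMSEQ_le) auto
  also have "\<dots> \<le> inner x (res a x) * (u + a)"
    using q x(2) positive_opD(2)[OF pos, of x] by (intro mult_left_mono) auto
  finally have "1 \<le> inner x (res a x) * (u + a)" using x(2) by (simp add: power2_norm_eq_inner[symmetric])
  then show ?thesis using ua by (simp add: pos_divide_le_eq)
qed

lemma quad_form_lower_bound:
  assumes lsb: "lower_semibounded A" and lb: "lower_bound c" and x: "x \<in> form_domain A"
  shows "c * (norm x)\<^sup>2 \<le> quad_form A x"
proof -
  obtain X where X: "\<And>n. X n \<in> Domain A" "X \<longlonglongrightarrow> x" "(\<lambda>n. op_form A (X n)) \<longlonglongrightarrow> quad_form A x"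
    using quad_form_approximants[OF lsb x] by blast
  have "(\<lambda>n. c * (norm (X n))\<^sup>2) \<longlonglongrightarrow> c * (norm x)\<^sup>2" by (intro tendsto_intros X)
  moreover have "c * (norm (X n))\<^sup>2 \<le> op_form A (X n)" for n
    using lower_boundD[OF lb X(1)] by (simp add: op_form_inner)
  ultimately show ?thesis using X(3) by (intro LIMSEQ_le) auto
qed

lemma lower_bound_exists: "lower_semibounded A \<Longrightarrow> \<exists>c. lower_bound c"
  by (auto simp: lower_semibounded_def lower_bound_def Re_cinner)

lemma spectral_operator_spectral_measure:
  assumes lb: "lower_bound c"
  shows "spectral_operator A (spectral_measure A) c"
proof -
  have "projection_valued_measure (spectral_measure A) \<and> has_spectral_integral (spectral_measure A) (\<lambda>s. s) A"
    unfolding spectral_measure_def by (rule someI_ex[OF spectral_theorem[OF lb]])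
  then show ?thesis
    by (intro spectral_operator.intro spectral_operator_axioms.intro pvm.intro
        self_adjoint_operator_axioms lb) auto
qed

end

context spectral_operator begin

lemma heat_form_ge:
  assumes lsb: "lower_semibounded A" and t: "t > 0"
    and x: "x \<in> form_domain A" "norm x = 1" and q: "quad_form A x \<le> u"
  shows "exp (- t * u) \<le> inner x (bint (heat_fun t) x)"
proof -
  obtain X where X: "\<And>n. X n \<in> Domain A" "X \<longlonglongrightarrow> x" "(\<lambda>n. op_form A (X n)) \<longlonglongrightarrow> quad_form A x"
    using quad_form_approximants[OF lsb x(1)] by blast
  note T = bounded_clinear_bint[OF bnn_heat_fun[OF t]]
  have l1: "(\<lambda>n. exp (- t * u) * ((1 + t * u) * (norm (X n))\<^sup>2 - t * op_form A (X n)))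
      \<longlonglongrightarrow> exp (- t * u) * ((1 + t * u) * (norm x)\<^sup>2 - t * quad_form A x)" by (intro tendsto_intros X)
  have l2: "(\<lambda>n. inner (X n) (bint (heat_fun t) (X n))) \<longlonglongrightarrow> inner x (bint (heat_fun t) x)"
    by (intro tendsto_intros X bounded_clinear_tendsto[OF T])
  have le: "exp (- t * u) * ((1 + t * u) * (norm (X n))\<^sup>2 - t * op_form A (X n))
      \<le> inner (X n) (bint (heat_fun t) (X n))" for n
    using heat_tangent[OF t X(1), of u n] by (simp add: op_form_inner)
  have "exp (- t * u) * ((1 + t * u) * (norm x)\<^sup>2 - t * quad_form A x) \<le> inner x (bint (heat_fun t) x)"
    by (rule LIMSEQ_le[OF l1 l2]) (use le in blast)
  moreover have "exp (- t * u) * 1 \<le> exp (- t * u) * ((1 + t * u) * (norm x)\<^sup>2 - t * quad_form A x)"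
    using q t x(2) by (intro mult_left_mono) (auto simp: mult_left_mono)
  ultimately have "exp (- t * u) * 1 \<le> inner x (bint (heat_fun t) x)" by (rule order_trans[rotated])
  then show ?thesis by simp
qed

lemma reducing_projection_commutes:
  assumes V: "closed_csubspace V" and red: "reduces V A" and l: "c \<le> l"
  shows "orth_proj V (E {l..} x) = E {l..} (orth_proj V x)"
proof -
  have ac: "0 < (1 - c) + c" by simp
  have "orth_proj V \<circ> res (1 - c) = res (1 - c) \<circ> orth_proj V"
    using red in_resolvent_set[OF lb ac] unfolding reduces_def res_def by blast
  then have "orth_proj V (res (1 - c) x) = res (1 - c) (orth_proj V x)" for x
    by (simp add: fun_eq_iff)
  from commuting_projection_halfline[OF ac V this l] show ?thesis .
qed

end

theorem theorem1:
  fixes A B :: "'h::chilbert operator" and V :: "'h set" and m :: nat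
  assumes "self_adjoint A" and "lower_semibounded A"
    and "self_adjoint B" and "lower_semibounded B"
    and "form_domain B \<subseteq> form_domain A"
    and "\<forall>\<psi>\<in>form_domain B. quad_form A \<psi> \<le> quad_form B \<psi>"
    and "closed_csubspace V" and "reduces V B"
    and "\<forall>a::real. ereal a > - inf_spectrum A \<longrightarrow> trace_class (orth_proj V \<circ> inv_shift_pow B a m)"
  shows "(\<forall>n::nat. m < 2 ^ n \<longrightarrow> (\<forall>a::real. ereal a > - inf_spectrum A \<longrightarrow>
            proj_trace V (inv_shift_pow B a (2 ^ n)) \<le> proj_trace V (inv_shift_pow A a (2 ^ n)))) \<and>
         (\<forall>t>0. proj_trace V (heat_op t B) \<le> proj_trace V (heat_op t A))"
proof -
  interpret A: self_adjoint_operator A by unfold_locales (rule assms(1))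
  interpret B: self_adjoint_operator B by unfold_locales (rule assms(3))
  note lsbA = assms(2) and lsbB = assms(4) and V = assms(7) and red = assms(8)
  have form_le: "x \<in> form_domain A" "quad_form A x \<le> inner x (app B x)" if "x \<in> Domain B" for x
    using B.domain_subset_form_domain[OF lsbB that] B.quad_form_domain[OF lsbB that] assms(5,6)
    by (auto simp: B.op_form_inner)
  \<comment> \<open>a vector in a spectral bin of \<open>B\<close> has small energy for \<open>A\<close>\<close>
  have bin: "x \<in> form_domain A" "quad_form A x \<le> l + d"
    if S: "spectral_operator B (spectral_measure B) c" and x: "norm x = 1"
      and bin: "spectral_measure B {l..<l+d} x = x" for c l d x
  proof -
    interpret S: spectral_operator B "spectral_measure B" c by fact
    have "spectral_measure B {l..<l+d} x \<in> Domain B"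
      by (rule S.E_bounded_dom[where l=l and u="l + d"]) auto
    then have xd: "x \<in> Domain B" by (simp only: bin)
    show "x \<in> form_domain A" by (rule form_le(1)[OF xd])
    have "inner x (app B x) \<le> (l + d) * (norm x)\<^sup>2"
      using S.form_on_E_le[of "{l..<l+d}" "l + d" x] xd by (auto simp: bin subset_iff)
    with form_le(2)[OF xd] x show "quad_form A x \<le> l + d" by simp
  qed
  have null: "(\<lambda>N. 1 / real (Suc N)) \<longlonglongrightarrow> 0" by (intro LIMSEQ_Suc lim_1_over_n)
  have part1: "proj_trace V (inv_shift_pow B a (2 ^ n)) \<le> proj_trace V (inv_shift_pow A a (2 ^ n))"
    if a: "- inf_spectrum A < ereal a" for n a
  proof -
    obtain c where cA: "A.lower_bound c" and ac: "0 < a + c"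
      using A.lower_bound_above_spectrum[OF lsbA a] by blast
    have cB: "B.lower_bound c"
      unfolding B.lower_bound_def
    proof
      fix x assume "x \<in> Domain B"
      from form_le[OF this] A.quad_form_lower_bound[OF lsbA cA]
      show "c * (norm x)\<^sup>2 \<le> inner x (app B x)" by force
    qed
    note S = B.spectral_operator_spectral_measure[OF cB]
    interpret S: spectral_operator B "spectral_measure B" c by (rule S)
    let ?X = "B.res a ^^ (2 ^ n)" and ?Y = "A.res a ^^ (2 ^ n)"
    \<comment> \<open>the largest ratio of \<open>(s + a)\<^sup>-\<^sup>k\<close> at the two ends of a bin, attained in the first bin\<close>
    define K where "K d = ((a + c + d) / (a + c)) ^ (2 ^ n)" for d
    have step: "proj_trace V ?X \<le> ennreal (K d) * proj_trace V ?Y" if d: "0 < d" for d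
    proof (rule S.proj_trace_comparison[OF V, where c=c and d=d])
      show "spectral_measure B {c..} x = x" for x by (rule S.E_above) auto
      show "orth_proj V (spectral_measure B {l..} x) = spectral_measure B {l..} (orth_proj V x)"
        if "c \<le> l" for l x by (rule S.reducing_projection_commutes[OF V red that])
      show "positive_op ?X" by (rule positive_op_power_of_two[OF B.positive_res[OF cB ac]])
      show "positive_op ?Y" by (rule positive_op_power_of_two[OF A.positive_res[OF cA ac]])
      show "0 \<le> K d" using d ac by (simp add: K_def)
      show "0 < d" by (rule d)
      fix l x assume l: "c \<le> l" and x: "norm x = 1" and xb: "spectral_measure B {l..<l+d} x = x"
      have la: "0 < l + a" "0 < l + d + a" using l ac d by auto
      have "inner x (?X x) \<le> norm x * norm (?X x)" by (rule norm_cauchy_schwarz)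
      also have "\<dots> \<le> 1 / (l + a) ^ (2 ^ n)"
        using S.norm_res_pow_le[OF ac, of "{l..<l+d}" l x "2 ^ n"] la xb x by (auto simp: subset_iff)
      also have "\<dots> \<le> K d * (1 / (l + d + a)) ^ (2 ^ n)"
      proof -
        have "1 / (l + a) \<le> (a + c + d) / (a + c) * (1 / (l + d + a))"
        proof -
          have "(a + c) * (l + d + a) \<le> (a + c + d) * (l + a)"
            using l d by (simp add: algebra_simps mult_left_mono)
          moreover have "1 / p \<le> y / z" if "z \<le> y * p" "0 < p" "0 < z" for p y z :: real
            using that by (simp add: pos_divide_le_eq pos_le_divide_eq)
          ultimately have "1 / (l + a) \<le> (a + c + d) / ((a + c) * (l + d + a))"
            using la ac by simp
          then show ?thesis by simp
        qed
        from power_mono[OF this, of "2 ^ n"] show ?thesis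
          unfolding K_def power_mult_distrib using la by (simp add: power_divide)
      qed
      also have "\<dots> \<le> K d * inner x (?Y x)"
      proof (rule mult_left_mono)
        have "1 / (l + d + a) \<le> inner x (A.res a x)"
          by (rule A.resolvent_form_ge[OF lsbA cA ac bin(1)[OF S x xb] x bin(2)[OF S x xb] la(2)])
        then show "(1 / (l + d + a)) ^ (2 ^ n) \<le> inner x (?Y x)"
          using la by (intro inner_power_ge[OF A.positive_res[OF cA ac] x]) auto
        show "0 \<le> K d" using d ac by (simp add: K_def)
      qed
      finally show "inner x (?X x) \<le> K d * inner x (?Y x)" .
    qed
    have le: "proj_trace V ?X \<le> ennreal (K (1 / real (Suc N))) * proj_trace V ?Y" for N
      by (rule step) simp
    have "(\<lambda>N. K (1 / real (Suc N))) \<longlonglongrightarrow> ((a + c + 0) / (a + c)) ^ (2 ^ n)"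
      unfolding K_def by (intro tendsto_intros null) (use ac in simp)
    then have "(\<lambda>N. K (1 / real (Suc N))) \<longlonglongrightarrow> 1" using ac by simp
    then have "proj_trace V ?X \<le> proj_trace V ?Y" by (rule ennreal_le_limit_factor[OF le])
    then show ?thesis by (simp add: inv_shift_pow_def A.res_def B.res_def)
  qed
  have part2: "proj_trace V (heat_op t B) \<le> proj_trace V (heat_op t A)" if t: "t > 0" for t
  proof -
    obtain cA cB where cA: "A.lower_bound cA" and cB: "B.lower_bound cB"
      using A.lower_bound_exists[OF lsbA] B.lower_bound_exists[OF lsbB] by blast
    note S = B.spectral_operator_spectral_measure[OF cB]
    interpret S: spectral_operator B "spectral_measure B" cB by (rule S)
    interpret SA: spectral_operator A "spectral_measure A" cA
      by (rule A.spectral_operator_spectral_measure[OF cA])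
    let ?X = "S.bint (S.heat_fun t)" and ?Y = "SA.bint (SA.heat_fun t)"
    have step: "proj_trace V ?X \<le> ennreal (exp (t * d)) * proj_trace V ?Y" if d: "0 < d" for d
    proof (rule S.proj_trace_comparison[OF V, where c=cB and d=d])
      show "spectral_measure B {cB..} x = x" for x by (rule S.E_above) auto
      show "orth_proj V (spectral_measure B {l..} x) = spectral_measure B {l..} (orth_proj V x)"
        if "cB \<le> l" for l x by (rule S.reducing_projection_commutes[OF V red that])
      show "positive_op ?X" by (rule S.positive_bint[OF S.bnn_heat_fun[OF t]])
      show "positive_op ?Y" by (rule SA.positive_bint[OF SA.bnn_heat_fun[OF t]])
      show "0 \<le> exp (t * d)" by simp
      show "0 < d" by (rule d)
      fix l x assume l: "cB \<le> l" and x: "norm x = 1" and xb: "spectral_measure B {l..<l+d} x = x"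
      have "inner x (?X x) \<le> exp (- t * l) * (norm x)\<^sup>2"
        by (rule S.heat_le[OF t _ _ xb]) auto
      also have "\<dots> = exp (t * d) * exp (- t * (l + d))"
        using x by (simp add: exp_add[symmetric] algebra_simps)
      also have "\<dots> \<le> exp (t * d) * inner x (?Y x)"
        using SA.heat_form_ge[OF lsbA t bin(1)[OF S x xb] x bin(2)[OF S x xb]] by (intro mult_left_mono) auto
      finally show "inner x (?X x) \<le> exp (t * d) * inner x (?Y x)" .
    qed
    have le: "proj_trace V ?X \<le> ennreal (exp (t * (1 / real (Suc N)))) * proj_trace V ?Y" for N
      by (rule step) simp
    have "(\<lambda>N. exp (t * (1 / real (Suc N)))) \<longlonglongrightarrow> exp (t * 0)" by (intro tendsto_intros null)
    then have "(\<lambda>N. exp (t * (1 / real (Suc N)))) \<longlonglongrightarrow> 1" by (simp only: mult_zero_right exp_zero)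
    then have "proj_trace V ?X \<le> proj_trace V ?Y" by (rule ennreal_le_limit_factor[OF le])
    then show ?thesis by (simp add: S.heat_op_eq[OF refl t] SA.heat_op_eq[OF refl t])
  qed
  show ?thesis using part1 part2 by blast
qed

end
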